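(* There exists a recurrent, recursively enumerable bi-infinite word $\xi$ with decidable MSO-theory such that there is no recursively enumerable uniformly homogeneous pair for $\xi$.
   Context: A bi-infinite word is a map $\xi\colon\mathbb Z\to\{0,1\}$, viewed as the structure $(\mathbb Z,\le,\xi^{-1}(1))$; its MSO-theory is the set of monadic second-order sentences over $\{\le,P\}$ true in it. $\xi$ is recursively enumerable if $\{2i\mid i\ge0,\xi(i)=1\}\cup\{2i+1\mid i>0,\xi(-i)=1\}$ is recursively enumerable. $F(\xi)$ is the set of factors $\xi[i,j]=\xi(i)\cdots\xi(j)$ ($i\le j$) plus the empty word; $\xi$ is recurrent if $F(\xi)=F(\xi(-\infty,i])=F(\xi[i,\infty))$ for all $i\in\mathbb Z$. Two finite words are $k$-equivalent ($\equiv_k$) if they satisfy the same MSO-sentences of quantifier rank at most $k$. For $u,v,w\in\{0,1\}^+$, $k\in\mathbb N$ and infinite $H_\leftarrow,H_\rightarrow\subseteq\mathbb Z$, $(H_\leftarrow,H_\rightarrow)$ is a $k$-homogeneous factorisation of $\xi$ into $(u,v,w)$ if $\xi[i,j-1]\equiv_k u$ for all $i<j$ in $H_\leftarrow$, $\xi[i,j-1]\equiv_k v$ for all $i\in H_\leftarrow$, $j\in H_\rightarrow$ with $i<j$, and $\xi[i,j-1]\equiv_k w$ for all $i<j$ in $H_\rightarrow$; it is $k$-homogeneous if it is such a factorisation into some $(u,v,w)$. Writing $H_\leftarrow=\{h_0^->h_1^->\cdots\}$ and $H_\rightarrow=\{h_0^+<h_1^+<\cdots\}$, the pair is uniformly homogeneous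 for $\xi$ if for every $k$ the pair $(\{h_i^-\mid i\ge k\},\{h_i^+\mid i\ge k\})$ is $k$-homogeneous for $\xi$. The pair is recursively enumerable if both sets are recursively enumerable subsets of $\mathbb Z$ (under a standard effective coding of $\mathbb Z$ by $\mathbb N$). *)

theory Defs
  imports "HOL-Library.Nat_Bijection"
begin

section \<open>Computability\<close>

text \<open>
  Kleene's partial recursive functions. Terms carry no arity; applied to argument lists of a
  fixed length, each term computes a partial recursive function, undefined where arities do not
  fit (\<open>RZero\<close> is the constant zero of every arity).
\<close>

datatype recf =
    RZero
  | RSucc
  | RProj nat
  | RComp recf "recf list"
  | RPrim recf recf
  | RMu recf

fun reval :: "recf \<Rightarrow> nat list \<Rightarrow> nat option" where
  "reval RZero xs = Some 0"
| "reval RSucc xs = (case xs of [x] \<Rightarrow> Some (Suc x) | _ \<Rightarrow> None)"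
| "reval (RProj i) xs = (if i < length xs then Some (xs ! i) else None)"
| "reval (RComp f gs) xs = Option.bind (those (map (\<lambda>g. reval g xs) gs)) (reval f)"
| "reval (RPrim f g) xs =
     (case xs of
        [] \<Rightarrow> None
      | n # ys \<Rightarrow>
          rec_nat (reval f ys) (\<lambda>m r. Option.bind r (\<lambda>y. reval g (m # y # ys))) n)"
| "reval (RMu f) xs =
     (if \<exists>n. reval f (n # xs) = Some 0 \<and> (\<forall>m<n. \<exists>y. reval f (m # xs) = Some (Suc y))
      then Some (LEAST n. reval f (n # xs) = Some 0)
      else None)"

definition re_set :: "nat set \<Rightarrow> bool" where
  "re_set A \<longleftrightarrow> (\<exists>f. A = {n. reval f [n] \<noteq> None})"

definition decidable_set :: "nat set \<Rightarrow> bool" where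
  "decidable_set A \<longleftrightarrow> (\<exists>f. \<forall>n. reval f [n] = Some (if n \<in> A then 1 else 0))"

definition re_int_set :: "int set \<Rightarrow> bool" where
  "re_int_set H \<longleftrightarrow> re_set (int_encode ` H)"


section \<open>Monadic second-order logic over labelled linear orders\<close>

text \<open>
  First-order and set variables are two separate sorts, each named by natural numbers. The
  remaining connectives and the universal quantifiers are definable without increasing the
  quantifier rank.
\<close>

datatype mso =
    Le nat nat
  | Eq nat nat
  | InP nat
  | Mem nat nat
  | Neg mso
  | Conj mso mso
  | ExElem nat mso
  | ExSet nat mso

primrec sat :: "'a::linorder set \<Rightarrow> ('a \<Rightarrow> bool) \<Rightarrow> (nat \<Rightarrow> 'a) \<Rightarrow> (nat \<Rightarrow> 'a set) \<Rightarrow> mso \<Rightarrow> bool"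
where
  "sat D P e E (Le x y) \<longleftrightarrow> e x \<le> e y"
| "sat D P e E (Eq x y) \<longleftrightarrow> e x = e y"
| "sat D P e E (InP x) \<longleftrightarrow> P (e x)"
| "sat D P e E (Mem x X) \<longleftrightarrow> e x \<in> E X"
| "sat D P e E (Neg \<phi>) \<longleftrightarrow> \<not> sat D P e E \<phi>"
| "sat D P e E (Conj \<phi> \<psi>) \<longleftrightarrow> sat D P e E \<phi> \<and> sat D P e E \<psi>"
| "sat D P e E (ExElem x \<phi>) \<longleftrightarrow> (\<exists>d\<in>D. sat D P (e(x := d)) E \<phi>)"
| "sat D P e E (ExSet X \<phi>) \<longleftrightarrow> (\<exists>S\<subseteq>D. sat D P e (E(X := S)) \<phi>)"

primrec free_elem :: "mso \<Rightarrow> nat set" where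
  "free_elem (Le x y) = {x, y}"
| "free_elem (Eq x y) = {x, y}"
| "free_elem (InP x) = {x}"
| "free_elem (Mem x X) = {x}"
| "free_elem (Neg \<phi>) = free_elem \<phi>"
| "free_elem (Conj \<phi> \<psi>) = free_elem \<phi> \<union> free_elem \<psi>"
| "free_elem (ExElem x \<phi>) = free_elem \<phi> - {x}"
| "free_elem (ExSet X \<phi>) = free_elem \<phi>"

primrec free_set :: "mso \<Rightarrow> nat set" where
  "free_set (Le x y) = {}"
| "free_set (Eq x y) = {}"
| "free_set (InP x) = {}"
| "free_set (Mem x X) = {X}"
| "free_set (Neg \<phi>) = free_set \<phi>"
| "free_set (Conj \<phi> \<psi>) = free_set \<phi> \<union> free_set \<psi>"
| "free_set (ExElem x \<phi>) = free_set \<phi>"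
| "free_set (ExSet X \<phi>) = free_set \<phi> - {X}"

definition sentence :: "mso \<Rightarrow> bool" where
  "sentence \<phi> \<longleftrightarrow> free_elem \<phi> = {} \<and> free_set \<phi> = {}"

primrec qrank :: "mso \<Rightarrow> nat" where
  "qrank (Le x y) = 0"
| "qrank (Eq x y) = 0"
| "qrank (InP x) = 0"
| "qrank (Mem x X) = 0"
| "qrank (Neg \<phi>) = qrank \<phi>"
| "qrank (Conj \<phi> \<psi>) = max (qrank \<phi>) (qrank \<psi>)"
| "qrank (ExElem x \<phi>) = Suc (qrank \<phi>)"
| "qrank (ExSet X \<phi>) = Suc (qrank \<phi>)"

text \<open>
  Only used for sentences, whose value does not depend on the assignments \<open>e\<close> and \<open>E\<close>.
\<close>

definition models :: "'a::linorder set \<Rightarrow> ('a \<Rightarrow> bool) \<Rightarrow> mso \<Rightarrow> bool" where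
  "models D P \<phi> \<longleftrightarrow> (\<forall>e E. sat D P e E \<phi>)"

primrec mso_code :: "mso \<Rightarrow> nat" where
  "mso_code (Le x y) = prod_encode (0, prod_encode (x, y))"
| "mso_code (Eq x y) = prod_encode (1, prod_encode (x, y))"
| "mso_code (InP x) = prod_encode (2, x)"
| "mso_code (Mem x X) = prod_encode (3, prod_encode (x, X))"
| "mso_code (Neg \<phi>) = prod_encode (4, mso_code \<phi>)"
| "mso_code (Conj \<phi> \<psi>) = prod_encode (5, prod_encode (mso_code \<phi>, mso_code \<psi>))"
| "mso_code (ExElem x \<phi>) = prod_encode (6, prod_encode (x, mso_code \<phi>))"
| "mso_code (ExSet X \<phi>) = prod_encode (7, prod_encode (X, mso_code \<phi>))"


section \<open>Words\<close>

text \<open>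
  The alphabet \<open>{0,1}\<close> is the type \<^typ>\<open>bool\<close>, with \<^term>\<open>True\<close> for the letter 1.
\<close>

definition mso_theory :: "(int \<Rightarrow> bool) \<Rightarrow> mso set" where
  "mso_theory \<xi> = {\<phi>. sentence \<phi> \<and> models UNIV \<xi> \<phi>}"

definition decidable_mso_theory :: "(int \<Rightarrow> bool) \<Rightarrow> bool" where
  "decidable_mso_theory \<xi> \<longleftrightarrow> decidable_set (mso_code ` mso_theory \<xi>)"

definition re_word :: "(int \<Rightarrow> bool) \<Rightarrow> bool" where
  "re_word \<xi> \<longleftrightarrow> re_set ({2 * i | i. \<xi> (int i)} \<union> {2 * i + 1 | i. i > 0 \<and> \<xi> (- int i)})"

definition factor :: "(int \<Rightarrow> bool) \<Rightarrow> int \<Rightarrow> int \<Rightarrow> bool list" where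
  "factor \<xi> i j = map \<xi> [i..j]"

text \<open>
  \<open>I\<close> is the interval of positions to which the word is restricted.
\<close>

definition factors :: "(int \<Rightarrow> bool) \<Rightarrow> int set \<Rightarrow> bool list set" where
  "factors \<xi> I = insert [] {factor \<xi> i j | i j. i \<le> j \<and> {i..j} \<subseteq> I}"

definition recurrent :: "(int \<Rightarrow> bool) \<Rightarrow> bool" where
  "recurrent \<xi> \<longleftrightarrow>
     (\<forall>i. factors \<xi> UNIV = factors \<xi> {..i} \<and> factors \<xi> UNIV = factors \<xi> {i..})"

definition word_models :: "bool list \<Rightarrow> mso \<Rightarrow> bool" where
  "word_models u \<phi> \<longleftrightarrow> models {..<length u} (\<lambda>i. u ! i) \<phi>"

definition k_equiv :: "nat \<Rightarrow> bool list \<Rightarrow> bool list \<Rightarrow> bool" where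
  "k_equiv k u v \<longleftrightarrow>
     (\<forall>\<phi>. sentence \<phi> \<and> qrank \<phi> \<le> k \<longrightarrow> (word_models u \<phi> \<longleftrightarrow> word_models v \<phi>))"

definition homogeneous_factorisation ::
  "nat \<Rightarrow> (int \<Rightarrow> bool) \<Rightarrow> int set \<Rightarrow> int set \<Rightarrow> bool list \<Rightarrow> bool list \<Rightarrow> bool list \<Rightarrow> bool"
where
  "homogeneous_factorisation k \<xi> HL HR u v w \<longleftrightarrow>
     infinite HL \<and> infinite HR \<and> u \<noteq> [] \<and> v \<noteq> [] \<and> w \<noteq> [] \<and>
     (\<forall>i\<in>HL. \<forall>j\<in>HL. i < j \<longrightarrow> k_equiv k (factor \<xi> i (j - 1)) u) \<and>
     (\<forall>i\<in>HL. \<forall>j\<in>HR. i < j \<longrightarrow> k_equiv k (factor \<xi> i (j - 1)) v) \<and>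
     (\<forall>i\<in>HR. \<forall>j\<in>HR. i < j \<longrightarrow> k_equiv k (factor \<xi> i (j - 1)) w)"

definition homogeneous :: "nat \<Rightarrow> (int \<Rightarrow> bool) \<Rightarrow> int set \<Rightarrow> int set \<Rightarrow> bool" where
  "homogeneous k \<xi> HL HR \<longleftrightarrow> (\<exists>u v w. homogeneous_factorisation k \<xi> HL HR u v w)"

text \<open>
  The enumerations \<open>hm\<close> (decreasing) and \<open>hp\<close> (increasing) exist only if \<open>HL\<close> is bounded above
  and \<open>HR\<close> is bounded below; they are then uniquely determined.
\<close>

definition uniformly_homogeneous :: "(int \<Rightarrow> bool) \<Rightarrow> int set \<Rightarrow> int set \<Rightarrow> bool" where
  "uniformly_homogeneous \<xi> HL HR \<longleftrightarrow>
     (\<exists>hm hp :: nat \<Rightarrow> int.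
        (\<forall>i j. i < j \<longrightarrow> hm j < hm i) \<and> strict_mono hp \<and> HL = range hm \<and> HR = range hp \<and>
        (\<forall>k. homogeneous k \<xi> (hm ` {k..}) (hp ` {k..})))"

end

(*
  Call a bi-infinite word rich if every finite word occurs arbitrarily far to the left and to the
  right. All rich words are recurrent and have the same MSO-theory. Indeed, only finitely many
  rank-k types of finite words exist, and they form a semigroup. If e is an idempotent of its minimal
  ideal, then e S e is a group, and by pigeonhole a rich word can be cut into blocks of types
  ... e e g e e ... with g in that group; if x is the inverse of g, then ... x g x g e e ... can be cut
  into ... e e g e e ... and into ... e e e e ..., so that g does not matter. The truth of a sentence in a word
  ... a a b c c ... is determined by the types a, b, c, one quantifier at a time: by Ramsey's theorem,
  expanding such a word by a set gives again a word of this shape, whose types are products of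
  expansions of a, b and c. As types are hereditarily finite sets, all this is computable.

  It remains to find a rich word which is recursively enumerable and in which the first run of m zeros
  lies beyond the reach of every computable function of m. The nonnegative half is cut into blocks;
  block s has room for the word coded by n = pfst s, but is overwritten with ones once a certificate
  larger than s is found, where the certificates of interest are the least ones showing that a program
  e <= n enumerates m + 4 numbers, m <= n. If H+ were enumerated by e, then by uniform
  homogeneity there would be m + 1 consecutive zeros between its elements of index m + 2 and m + 3,
  within a surviving block s with n >= m, whereas the least certificate for (e, m) is larger than s.
*)

theory Submission
  imports Defs "HOL-Library.Ramsey"
begin

section \<open>Computable functions and predicates\<close>

text \<open>Two demands conflict: every finite word must keep occurring, yet blocks have to be
  destroyed for the sake of infinitely many programs. They are reconciled by making the damage
  finite for each word: blocks for the word coded by \<open>n\<close> answer only to pairs (e, m)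
  with both components at most \<open>n\<close>, and each such pair strikes through a single
  certificate. Erasure only ever turns zeros into ones, so the ones remain recursively enumerable;
  and since the decision procedure never consults the word, the noncomputable erasures cannot
  disturb it. Types are numbers coding nested finite sets instead of classes of formulas, so that
  products, closures and truth reduce to bounded search and course-of-values recursion on codes. A
  certificate is a number that bounds every number whose enumeration it proves; this is how a
  statement about programs becomes one about positions. Only the checking of certificates has to be
  computable, so local inspection of a derivation replaces a universal program.\<close>

definition pfst :: "nat \<Rightarrow> nat" where "pfst n = fst (prod_decode n)"
definition psnd :: "nat \<Rightarrow> nat" where "psnd n = snd (prod_decode n)"

lemma pfst_encode [simp]: "pfst (prod_encode (a, b)) = a"
  by (simp add: pfst_def)

lemma psnd_encode [simp]: "psnd (prod_encode (a, b)) = b"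
  by (simp add: psnd_def)

lemma prod_encode_pfst_psnd [simp]: "prod_encode (pfst n, psnd n) = n"
  by (simp add: pfst_def psnd_def)

lemma pfst_le: "pfst n \<le> n"
  by (metis le_prod_encode_1 prod_encode_pfst_psnd)

lemma psnd_le: "psnd n \<le> n"
  by (metis le_prod_encode_2 prod_encode_pfst_psnd)

text \<open>A positive tag makes the payload strictly smaller, which drives the recursions on codes
  of formulas. Tag 0 must be excluded because \<open>prod_encode (0, 0) = 0\<close>.\<close>

lemma psnd_less: "0 < pfst n \<Longrightarrow> psnd n < n"
proof -
  assume "0 < pfst n"
  then obtain k where k: "pfst n = Suc k" by (cases "pfst n") auto
  have "n = prod_encode (Suc k, psnd n)" by (metis k prod_encode_pfst_psnd)
  then have "n = triangle (k + psnd n) + Suc (k + psnd n) + Suc k"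
    by (simp add: prod_encode_def)
  then show ?thesis by linarith
qed

lemma psnd_0 [simp]: "psnd 0 = 0"
  using psnd_le[of 0] by simp

lemma triangle_mono: "m \<le> n \<Longrightarrow> triangle m \<le> triangle n"
  by (induction n) (auto simp: le_Suc_eq)

lemma prod_encode_mono: "a \<le> c \<Longrightarrow> b \<le> d \<Longrightarrow> prod_encode (a, b) \<le> prod_encode (c, d)"
  by (simp add: prod_encode_def add_mono triangle_mono)

lemma prod_encode_strict_mono:
  assumes "a < c" "b < d" shows "prod_encode (a, b) < prod_encode (c, d)"
proof -
  have "prod_encode (a, b) \<le> prod_encode (c, d)" using assms by (intro prod_encode_mono) auto
  moreover have "prod_encode (a, b) \<noteq> prod_encode (c, d)" using assms by auto
  ultimately show ?thesis by linarith
qed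

lemma set_decode_less: "a \<in> set_decode s \<Longrightarrow> a < s"
proof -
  assume "a \<in> set_decode s"
  then have "s div 2 ^ a \<noteq> 0" unfolding set_decode_def by (metis (no_types, lifting) even_zero mem_Collect_eq)
  then have "2 ^ a \<le> s" by (meson div_less not_le)
  then show "a < s" using less_exp[of a] by linarith
qed

lemma set_decode_inject: "set_decode a = set_decode b \<longleftrightarrow> a = b"
  by (metis set_decode_inverse)

lemma set_encode_less_exp: "A \<subseteq> {..<n} \<Longrightarrow> set_encode A < 2 ^ n"
proof -
  assume "A \<subseteq> {..<n}"
  then have "set_encode A \<le> sum ((^) 2) {..<n}"
    unfolding set_encode_def by (intro sum_mono2) auto
  also have "\<dots> < 2 ^ n" by (induction n) auto
  finally show ?thesis .
qed

text \<open>
  Functions of several arguments are treated as unary ones, applied to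
  \<^const>\<open>prod_encode\<close> tuples.
\<close>

definition cfun :: "(nat \<Rightarrow> nat) \<Rightarrow> bool" where
  "cfun F \<longleftrightarrow> (\<exists>f. \<forall>x. reval f [x] = Some (F x))"

definition cfun2 :: "(nat \<Rightarrow> nat \<Rightarrow> nat) \<Rightarrow> bool" where
  "cfun2 F \<longleftrightarrow> (\<exists>f. \<forall>x y. reval f [x, y] = Some (F x y))"

definition cpred :: "(nat \<Rightarrow> bool) \<Rightarrow> bool" where
  "cpred P \<longleftrightarrow> cfun (\<lambda>x. of_bool (P x))"

lemma cfun_cong: "cfun f \<Longrightarrow> (\<And>x. f x = g x) \<Longrightarrow> cfun g"
  by (simp add: cfun_def)

lemma cfun_comp: "cfun F \<Longrightarrow> cfun g \<Longrightarrow> cfun (\<lambda>x. F (g x))"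
proof -
  assume "cfun F" "cfun g"
  then obtain f f' where "\<forall>x. reval f [x] = Some (F x)" "\<forall>x. reval f' [x] = Some (g x)"
    unfolding cfun_def by blast
  then have "\<forall>x. reval (RComp f [f']) [x] = Some (F (g x))" by simp
  then show ?thesis unfolding cfun_def by blast
qed

lemma cfun_comp2: "cfun2 F \<Longrightarrow> cfun g \<Longrightarrow> cfun h \<Longrightarrow> cfun (\<lambda>x. F (g x) (h x))"
proof -
  assume "cfun2 F" "cfun g" "cfun h"
  then obtain f f' f'' where "\<forall>x y. reval f [x, y] = Some (F x y)"
    "\<forall>x. reval f' [x] = Some (g x)" "\<forall>x. reval f'' [x] = Some (h x)"
    unfolding cfun_def cfun2_def by blast
  then have "\<forall>x. reval (RComp f [f', f'']) [x] = Some (F (g x) (h x))" by simp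
  then show ?thesis unfolding cfun_def by blast
qed

lemma cfun_id: "cfun (\<lambda>x. x)"
  unfolding cfun_def by (rule exI[of _ "RProj 0"]) simp

lemma cfun_Suc': "cfun Suc"
  unfolding cfun_def by (rule exI[of _ RSucc]) simp

lemmas cfun_Suc = cfun_comp[OF cfun_Suc']

lemma cfun_const: "cfun (\<lambda>x. c)"
proof (induction c)
  case 0
  show ?case unfolding cfun_def by (rule exI[of _ RZero]) simp
next
  case (Suc c)
  from cfun_Suc[OF this] show ?case .
qed

text \<open>Bootstrapping form: as long as the projections of pairs are not known to be computable,
  the ternary step function has to be supplied as a program. \<open>cfun_rec\<close> supersedes
  it.\<close>

lemma cfun2_prim:
  assumes a: "cfun a" and b: "\<And>m y x. reval g [m, y, x] = Some (b m y x)"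
  shows "cfun2 (\<lambda>n x. rec_nat (a x) (\<lambda>m y. b m y x) n)"
proof -
  from a obtain f where f: "\<forall>x. reval f [x] = Some (a x)" unfolding cfun_def by blast
  have "reval (RPrim f g) [n, x] = Some (rec_nat (a x) (\<lambda>m y. b m y x) n)" for n x
    by (induction n) (simp_all add: f b)
  then show ?thesis unfolding cfun2_def by blast
qed

lemma cfun_prim1:
  assumes b: "\<And>m y. reval g [m, y] = Some (b m y)"
  shows "cfun (rec_nat c b)"
proof -
  \<comment> \<open>With no parameters, \<open>RPrim\<close> evaluates its base program on the empty
    list, so a constant of arity 0 is required.\<close>
  have *: "\<exists>f. reval f [] = Some c" for c
  proof (induction c)
    case 0 show ?case by (rule exI[of _ RZero]) simp
  next
    case (Suc c)
    then obtain f where "reval f [] = Some c" by blast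
    then have "reval (RComp RSucc [f]) [] = Some (Suc c)" by simp
    then show ?case by blast
  qed
  then obtain f where f: "reval f [] = Some c" by blast
  have "reval (RPrim f g) [n] = Some (rec_nat c b n)" for n
    by (induction n) (simp_all add: f b)
  then show ?thesis unfolding cfun_def by blast
qed

lemma cfun2_add: "cfun2 (+)"
proof -
  have "cfun2 (\<lambda>n x. rec_nat x (\<lambda>m y. Suc y) n)"
    by (rule cfun2_prim[of _ "RComp RSucc [RProj 1]"]) (simp_all add: cfun_id)
  moreover have "rec_nat x (\<lambda>m y. Suc y) n = n + x" for n x by (induction n) auto
  ultimately show ?thesis by (simp add: fun_eq_iff)
qed

lemmas cfun_add = cfun_comp2[OF cfun2_add]

lemma cfun2_mult: "cfun2 (*)"
proof -
  from cfun2_add obtain f where f: "\<forall>x y. reval f [x, y] = Some (x + y)" unfolding cfun2_def by blast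
  have "cfun2 (\<lambda>n x. rec_nat 0 (\<lambda>m y. y + x) n)"
    by (rule cfun2_prim[of _ "RComp f [RProj 1, RProj 2]"]) (simp_all add: cfun_const f numeral_2_eq_2)
  moreover have "rec_nat 0 (\<lambda>m y. y + x) n = n * x" for n x by (induction n) auto
  ultimately show ?thesis by (simp add: fun_eq_iff)
qed

lemmas cfun_mult = cfun_comp2[OF cfun2_mult]

lemma cfun_pred: "cfun (\<lambda>x. x - 1)"
proof -
  have "cfun (rec_nat 0 (\<lambda>m y. m))"
    by (rule cfun_prim1[of "RProj 0"]) simp
  moreover have "rec_nat 0 (\<lambda>m y. m) = (\<lambda>x. x - 1)"
  proof
    show "rec_nat 0 (\<lambda>m y. m) x = x - 1" for x :: nat by (cases x) auto
  qed
  ultimately show ?thesis by simp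
qed

text \<open>The arguments are swapped since the recursion runs over its first argument, which here
  counts the decrements.\<close>

lemma cfun2_diff: "cfun2 (\<lambda>x y. y - x)"
proof -
  from cfun_pred obtain f where f: "\<forall>x. reval f [x] = Some (x - 1)" unfolding cfun_def by blast
  have "cfun2 (\<lambda>n x. rec_nat x (\<lambda>m y. y - 1) n)"
    by (rule cfun2_prim[of _ "RComp f [RProj 1]"]) (simp_all add: cfun_id f)
  moreover have "rec_nat x (\<lambda>m y. y - 1) n = x - n" for n x by (induction n) auto
  ultimately show ?thesis by (simp add: fun_eq_iff)
qed

lemma cfun_diff: "cfun g \<Longrightarrow> cfun h \<Longrightarrow> cfun (\<lambda>x. g x - h x)"
  using cfun_comp2[OF cfun2_diff, of h g] by simp

lemma cfun_triangle': "cfun triangle"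
proof -
  from cfun2_add obtain f where f: "\<forall>x y. reval f [x, y] = Some (x + y)" unfolding cfun2_def by blast
  have "cfun (rec_nat 0 (\<lambda>m y. y + Suc m))"
    by (rule cfun_prim1[of "RComp f [RProj 1, RComp RSucc [RProj 0]]"]) (simp_all add: f)
  moreover have "rec_nat 0 (\<lambda>m y. y + Suc m) x = triangle x" for x by (induction x) auto
  ultimately show ?thesis by (rule cfun_cong)
qed

lemmas cfun_triangle = cfun_comp[OF cfun_triangle']

lemma cfun2_pair: "cfun2 (\<lambda>x y. prod_encode (x, y))"
proof -
  from cfun2_add obtain f where f: "\<forall>x y. reval f [x, y] = Some (x + y)" unfolding cfun2_def by blast
  from cfun_triangle' obtain g where g: "\<forall>x. reval g [x] = Some (triangle x)" unfolding cfun_def by blast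
  have "\<forall>x y. reval (RComp f [RComp g [f], RProj 0]) [x, y] = Some (prod_encode (x, y))"
    by (simp add: f g prod_encode_def)
  then show ?thesis unfolding cfun2_def by blast
qed

lemmas cfun_pair = cfun_comp2[OF cfun2_pair]

text \<open>\<open>RMu\<close> searches for the value 0, so the program has to return 0 for true; as
  it is total, the values before the first zero are defined successors.\<close>

lemma reval_RMu_total:
  assumes f: "\<And>n. reval f (n # xs) = Some (of_bool (\<not> P n))" and ex: "\<exists>n. P n"
  shows "reval (RMu f) xs = Some (LEAST n. P n)"
proof -
  have "P (LEAST n. P n)" using ex by (metis LeastI_ex)
  moreover have "\<forall>m < (LEAST n. P n). \<exists>y. reval f (m # xs) = Some (Suc y)"
  proof (intro allI impI)
    fix m assume "m < (LEAST n. P n)"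
    then have "\<not> P m" by (rule not_less_Least)
    then show "\<exists>y. reval f (m # xs) = Some (Suc y)" by (simp add: f)
  qed
  ultimately have "\<exists>n. reval f (n # xs) = Some 0 \<and> (\<forall>m<n. \<exists>y. reval f (m # xs) = Some (Suc y))"
    by (intro exI[of _ "LEAST n. P n"]) (auto simp: f)
  moreover have "(LEAST n. reval f (n # xs) = Some 0) = (LEAST n. P n)"
    by (simp add: f)
  ultimately show ?thesis by simp
qed

lemma pfst_psnd_triangle: "x = triangle (pfst x + psnd x) + pfst x"
proof -
  have "prod_encode (pfst x, psnd x) = triangle (pfst x + psnd x) + pfst x"
    by (simp only: prod_encode_def case_prod_conv)
  then show ?thesis by (simp only: prod_encode_pfst_psnd)
qed

text \<open>Inverts Cantor pairing by search: \<open>pfst x + psnd x\<close> is the diagonal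
  containing \<open>x\<close>, and once it is known both projections follow by subtraction.\<close>

lemma triangle_root:
  "(LEAST w. x < triangle (Suc w)) = pfst x + psnd x"
proof -
  let ?s = "pfst x + psnd x"
  have x: "x = triangle ?s + pfst x"
    by (rule pfst_psnd_triangle)
  show ?thesis
  proof (rule Least_equality)
    have "triangle (Suc ?s) = triangle ?s + Suc ?s" by (rule triangle_Suc)
    then show "x < triangle (Suc ?s)" using x by linarith
    fix w assume w: "x < triangle (Suc w)"
    show "?s \<le> w"
    proof (rule ccontr)
      assume "\<not> ?s \<le> w"
      then have "triangle (Suc w) \<le> triangle ?s" by (intro triangle_mono) simp
      then show False using w x by linarith
    qed
  qed
qed

lemma cfun_root: "cfun (\<lambda>x. pfst x + psnd x)"
proof -
  from cfun2_diff obtain f where f: "\<forall>x y. reval f [x, y] = Some (y - x)" unfolding cfun2_def by blast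
  from cfun_triangle' obtain g where g: "\<forall>x. reval g [x] = Some (triangle x)" unfolding cfun_def by blast
  from cfun_diff[OF cfun_const[of 1] cfun_diff[OF cfun_const[of 1] cfun_id]]
  obtain s where s: "\<forall>x. reval s [x] = Some (1 - (1 - x))" unfolding cfun_def by blast
  let ?f = "RComp s [RComp f [RComp g [RComp RSucc [RProj 0]], RComp RSucc [RProj 1]]]"
  have "reval ?f (n # [x]) = Some (of_bool (\<not> x < triangle (Suc n)))" for n x
    by (simp add: f g s)
  then have "\<forall>x. reval (RMu ?f) [x] = Some (LEAST w. x < triangle (Suc w))"
  proof (intro allI reval_RMu_total)
    fix x
    have "x < triangle (Suc x)" by simp
    then show "\<exists>w. x < triangle (Suc w)" by blast
  qed auto
  then show ?thesis unfolding cfun_def triangle_root by blast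
qed

lemma cfun_pfst': "cfun pfst"
proof -
  have "cfun (\<lambda>x. x - triangle (pfst x + psnd x))"
    by (intro cfun_diff cfun_id cfun_triangle cfun_root)
  moreover have "x - triangle (pfst x + psnd x) = pfst x" for x
    using pfst_psnd_triangle[of x] by linarith
  ultimately show ?thesis by (rule cfun_cong)
qed

lemma cfun_psnd': "cfun psnd"
proof -
  have "cfun (\<lambda>x. (pfst x + psnd x) - pfst x)"
    by (intro cfun_diff cfun_root cfun_pfst')
  then show ?thesis by simp
qed

lemmas cfun_pfst = cfun_comp[OF cfun_pfst'] and cfun_psnd = cfun_comp[OF cfun_psnd']

lemma cfun_rec:
  assumes a: "cfun a" and b: "cfun (\<lambda>z. b (pfst z) (pfst (psnd z)) (psnd (psnd z)))" and n: "cfun n"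
  shows "cfun (\<lambda>x. rec_nat (a x) (\<lambda>m y. b m y x) (n x))"
proof -
  from b obtain f where f: "\<forall>z. reval f [z] = Some (b (pfst z) (pfst (psnd z)) (psnd (psnd z)))"
    unfolding cfun_def by blast
  from cfun2_pair obtain p where p: "\<forall>x y. reval p [x, y] = Some (prod_encode (x, y))"
    unfolding cfun2_def by blast
  have "cfun2 (\<lambda>n x. rec_nat (a x) (\<lambda>m y. b m y x) n)"
    by (rule cfun2_prim[of _ "RComp f [RComp p [RProj 0, RComp p [RProj 1, RProj 2]]]"])
      (simp_all add: a f p numeral_2_eq_2)
  from cfun_comp2[OF this n cfun_id] show ?thesis .
qed

lemma cfun_Least:
  assumes P: "cpred (\<lambda>z. P (pfst z) (psnd z))" and ex: "\<And>x. \<exists>y. P y x"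
  shows "cfun (\<lambda>x. LEAST y. P y x)"
proof -
  from P have "cfun (\<lambda>z. 1 - of_bool (P (pfst z) (psnd z)))"
    unfolding cpred_def by (intro cfun_diff cfun_const)
  then obtain f where f: "\<forall>z. reval f [z] = Some (1 - of_bool (P (pfst z) (psnd z)))"
    unfolding cfun_def by blast
  from cfun2_pair obtain p where p: "\<forall>x y. reval p [x, y] = Some (prod_encode (x, y))"
    unfolding cfun2_def by blast
  have "\<forall>x. reval (RMu (RComp f [p])) [x] = Some (LEAST y. P y x)"
    by (intro allI reval_RMu_total) (auto simp: f p ex)
  then show ?thesis unfolding cfun_def by blast
qed

lemma cpred_const: "cpred (\<lambda>x. c)"
  unfolding cpred_def by (rule cfun_const)

lemma cpred_cong: "cpred f \<Longrightarrow> (\<And>x. f x = g x) \<Longrightarrow> cpred g"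
  by (simp add: cpred_def cfun_def)

lemma cpred_not: "cpred P \<Longrightarrow> cpred (\<lambda>x. \<not> P x)"
proof -
  assume "cpred P"
  then have "cfun (\<lambda>x. 1 - of_bool (P x))" unfolding cpred_def by (intro cfun_diff cfun_const)
  moreover have "(1 - of_bool p :: nat) = of_bool (\<not> p)" for p by simp
  ultimately show ?thesis unfolding cpred_def by simp
qed

lemma cpred_conj: "cpred P \<Longrightarrow> cpred Q \<Longrightarrow> cpred (\<lambda>x. P x \<and> Q x)"
  unfolding cpred_def of_bool_conj by (rule cfun_mult)

lemma cpred_disj: "cpred P \<Longrightarrow> cpred Q \<Longrightarrow> cpred (\<lambda>x. P x \<or> Q x)"
proof -
  assume "cpred P" "cpred Q"
  then have "cpred (\<lambda>x. \<not> (\<not> P x \<and> \<not> Q x))" by (intro cpred_conj cpred_not)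
  then show ?thesis by (rule cpred_cong) blast
qed

lemma cpred_imp: "cpred P \<Longrightarrow> cpred Q \<Longrightarrow> cpred (\<lambda>x. P x \<longrightarrow> Q x)"
proof -
  assume "cpred P" "cpred Q"
  then have "cpred (\<lambda>x. \<not> P x \<or> Q x)" by (intro cpred_disj cpred_not)
  then show ?thesis by (rule cpred_cong) blast
qed

lemma cpred_le: "cfun f \<Longrightarrow> cfun g \<Longrightarrow> cpred (\<lambda>x. f x \<le> g x)"
proof -
  assume "cfun f" "cfun g"
  then have "cfun (\<lambda>x. 1 - (f x - g x))" by (intro cfun_diff cfun_const)
  moreover have "1 - (a - b) = of_bool (a \<le> b)" for a b :: nat by simp
  ultimately show ?thesis unfolding cpred_def by simp
qed

lemma cpred_less: "cfun f \<Longrightarrow> cfun g \<Longrightarrow> cpred (\<lambda>x. f x < g x)"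
  using cpred_le[OF cfun_Suc] by (simp add: Suc_le_eq)

lemma cpred_eq: "cfun f \<Longrightarrow> cfun g \<Longrightarrow> cpred (\<lambda>x. f x = g x)"
proof -
  assume "cfun f" "cfun g"
  then have "cpred (\<lambda>x. f x \<le> g x \<and> g x \<le> f x)" by (intro cpred_conj cpred_le)
  then show ?thesis by (rule cpred_cong) auto
qed

lemma cfun_if: "cpred P \<Longrightarrow> cfun f \<Longrightarrow> cfun g \<Longrightarrow> cfun (\<lambda>x. if P x then f x else g x)"
proof -
  assume "cpred P" and f: "cfun f" and g: "cfun g"
  then have "cfun (\<lambda>x. of_bool (P x) * f x + (1 - of_bool (P x)) * g x)"
    unfolding cpred_def by (intro cfun_add cfun_mult cfun_diff cfun_const)
  moreover have "of_bool p * a + (1 - of_bool p) * b = (if p then a else b)" for p and a b :: nat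
    by simp
  ultimately show ?thesis by simp
qed

lemma cpred_if: "cpred P \<Longrightarrow> cpred Q \<Longrightarrow> cpred R \<Longrightarrow> cpred (\<lambda>x. if P x then Q x else R x)"
proof -
  assume "cpred P" "cpred Q" "cpred R"
  then have "cpred (\<lambda>x. P x \<and> Q x \<or> \<not> P x \<and> R x)" by (intro cpred_disj cpred_conj cpred_not)
  then show ?thesis by (rule cpred_cong) auto
qed

lemma cpred_ball_less:
  assumes P: "cpred (\<lambda>z. P (pfst z) (psnd z))" and n: "cfun n"
  shows "cpred (\<lambda>x. \<forall>y<n x. P y x)"
proof -
  have "cfun (\<lambda>x. rec_nat 1 (\<lambda>m y. y * of_bool (P m x)) (n x))"
  proof (intro cfun_rec cfun_mult cfun_const n cfun_pfst cfun_psnd cfun_id)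
    show "cfun (\<lambda>z. of_bool (P (pfst z) (psnd (psnd z))))"
      using cfun_comp[OF P[unfolded cpred_def], OF cfun_pair[OF cfun_pfst[OF cfun_id] cfun_psnd[OF cfun_psnd[OF cfun_id]]]]
      by simp
  qed
  moreover have "rec_nat 1 (\<lambda>m y. y * of_bool (P m x)) k = (of_bool (\<forall>y<k. P y x) :: nat)" for k x
    by (induction k) (auto simp: less_Suc_eq)
  ultimately show ?thesis by (simp add: cpred_def)
qed

lemma cpred_bex_less:
  assumes P: "cpred (\<lambda>z. P (pfst z) (psnd z))" and n: "cfun n"
  shows "cpred (\<lambda>x. \<exists>y<n x. P y x)"
  using cpred_not[OF cpred_ball_less[OF cpred_not[OF P] n]] by simp

lemma cpred_bex_le:
  assumes P: "cpred (\<lambda>z. P (pfst z) (psnd z))" and n: "cfun n"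
  shows "cpred (\<lambda>x. \<exists>y\<le>n x. P y x)"
  using cpred_bex_less[OF P cfun_Suc[OF n]] by (simp add: less_Suc_eq_le)

lemma cfun_power2: "cfun n \<Longrightarrow> cfun (\<lambda>x. 2 ^ n x)"
proof -
  assume n: "cfun n"
  have "cfun (\<lambda>x. rec_nat 1 (\<lambda>m y. 2 * y) (n x))"
    by (intro cfun_rec cfun_mult cfun_const n cfun_pfst cfun_psnd cfun_id)
  moreover have "rec_nat 1 (\<lambda>m y. 2 * y) k = (2 ^ k :: nat)" for k by (induction k) auto
  ultimately show ?thesis by simp
qed

text \<open>The quotient is the least q with \<open>f x < Suc q * g x\<close>. The extra disjunct
  stops the search at 0 for a zero divisor, in agreement with HOL division.\<close>

lemma cfun_div: "cfun f \<Longrightarrow> cfun g \<Longrightarrow> cfun (\<lambda>x. f x div g x)"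
proof -
  assume f: "cfun f" and g: "cfun g"
  have "cfun (\<lambda>z. LEAST q. psnd z = 0 \<or> pfst z < Suc q * psnd z)"
  proof (rule cfun_Least)
    show "cpred (\<lambda>z. psnd (psnd z) = 0 \<or> pfst (psnd z) < Suc (pfst z) * psnd (psnd z))"
      by (intro cpred_disj cpred_eq cpred_less cfun_mult cfun_Suc cfun_const cfun_pfst cfun_psnd cfun_id)
    show "\<exists>y. psnd x = 0 \<or> pfst x < Suc y * psnd x" for x
      by (metis Suc_mult_less_cancel1 dividend_less_div_times mult.commute mult_Suc not_gr_zero)
  qed
  from cfun_comp[OF this cfun_pair[OF f g]]
  have "cfun (\<lambda>x. LEAST q. g x = 0 \<or> f x < Suc q * g x)" by simp
  moreover have "(LEAST q. b = 0 \<or> a < Suc q * b) = a div b" for a b :: nat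
  proof (cases "b = 0")
    case False
    show ?thesis
    proof (rule Least_equality)
      show "b = 0 \<or> a < Suc (a div b) * b" using False
        by (simp add: dividend_less_div_times)
      show "b = 0 \<or> a < Suc y * b \<Longrightarrow> a div b \<le> y" for y
        using False by (metis less_Suc_eq_le less_mult_imp_div_less)
    qed
  qed simp
  ultimately show ?thesis by simp
qed

lemma cpred_even: "cfun f \<Longrightarrow> cpred (\<lambda>x. even (f x))"
proof -
  assume f: "cfun f"
  then have "cpred (\<lambda>x. 2 * (f x div 2) = f x)" by (intro cpred_eq cfun_mult cfun_div cfun_const)
  then show ?thesis by (rule cpred_cong) presburger
qed

lemma cpred_mem: "cfun f \<Longrightarrow> cfun g \<Longrightarrow> cpred (\<lambda>x. f x \<in> set_decode (g x))"
proof -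
  assume "cfun f" "cfun g"
  then have "cpred (\<lambda>x. \<not> even (g x div 2 ^ f x))"
    by (intro cpred_not cpred_even cfun_div cfun_power2)
  then show ?thesis by (simp add: set_decode_def)
qed

lemma cpred_comp: "cpred P \<Longrightarrow> cfun g \<Longrightarrow> cpred (\<lambda>x. P (g x))"
  unfolding cpred_def by (rule cfun_comp)

lemma cpred_bex_mem:
  assumes P: "cpred (\<lambda>z. P (pfst z) (psnd z))" and s: "cfun s"
  shows "cpred (\<lambda>x. \<exists>y\<in>set_decode (s x). P y x)"
proof -
  have "cpred (\<lambda>x. \<exists>y<s x. y \<in> set_decode (s x) \<and> P y x)"
    by (intro cpred_bex_less cpred_conj cpred_mem P s cfun_comp[OF s] cfun_pfst cfun_psnd cfun_id)
  then show ?thesis by (rule cpred_cong) (auto dest: set_decode_less)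
qed

lemma cpred_ball_mem:
  assumes P: "cpred (\<lambda>z. P (pfst z) (psnd z))" and s: "cfun s"
  shows "cpred (\<lambda>x. \<forall>y\<in>set_decode (s x). P y x)"
  using cpred_not[OF cpred_bex_mem[OF cpred_not[OF P] s]] by simp

lemma cfun_image:
  assumes g: "cfun (\<lambda>z. g (pfst z) (psnd z))" and P: "cpred (\<lambda>z. P (pfst z) (psnd z))" and n: "cfun n"
  shows "cfun (\<lambda>x. set_encode {g y x |y. y < n x \<and> P y x})"
proof -
  \<comment> \<open>The membership test keeps a value attained twice from adding its power of 2
    twice.\<close>
  let ?b = "\<lambda>m acc x. if P m x \<and> g m x \<notin> set_decode acc then 2 ^ g m x + acc else acc"
  have q: "cfun (\<lambda>z. prod_encode (pfst z, psnd (psnd z)))"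
    by (intro cfun_pair cfun_pfst cfun_psnd cfun_id)
  have "cfun (\<lambda>x. rec_nat 0 (\<lambda>m acc. ?b m acc x) (n x))"
    using cfun_comp[OF g q] cpred_comp[OF P q]
    by (intro cfun_rec cfun_if cpred_conj cpred_not cpred_mem cfun_add cfun_power2 cfun_const n cfun_pfst cfun_psnd cfun_id) auto
  moreover have "rec_nat 0 (\<lambda>m acc. ?b m acc x) k = set_encode {g y x |y. y < k \<and> P y x}" for k x
  proof (induction k)
    case (Suc k)
    let ?S = "{g y x |y. y < k \<and> P y x}"
    have fin: "finite ?S" by auto
    have "{g y x |y. y < Suc k \<and> P y x} = (if P k x then insert (g k x) ?S else ?S)"
      by (auto simp: less_Suc_eq)
    moreover have "rec_nat 0 (\<lambda>m acc. ?b m acc x) (Suc k) =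
      (if P k x \<and> g k x \<notin> ?S then 2 ^ g k x + set_encode ?S else set_encode ?S)"
      using Suc fin by (simp del: mem_Collect_eq)
    ultimately show ?case using fin
      by (cases "P k x"; cases "g k x \<in> ?S") (simp_all add: insert_absorb del: mem_Collect_eq)
  qed simp
  ultimately show ?thesis by simp
qed

text \<open>The two bounded generators are packed into one number, bounded because pairing is
  strictly monotone.\<close>

lemma cfun_image2:
  assumes g: "cfun (\<lambda>z. g (pfst z) (pfst (psnd z)) (psnd (psnd z)))"
    and P: "cpred (\<lambda>z. P (pfst z) (pfst (psnd z)) (psnd (psnd z)))" and n: "cfun n" and m: "cfun m"
  shows "cfun (\<lambda>x. set_encode {g y z x |y z. y < n x \<and> z < m x \<and> P y z x})"
proof -
  have q: "cfun (\<lambda>z. prod_encode (pfst (pfst z), prod_encode (psnd (pfst z), psnd z)))"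
    by (intro cfun_pair cfun_pfst cfun_psnd cfun_id)
  have "cfun (\<lambda>x. set_encode {g (pfst w) (psnd w) x |w. w < prod_encode (n x, m x) \<and>
    pfst w < n x \<and> psnd w < m x \<and> P (pfst w) (psnd w) x})"
    using cfun_comp[OF g q] cpred_comp[OF P q]
    by (intro cfun_image cpred_conj cpred_less cfun_pair n m cfun_comp[OF n] cfun_comp[OF m] cfun_pfst cfun_psnd cfun_id) auto
  moreover have "{g (pfst w) (psnd w) x |w. w < prod_encode (n x, m x) \<and>
    pfst w < n x \<and> psnd w < m x \<and> P (pfst w) (psnd w) x} = {g y z x |y z. y < n x \<and> z < m x \<and> P y z x}" for x
  proof -
    have "\<exists>w. g y z x = g (pfst w) (psnd w) x \<and> w < prod_encode (n x, m x) \<and>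
      pfst w < n x \<and> psnd w < m x \<and> P (pfst w) (psnd w) x" if "y < n x" "z < m x" "P y z x" for y z
      using that by (intro exI[of _ "prod_encode (y, z)"]) (auto intro: prod_encode_strict_mono)
    then show ?thesis by auto
  qed
  ultimately show ?thesis by simp
qed

section \<open>Arithmetic of list codes\<close>

text \<open>These work on \<open>list_encode\<close>, where the empty list is 0 and a cons is the
  successor of a pair; hence the subtraction of 1 in \<open>ctl\<close> and
  \<open>chd\<close>.\<close>

definition ctl :: "nat \<Rightarrow> nat" where "ctl l = psnd (l - 1)"
definition chd :: "nat \<Rightarrow> nat" where "chd l = pfst (l - 1)"
definition ccons :: "nat \<Rightarrow> nat \<Rightarrow> nat" where "ccons x l = Suc (prod_encode (x, l))"
definition cdrop :: "nat \<Rightarrow> nat \<Rightarrow> nat" where "cdrop n l = rec_nat l (\<lambda>m y. ctl y) n"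
definition cnth :: "nat \<Rightarrow> nat \<Rightarrow> nat" where "cnth l n = chd (cdrop n l)"
definition clen :: "nat \<Rightarrow> nat" where "clen l = (LEAST n. cdrop n l = 0)"

lemma ccons_encode [simp]: "ccons x (list_encode xs) = list_encode (x # xs)"
  by (simp add: ccons_def)

lemma ctl_encode [simp]: "ctl (list_encode xs) = list_encode (tl xs)"
  by (cases xs) (simp_all add: ctl_def)

lemma chd_encode [simp]: "xs \<noteq> [] \<Longrightarrow> chd (list_encode xs) = hd xs"
  by (cases xs) (simp_all add: chd_def)

lemma cdrop_encode [simp]: "cdrop n (list_encode xs) = list_encode (drop n xs)"
  by (induction n) (simp_all add: cdrop_def drop_Suc tl_drop)

lemma cnth_encode [simp]: "n < length xs \<Longrightarrow> cnth (list_encode xs) n = xs ! n"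
  by (simp add: cnth_def hd_drop_conv_nth)

lemma list_encode_0_iff: "list_encode xs = 0 \<longleftrightarrow> xs = []"
  by (cases xs) auto

lemma clen_encode [simp]: "clen (list_encode xs) = length xs"
proof -
  have "(LEAST n. length xs \<le> n) = length xs" by (rule Least_equality) auto
  then show ?thesis by (simp add: clen_def list_encode_0_iff)
qed

lemma cfun_ctl: "cfun l \<Longrightarrow> cfun (\<lambda>x. ctl (l x))"
  unfolding ctl_def by (intro cfun_psnd cfun_diff cfun_const)

lemma cfun_chd: "cfun l \<Longrightarrow> cfun (\<lambda>x. chd (l x))"
  unfolding chd_def by (intro cfun_pfst cfun_diff cfun_const)

lemma cfun_ccons: "cfun f \<Longrightarrow> cfun l \<Longrightarrow> cfun (\<lambda>x. ccons (f x) (l x))"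
  unfolding ccons_def by (intro cfun_Suc cfun_pair)

lemma cfun_cdrop: "cfun n \<Longrightarrow> cfun l \<Longrightarrow> cfun (\<lambda>x. cdrop (n x) (l x))"
  unfolding cdrop_def by (intro cfun_rec cfun_ctl cfun_pfst cfun_psnd cfun_id)

lemma cfun_cnth: "cfun l \<Longrightarrow> cfun n \<Longrightarrow> cfun (\<lambda>x. cnth (l x) (n x))"
  unfolding cnth_def by (intro cfun_chd cfun_cdrop)

lemma cfun_clen: "cfun l \<Longrightarrow> cfun (\<lambda>x. clen (l x))"
proof -
  have "cfun clen" unfolding clen_def
  proof (rule cfun_Least)
    show "cpred (\<lambda>z. cdrop (pfst z) (psnd z) = 0)"
      by (intro cpred_eq cfun_cdrop cfun_const cfun_pfst cfun_psnd cfun_id)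
    show "\<exists>y. cdrop y x = 0" for x
      using cdrop_encode[of "length (list_decode x)" "list_decode x"] by auto
  qed
  then show "cfun l \<Longrightarrow> cfun (\<lambda>x. clen (l x))" by (rule cfun_comp)
qed

lemmas cfun_intros = cfun_id cfun_Suc cfun_add cfun_mult cfun_diff cfun_pair cfun_pfst cfun_psnd cfun_rec cfun_if cfun_power2
  cfun_div cfun_image cfun_image2 cfun_ctl cfun_chd cfun_ccons cfun_cdrop cfun_cnth cfun_clen cfun_const
  cpred_not cpred_conj cpred_disj cpred_imp cpred_le cpred_less cpred_eq cpred_if cpred_ball_less cpred_bex_less
  cpred_bex_le cpred_even cpred_mem cpred_bex_mem cpred_ball_mem cpred_const

text \<open>
  The history is the list of the values at \<open>n - 1, \<dots>, 0\<close>, in this order,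
  hence the index \<open>n - 1 - i\<close>.
\<close>

lemma cfun_course_of_values:
  assumes eq: "\<And>z n. F z n = B z n (F z)"
    and loc: "\<And>z n f g. (\<And>i. i < n \<Longrightarrow> f i = g i) \<Longrightarrow> B z n f = B z n g"
    and B: "cfun (\<lambda>w. B (pfst w) (pfst (psnd w)) (\<lambda>i. cnth (psnd (psnd w)) (pfst (psnd w) - 1 - i)))"
    and z: "cfun z" and n: "cfun n"
  shows "cfun (\<lambda>x. F (z x) (n x))"
proof -
  define H where "H z n = list_encode (map (F z) (rev [0..<n]))" for z n
  have H: "cnth (H z n) (n - 1 - i) = F z i" if "i < n" for z n i
    using that by (simp add: H_def rev_nth)
  have F: "F z n = B z n (\<lambda>i. cnth (H z n) (n - 1 - i))" for z n
    by (subst eq, rule loc) (simp only: H)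
  have "H z n = rec_nat 0 (\<lambda>m h. ccons (B z m (\<lambda>i. cnth h (m - 1 - i))) h) n" for z n
  proof (induction n)
    case (Suc n)
    have "H z (Suc n) = ccons (F z n) (H z n)" by (simp add: H_def)
    also have "\<dots> = ccons (B z n (\<lambda>i. cnth (H z n) (n - 1 - i))) (H z n)" by (subst F) simp
    finally show ?case by (simp add: Suc)
  qed (simp add: H_def)
  moreover have "cfun (\<lambda>x. rec_nat 0 (\<lambda>m h. ccons (B (z x) m (\<lambda>i. cnth h (m - 1 - i))) h) (n x))"
  proof (intro cfun_rec cfun_ccons)
    let ?q = "\<lambda>w. prod_encode (z (psnd (psnd w)), prod_encode (pfst w, pfst (psnd w)))"
    have "cfun ?q" by (intro cfun_intros cfun_comp[OF z])
    from cfun_comp[OF B this]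
    show "cfun (\<lambda>w. B (z (psnd (psnd w))) (pfst w) (\<lambda>i. cnth (pfst (psnd w)) (pfst w - 1 - i)))"
      by simp
  qed (intro cfun_intros n)+
  ultimately have h: "cfun (\<lambda>x. H (z x) (n x))" by simp
  let ?q = "\<lambda>x. prod_encode (z x, prod_encode (n x, H (z x) (n x)))"
  have "cfun ?q" by (intro cfun_intros z n h)
  from cfun_comp[OF B this]
  have "cfun (\<lambda>x. B (z x) (n x) (\<lambda>i. cnth (H (z x) (n x)) (n x - 1 - i)))" by simp
  then show ?thesis by (simp only: F[symmetric])
qed

lemma re_set_ex:
  assumes "cpred (\<lambda>z. P (pfst z) (psnd z))"
  shows "re_set {x. \<exists>y. P y x}"
proof -
  from assms have "cfun (\<lambda>z. 1 - of_bool (P (pfst z) (psnd z)))"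
    unfolding cpred_def by (intro cfun_diff cfun_const)
  then obtain f where f: "\<forall>z. reval f [z] = Some (1 - of_bool (P (pfst z) (psnd z)))"
    unfolding cfun_def by blast
  from cfun2_pair obtain p where p: "\<forall>x y. reval p [x, y] = Some (prod_encode (x, y))"
    unfolding cfun2_def by blast
  have "reval (RMu (RComp f [p])) [x] \<noteq> None \<longleftrightarrow> (\<exists>y. P y x)" for x
  proof
    assume "\<exists>y. P y x"
    then have "reval (RMu (RComp f [p])) [x] = Some (LEAST y. P y x)"
      by (intro reval_RMu_total) (auto simp: f p)
    then show "reval (RMu (RComp f [p])) [x] \<noteq> None" by simp
  next
    assume "reval (RMu (RComp f [p])) [x] \<noteq> None"
    then obtain n where "reval (RComp f [p]) [n, x] = Some 0"
      by (auto simp only: reval.simps(6) split: if_splits)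
    then have "1 - of_bool (P n x) = (0 :: nat)" by (simp add: f p)
    then show "\<exists>y. P y x" by (cases "P n x") auto
  qed
  then show ?thesis unfolding re_set_def by blast
qed

lemma decidable_set_cpred: "cpred (\<lambda>n. n \<in> A) \<Longrightarrow> decidable_set A"
  by (simp add: cpred_def cfun_def decidable_set_def of_bool_def)


section \<open>Types of labelled intervals\<close>

text \<open>
  A type records which of the labels share a position (\<open>meets\<close>), which occur one
  before the other (\<open>precs\<close>), and the types, one rank lower, of the relabellings in
  which the label \<open>i\<close> is overwritten by some set (\<open>kids i\<close>).
\<close>

definition mk_type :: "nat set \<Rightarrow> nat set \<Rightarrow> nat set \<Rightarrow> nat" where
  "mk_type M L C = prod_encode (set_encode M, prod_encode (set_encode L, set_encode C))"

definition meets :: "nat \<Rightarrow> nat set" where "meets t = set_decode (pfst t)"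
definition precs :: "nat \<Rightarrow> nat set" where "precs t = set_decode (pfst (psnd t))"
definition kidset :: "nat \<Rightarrow> nat set" where "kidset t = set_decode (psnd (psnd t))"
definition kids :: "nat \<Rightarrow> nat \<Rightarrow> nat set" where "kids i t = {a. prod_encode (i, a) \<in> kidset t}"

lemma meets_mk_type [simp]: "finite M \<Longrightarrow> meets (mk_type M L C) = M"
  by (simp add: meets_def mk_type_def)

lemma precs_mk_type [simp]: "finite L \<Longrightarrow> precs (mk_type M L C) = L"
  by (simp add: precs_def mk_type_def)

lemma kidset_mk_type [simp]: "finite C \<Longrightarrow> kidset (mk_type M L C) = C"
  by (simp add: kidset_def mk_type_def)

lemma kids_mk_type [simp]: "finite C \<Longrightarrow> kids i (mk_type M L C) = {a. prod_encode (i, a) \<in> C}"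
  by (simp add: kids_def)

lemma finite_meets [simp]: "finite (meets t)" and finite_precs [simp]: "finite (precs t)"
  and finite_kidset [simp]: "finite (kidset t)"
  by (simp_all add: meets_def precs_def kidset_def)

lemma mk_type_meets_precs_kidset: "mk_type (meets t) (precs t) (kidset t) = t"
  by (simp add: mk_type_def meets_def precs_def kidset_def)

lemma kidset_kids: "x \<in> kidset t \<longleftrightarrow> psnd x \<in> kids (pfst x) t"
  by (simp add: kids_def)

lemma type_eqI:
  assumes "meets s = meets t" "precs s = precs t" "\<And>i. kids i s = kids i t" shows "s = t"
proof -
  have "kidset s = kidset t" using assms(3) by (simp add: set_eq_iff kidset_kids)
  then show ?thesis using assms(1,2) by (metis mk_type_meets_precs_kidset)
qed

text \<open>A kid has a smaller code than its parent, so recursion and induction on codes follow the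
  nesting of types.\<close>

lemma psnd_kidset_less: "x \<in> kidset t \<Longrightarrow> psnd x < t"
proof -
  assume "x \<in> kidset t"
  then have "x < psnd (psnd t)" unfolding kidset_def by (rule set_decode_less)
  moreover have "psnd (psnd t) \<le> t" by (meson le_trans psnd_le)
  ultimately show ?thesis using psnd_le[of x] by linarith
qed

lemma kids_less: "a \<in> kids i t \<Longrightarrow> a < t"
  using psnd_kidset_less[of "prod_encode (i, a)" t] by (simp add: kids_def)

text \<open>Intended as the type of a concatenation. A label occurs in a part iff its diagonal pair
  lies in \<open>meets\<close>; if \<open>i\<close> occurs on the left and \<open>j\<close> on the
  right, then \<open>i\<close> precedes \<open>j\<close>. A relabelling of the whole is a pair of
  relabellings of the parts at the same label, so kids multiply pairwise.\<close>

function tmul :: "nat \<Rightarrow> nat \<Rightarrow> nat" where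
  "tmul s t = mk_type (meets s \<union> meets t)
    (precs s \<union> precs t \<union> {prod_encode (pfst i, pfst j) |i j. i \<in> meets s \<and> j \<in> meets t \<and> pfst i = psnd i \<and> pfst j = psnd j})
    ((\<lambda>(x, y). prod_encode (pfst x, tmul (psnd x) (psnd y))) ` {(x, y). x \<in> kidset s \<and> y \<in> kidset t \<and> pfst x = pfst y})"
  by auto
termination by (relation "measure fst") (auto simp: psnd_kidset_less)

declare tmul.simps [simp del]

lemma meets_tmul [simp]: "meets (tmul s t) = meets s \<union> meets t"
  by (subst tmul.simps) simp

lemma precs_tmul: "precs (tmul s t) = precs s \<union> precs t \<union>
  {prod_encode (i, j) |i j. prod_encode (i, i) \<in> meets s \<and> prod_encode (j, j) \<in> meets t}"
proof -
  let ?A = "{prod_encode (pfst i, pfst j) |i j. i \<in> meets s \<and> j \<in> meets t \<and> pfst i = psnd i \<and> pfst j = psnd j}"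
  have "?A \<subseteq> (\<lambda>(i, j). prod_encode (pfst i, pfst j)) ` (meets s \<times> meets t)" by auto
  then have fin: "finite ?A" by (rule finite_subset) simp
  have "?A = {prod_encode (i, j) |i j. prod_encode (i, i) \<in> meets s \<and> prod_encode (j, j) \<in> meets t}"
  proof (intro set_eqI iffI)
    fix x assume "x \<in> ?A"
    then obtain i j where "x = prod_encode (pfst i, pfst j)" "i \<in> meets s" "j \<in> meets t" "pfst i = psnd i" "pfst j = psnd j"
      by blast
    moreover from this have "prod_encode (pfst i, pfst i) = i" "prod_encode (pfst j, pfst j) = j"
      using prod_encode_pfst_psnd[of i] prod_encode_pfst_psnd[of j] by simp_all
    ultimately show "x \<in> {prod_encode (i, j) |i j. prod_encode (i, i) \<in> meets s \<and> prod_encode (j, j) \<in> meets t}"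
      by (smt (verit) mem_Collect_eq)
  next
    fix x assume "x \<in> {prod_encode (i, j) |i j. prod_encode (i, i) \<in> meets s \<and> prod_encode (j, j) \<in> meets t}"
    then obtain i j where "x = prod_encode (i, j)" "prod_encode (i, i) \<in> meets s" "prod_encode (j, j) \<in> meets t"
      by blast
    then have "x = prod_encode (pfst (prod_encode (i, i)), pfst (prod_encode (j, j)))" by simp
    then show "x \<in> ?A"
      using \<open>prod_encode (i, i) \<in> meets s\<close> \<open>prod_encode (j, j) \<in> meets t\<close> by force
  qed
  with fin show ?thesis by (subst tmul.simps) simp
qed

lemma kidset_tmul: "kidset (tmul s t) =
  (\<lambda>(x, y). prod_encode (pfst x, tmul (psnd x) (psnd y))) ` {(x, y). x \<in> kidset s \<and> y \<in> kidset t \<and> pfst x = pfst y}"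
proof -
  have "finite {(x, y). x \<in> kidset s \<and> y \<in> kidset t \<and> pfst x = pfst y}"
    by (rule finite_subset[of _ "kidset s \<times> kidset t"]) auto
  then show ?thesis by (subst tmul.simps) simp
qed

lemma kids_tmul: "kids i (tmul s t) = {tmul a b |a b. a \<in> kids i s \<and> b \<in> kids i t}"
proof (intro set_eqI iffI)
  fix x assume "x \<in> kids i (tmul s t)"
  then obtain u v where "u \<in> kidset s" "v \<in> kidset t" "pfst u = i" "pfst v = i" "x = tmul (psnd u) (psnd v)"
    by (auto simp: kids_def kidset_tmul)
  then show "x \<in> {tmul a b |a b. a \<in> kids i s \<and> b \<in> kids i t}" by (auto simp: kidset_kids)
next
  fix x assume "x \<in> {tmul a b |a b. a \<in> kids i s \<and> b \<in> kids i t}"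
  then obtain a b where "prod_encode (i, a) \<in> kidset s" "prod_encode (i, b) \<in> kidset t" "x = tmul a b"
    by (auto simp: kids_def)
  then show "x \<in> kids i (tmul s t)" by (force simp: kids_def kidset_tmul)
qed

lemma tmul_assoc: "tmul (tmul s t) u = tmul s (tmul t u)"
proof (induction s arbitrary: t u rule: less_induct)
  case (less s)
  show ?case
  proof (rule type_eqI)
    show "precs (tmul (tmul s t) u) = precs (tmul s (tmul t u))" by (auto simp: precs_tmul)
    fix i
    have "kids i (tmul (tmul s t) u) = {tmul (tmul a b) c |a b c. a \<in> kids i s \<and> b \<in> kids i t \<and> c \<in> kids i u}"
      by (auto simp: kids_tmul)
    also have "\<dots> = {tmul a (tmul b c) |a b c. a \<in> kids i s \<and> b \<in> kids i t \<and> c \<in> kids i u}"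
      using less kids_less by (metis (no_types, lifting))
    also have "\<dots> = kids i (tmul s (tmul t u))" by (auto simp: kids_tmul)
    finally show "kids i (tmul (tmul s t) u) = kids i (tmul s (tmul t u))" .
  qed auto
qed

text \<open>The subsemigroup generated by \<open>A\<close>. Generators are appended on the right to
  match the left-nested products \<open>tprod\<close>.\<close>

inductive_set generated :: "nat set \<Rightarrow> nat set" for A where
  base: "a \<in> A \<Longrightarrow> a \<in> generated A"
| step: "x \<in> generated A \<Longrightarrow> a \<in> A \<Longrightarrow> tmul x a \<in> generated A"

lemma generated_tmul: "y \<in> generated A \<Longrightarrow> x \<in> generated A \<Longrightarrow> tmul x y \<in> generated A"
  by (induction rule: generated.induct) (auto simp: tmul_assoc[symmetric] intro: generated.intros)

text \<open>Index \<open>j\<close> means \<open>j + 1\<close> factors, so these products are never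
  empty.\<close>

fun tprod :: "(nat \<Rightarrow> nat) \<Rightarrow> nat \<Rightarrow> nat" where
  "tprod \<alpha> 0 = \<alpha> 0"
| "tprod \<alpha> (Suc j) = tmul (tprod \<alpha> j) (\<alpha> (Suc j))"

lemma tprod_generated: "(\<And>i. i \<le> j \<Longrightarrow> \<alpha> i \<in> A) \<Longrightarrow> tprod \<alpha> j \<in> generated A"
  by (induction j) (auto intro: generated.intros)

lemma tprod_cong: "(\<And>i. i \<le> j \<Longrightarrow> \<alpha> i = \<beta> i) \<Longrightarrow> tprod \<alpha> j = tprod \<beta> j"
  by (induction j) auto

lemma generated_tprod: "x \<in> generated A \<Longrightarrow> \<exists>\<alpha> j. (\<forall>i. \<alpha> i \<in> A) \<and> x = tprod \<alpha> j"
proof (induction rule: generated.induct)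
  case (base a)
  then show ?case by (intro exI[of _ "\<lambda>_. a"] exI[of _ 0]) simp
next
  case (step x a)
  then obtain \<alpha> j where *: "\<forall>i. \<alpha> i \<in> A" "x = tprod \<alpha> j" by blast
  have "tprod (\<alpha>(Suc j := a)) j = tprod \<alpha> j" by (rule tprod_cong) simp
  then show ?case using * step.hyps
    by (intro exI[of _ "\<alpha>(Suc j := a)"] exI[of _ "Suc j"]) (simp del: fun_upd_apply add: fun_upd_same, simp)
qed

text \<open>
  The label \<open>0\<close> stands for the predicate of the word, \<open>2 * x + 1\<close> for
  the element variable \<open>x\<close>, represented by a singleton, and \<open>2 * X +
  2\<close> for the set variable \<open>X\<close>.
\<close>

definition meet_facts :: "nat \<Rightarrow> int set \<Rightarrow> (nat \<Rightarrow> int set) \<Rightarrow> nat set" where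
  "meet_facts N D E = {prod_encode (i, j) |i j. i < N \<and> j < N \<and> (\<exists>p\<in>D. p \<in> E i \<and> p \<in> E j)}"

definition prec_facts :: "nat \<Rightarrow> int set \<Rightarrow> (nat \<Rightarrow> int set) \<Rightarrow> nat set" where
  "prec_facts N D E = {prod_encode (i, j) |i j. i < N \<and> j < N \<and> (\<exists>p\<in>D. \<exists>q\<in>D. p < q \<and> p \<in> E i \<and> q \<in> E j)}"

primrec mtype :: "nat \<Rightarrow> nat \<Rightarrow> int set \<Rightarrow> (nat \<Rightarrow> int set) \<Rightarrow> nat" where
  "mtype N 0 D E = mk_type (meet_facts N D E) (prec_facts N D E) {}"
| "mtype N (Suc k) D E = mk_type (meet_facts N D E) (prec_facts N D E)
     {prod_encode (i, mtype N k D (E(i := S))) |i S. i < N \<and> S \<subseteq> D}"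

text \<open>A syntactic over-approximation of the realised types: closed under \<open>tmul\<close>,
  and bounded in code, without reference to any labelled interval. The algorithm can therefore
  handle arbitrary products below a known bound.\<close>

primrec is_type :: "nat \<Rightarrow> nat \<Rightarrow> nat \<Rightarrow> bool" where
  "is_type N 0 t \<longleftrightarrow> meets t \<union> precs t \<subseteq> prod_encode ` ({..<N} \<times> {..<N}) \<and> kidset t = {}"
| "is_type N (Suc k) t \<longleftrightarrow> meets t \<union> precs t \<subseteq> prod_encode ` ({..<N} \<times> {..<N}) \<and>
     (\<forall>i a. a \<in> kids i t \<longrightarrow> i < N \<and> is_type N k a)"

primrec type_bound :: "nat \<Rightarrow> nat \<Rightarrow> nat" where
  "type_bound N 0 = Suc (prod_encode (2 ^ prod_encode (N, N), prod_encode (2 ^ prod_encode (N, N), 1)))"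
| "type_bound N (Suc k) = Suc (prod_encode (2 ^ prod_encode (N, N), prod_encode (2 ^ prod_encode (N, N),
     2 ^ prod_encode (N, type_bound N k))))"

lemma is_type_facts: "is_type N k t \<Longrightarrow> meets t \<union> precs t \<subseteq> prod_encode ` ({..<N} \<times> {..<N})"
  by (cases k) auto

lemma is_type_code:
  assumes "is_type N k t" shows "pfst t < 2 ^ prod_encode (N, N)" "pfst (psnd t) < 2 ^ prod_encode (N, N)"
proof -
  have "prod_encode ` ({..<N} \<times> {..<N}) \<subseteq> {..<prod_encode (N, N)}"
    by (auto intro: prod_encode_strict_mono)
  with is_type_facts[OF assms] have "meets t \<subseteq> {..<prod_encode (N, N)}" "precs t \<subseteq> {..<prod_encode (N, N)}"
    by (meson Un_subset_iff order_trans)+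
  then show "pfst t < 2 ^ prod_encode (N, N)" "pfst (psnd t) < 2 ^ prod_encode (N, N)"
    using set_encode_less_exp[of "meets t" "prod_encode (N, N)"] set_encode_less_exp[of "precs t" "prod_encode (N, N)"]
    by (simp_all add: meets_def precs_def)
qed

lemma is_type_less_type_bound: "is_type N k t \<Longrightarrow> t < type_bound N k"
proof (induction k arbitrary: t)
  case 0
  have t: "t = prod_encode (pfst t, prod_encode (pfst (psnd t), psnd (psnd t)))" by simp
  have "kidset t = {}" using 0 by simp
  then have "psnd (psnd t) = 0" unfolding kidset_def by (metis set_decode_inverse set_encode_empty)
  then show ?case using is_type_code[OF 0]
    by (subst t) (auto intro!: less_Suc_eq_le[THEN iffD2] prod_encode_mono simp del: prod_encode_pfst_psnd)
next
  case (Suc k)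
  have t: "t = prod_encode (pfst t, prod_encode (pfst (psnd t), psnd (psnd t)))" by simp
  have "kidset t \<subseteq> {..<prod_encode (N, type_bound N k)}"
  proof
    fix x assume "x \<in> kidset t"
    then have "psnd x \<in> kids (pfst x) t" by (simp add: kids_def)
    with Suc have "pfst x < N" "psnd x < type_bound N k" by auto
    from prod_encode_strict_mono[OF this] show "x \<in> {..<prod_encode (N, type_bound N k)}" by simp
  qed
  then have "psnd (psnd t) < 2 ^ prod_encode (N, type_bound N k)"
    using set_encode_less_exp[of "kidset t"] by (simp add: kidset_def)
  then show ?case using is_type_code[OF Suc.prems]
    by (subst t) (auto intro!: less_Suc_eq_le[THEN iffD2] prod_encode_mono simp del: prod_encode_pfst_psnd)
qed

lemma type_bound_le_Suc: "type_bound N k \<le> type_bound N (Suc k)"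
proof (induction k)
  case 0
  show ?case by (auto intro!: prod_encode_mono)
next
  case (Suc k)
  show ?case
    unfolding type_bound.simps(2)[of N "Suc k"] type_bound.simps(2)[of N k]
    by (intro Suc_le_mono[THEN iffD2] prod_encode_mono order_refl power_increasing) (use Suc in simp_all)
qed

lemma type_bound_mono: "k \<le> l \<Longrightarrow> type_bound N k \<le> type_bound N l"
  by (rule lift_Suc_mono_le[of "type_bound N"]) (rule type_bound_le_Suc)

lemma mem_meet_facts [simp]: "prod_encode (i, j) \<in> meet_facts N D E \<longleftrightarrow> i < N \<and> j < N \<and> (\<exists>p\<in>D. p \<in> E i \<and> p \<in> E j)"
  by (simp add: meet_facts_def)

lemma mem_prec_facts [simp]:
  "prod_encode (i, j) \<in> prec_facts N D E \<longleftrightarrow> i < N \<and> j < N \<and> (\<exists>p\<in>D. \<exists>q\<in>D. p < q \<and> p \<in> E i \<and> q \<in> E j)"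
  by (simp add: prec_facts_def)

lemma prod_encode_set_eqI:
  "(\<And>i j. prod_encode (i, j) \<in> A \<longleftrightarrow> prod_encode (i, j) \<in> B) \<Longrightarrow> A = B"
  by (metis prod_encode_pfst_psnd set_eqI)

lemma meet_facts_subset: "meet_facts N D E \<subseteq> prod_encode ` ({..<N} \<times> {..<N})"
  and prec_facts_subset: "prec_facts N D E \<subseteq> prod_encode ` ({..<N} \<times> {..<N})"
  by (auto simp: meet_facts_def prec_facts_def)

lemma finite_meet_facts [simp]: "finite (meet_facts N D E)"
  by (rule finite_subset[OF meet_facts_subset]) simp

lemma finite_prec_facts [simp]: "finite (prec_facts N D E)"
  by (rule finite_subset[OF prec_facts_subset]) simp

lemma is_type_mtype: "is_type N k (mtype N k D E)"
proof (induction k arbitrary: E)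
  case 0
  then show ?case using meet_facts_subset prec_facts_subset by simp
next
  case (Suc k)
  let ?C = "{prod_encode (i, mtype N k D (E(i := S))) |i S. i < N \<and> S \<subseteq> D}"
  have "?C \<subseteq> prod_encode ` ({..<N} \<times> {..<type_bound N k})"
    using is_type_less_type_bound[OF Suc] by auto
  then have "finite ?C" by (rule finite_subset) simp
  then show ?case using meet_facts_subset prec_facts_subset Suc by auto
qed

lemma mtype_less: "mtype N k D E < type_bound N k"
  by (rule is_type_less_type_bound[OF is_type_mtype])

lemma meets_mtype [simp]: "meets (mtype N k D E) = meet_facts N D E"
  by (cases k) simp_all

lemma precs_mtype [simp]: "precs (mtype N k D E) = prec_facts N D E"
  by (cases k) simp_all

lemma kids_mtype_0 [simp]: "kids i (mtype N 0 D E) = {}"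
  by simp

lemma kids_mtype_Suc: "kids i (mtype N (Suc k) D E) = (if i < N then {mtype N k D (E(i := S)) |S. S \<subseteq> D} else {})"
proof -
  let ?C = "{prod_encode (i, mtype N k D (E(i := S))) |i S. i < N \<and> S \<subseteq> D}"
  have "?C \<subseteq> prod_encode ` ({..<N} \<times> {..<type_bound N k})"
    using mtype_less by auto
  then have "finite ?C" by (rule finite_subset) simp
  then show ?thesis by auto
qed

declare mtype.simps [simp del]

lemma mtype_cong:
  assumes "\<And>i. i < N \<Longrightarrow> E i \<inter> D = E' i \<inter> D" shows "mtype N k D E = mtype N k D E'"
  using assms
proof (induction k arbitrary: E E')
  have *: "meet_facts N D E = meet_facts N D E' \<and> prec_facts N D E = prec_facts N D E'"
    if "\<And>i. i < N \<Longrightarrow> E i \<inter> D = E' i \<inter> D" for E E'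
  proof -
    have "p \<in> E i \<longleftrightarrow> p \<in> E' i" if "i < N" "p \<in> D" for i p using \<open>\<And>i. i < N \<Longrightarrow> E i \<inter> D = E' i \<inter> D\<close> that by blast
    then have "(i < N \<and> j < N \<and> (\<exists>p\<in>D. p \<in> E i \<and> p \<in> E j)) = (i < N \<and> j < N \<and> (\<exists>p\<in>D. p \<in> E' i \<and> p \<in> E' j))"
      "(i < N \<and> j < N \<and> (\<exists>p\<in>D. \<exists>q\<in>D. p < q \<and> p \<in> E i \<and> q \<in> E j)) =
       (i < N \<and> j < N \<and> (\<exists>p\<in>D. \<exists>q\<in>D. p < q \<and> p \<in> E' i \<and> q \<in> E' j))" for i j
      by blast+
    then show ?thesis unfolding meet_facts_def prec_facts_def by simp
  qed
  {
    case 0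
    then show ?case using *[OF 0] by (simp add: mtype.simps)
  next
    case (Suc k)
    show ?case
    proof (rule type_eqI)
      fix i
      have "mtype N k D (E(i := S)) = mtype N k D (E'(i := S))" for S
        using Suc.prems by (intro Suc.IH) auto
      then show "kids i (mtype N (Suc k) D E) = kids i (mtype N (Suc k) D E')"
        by (simp add: kids_mtype_Suc)
    qed (use *[OF Suc.prems] in simp_all)
  }
qed

text \<open>The composition method: subsets of the union correspond to independent choices of a
  subset of each part, since the parts are disjoint. By induction on the rank the kids of the union
  are then the products of kids.\<close>

lemma mtype_union:
  assumes "\<And>p q. p \<in> D1 \<Longrightarrow> q \<in> D2 \<Longrightarrow> p < q"
  shows "mtype N k (D1 \<union> D2) E = tmul (mtype N k D1 E) (mtype N k D2 E)"
proof (induction k arbitrary: E)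
  have m: "meet_facts N (D1 \<union> D2) E = meet_facts N D1 E \<union> meet_facts N D2 E" for E
    unfolding meet_facts_def by blast
  have l: "prec_facts N (D1 \<union> D2) E = prec_facts N D1 E \<union> prec_facts N D2 E \<union>
    {prod_encode (i, j) |i j. prod_encode (i, i) \<in> meet_facts N D1 E \<and> prod_encode (j, j) \<in> meet_facts N D2 E}" for E
  proof -
    have "(\<exists>p\<in>D1 \<union> D2. \<exists>q\<in>D1 \<union> D2. p < q \<and> p \<in> E i \<and> q \<in> E j) \<longleftrightarrow>
      (\<exists>p\<in>D1. \<exists>q\<in>D1. p < q \<and> p \<in> E i \<and> q \<in> E j) \<or> (\<exists>p\<in>D2. \<exists>q\<in>D2. p < q \<and> p \<in> E i \<and> q \<in> E j) \<or>
      (\<exists>p\<in>D1. p \<in> E i) \<and> (\<exists>q\<in>D2. q \<in> E j)" for i j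
    proof
      assume "\<exists>p\<in>D1 \<union> D2. \<exists>q\<in>D1 \<union> D2. p < q \<and> p \<in> E i \<and> q \<in> E j"
      then obtain p q where pq: "p \<in> D1 \<union> D2" "q \<in> D1 \<union> D2" "p < q" "p \<in> E i" "q \<in> E j" by blast
      have "\<not> (p \<in> D2 \<and> q \<in> D1)" using assms[of q p] pq(3) by auto
      with pq show "(\<exists>p\<in>D1. \<exists>q\<in>D1. p < q \<and> p \<in> E i \<and> q \<in> E j) \<or>
        (\<exists>p\<in>D2. \<exists>q\<in>D2. p < q \<and> p \<in> E i \<and> q \<in> E j) \<or> (\<exists>p\<in>D1. p \<in> E i) \<and> (\<exists>q\<in>D2. q \<in> E j)"
        by blast
    next
      assume "(\<exists>p\<in>D1. \<exists>q\<in>D1. p < q \<and> p \<in> E i \<and> q \<in> E j) \<or>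
        (\<exists>p\<in>D2. \<exists>q\<in>D2. p < q \<and> p \<in> E i \<and> q \<in> E j) \<or> (\<exists>p\<in>D1. p \<in> E i) \<and> (\<exists>q\<in>D2. q \<in> E j)"
      then show "\<exists>p\<in>D1 \<union> D2. \<exists>q\<in>D1 \<union> D2. p < q \<and> p \<in> E i \<and> q \<in> E j"
        using assms by blast
    qed
    then show ?thesis
    proof (intro prod_encode_set_eqI)
      fix i j
      have "prod_encode (i, j) \<in> {prod_encode (i, j) |i j. prod_encode (i, i) \<in> meet_facts N D1 E \<and> prod_encode (j, j) \<in> meet_facts N D2 E}
        \<longleftrightarrow> i < N \<and> j < N \<and> (\<exists>p\<in>D1. p \<in> E i) \<and> (\<exists>q\<in>D2. q \<in> E j)"
        by auto
      then show "prod_encode (i, j) \<in> prec_facts N (D1 \<union> D2) E \<longleftrightarrow> prod_encode (i, j) \<in> prec_facts N D1 E \<union> prec_facts N D2 E \<union>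
        {prod_encode (i, j) |i j. prod_encode (i, i) \<in> meet_facts N D1 E \<and> prod_encode (j, j) \<in> meet_facts N D2 E}"
        unfolding Un_iff mem_prec_facts \<open>\<And>j i. (\<exists>p\<in>D1 \<union> D2. \<exists>q\<in>D1 \<union> D2. p < q \<and> p \<in> E i \<and> q \<in> E j) \<longleftrightarrow>
      (\<exists>p\<in>D1. \<exists>q\<in>D1. p < q \<and> p \<in> E i \<and> q \<in> E j) \<or> (\<exists>p\<in>D2. \<exists>q\<in>D2. p < q \<and> p \<in> E i \<and> q \<in> E j) \<or>
      (\<exists>p\<in>D1. p \<in> E i) \<and> (\<exists>q\<in>D2. q \<in> E j)\<close> by argo
    qed
  qed
  {
    case 0
    show ?case by (rule type_eqI) (simp_all add: m l precs_tmul kids_tmul)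
  next
    case (Suc k)
    show ?case
    proof (rule type_eqI)
      fix i
      show "kids i (mtype N (Suc k) (D1 \<union> D2) E) = kids i (tmul (mtype N (Suc k) D1 E) (mtype N (Suc k) D2 E))"
      proof (cases "i < N")
        case True
        have "{mtype N k (D1 \<union> D2) (E(i := S)) |S. S \<subseteq> D1 \<union> D2} =
          {tmul (mtype N k D1 (E(i := S1))) (mtype N k D2 (E(i := S2))) |S1 S2. S1 \<subseteq> D1 \<and> S2 \<subseteq> D2}" (is "?L = ?R")
        proof (intro equalityI subsetI)
          fix x assume "x \<in> ?L"
          then obtain S where "x = mtype N k (D1 \<union> D2) (E(i := S))" "S \<subseteq> D1 \<union> D2" by blast
          moreover have "mtype N k D1 (E(i := S)) = mtype N k D1 (E(i := S \<inter> D1))"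
            "mtype N k D2 (E(i := S)) = mtype N k D2 (E(i := S \<inter> D2))"
            by (rule mtype_cong; auto)+
          ultimately have "x = tmul (mtype N k D1 (E(i := S \<inter> D1))) (mtype N k D2 (E(i := S \<inter> D2)))"
            using Suc by (simp del: fun_upd_apply)
          then show "x \<in> ?R" by blast
        next
          fix x assume "x \<in> ?R"
          then obtain S1 S2 where S: "S1 \<subseteq> D1" "S2 \<subseteq> D2"
            and x: "x = tmul (mtype N k D1 (E(i := S1))) (mtype N k D2 (E(i := S2)))" by blast
          have "D1 \<inter> D2 = {}" using assms by fastforce
          then have "mtype N k D1 (E(i := S1 \<union> S2)) = mtype N k D1 (E(i := S1))"
            "mtype N k D2 (E(i := S1 \<union> S2)) = mtype N k D2 (E(i := S2))"
            using S by (intro mtype_cong; simp; blast)+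
          with x have "x = mtype N k (D1 \<union> D2) (E(i := S1 \<union> S2))" using Suc by (simp del: fun_upd_apply)
          then show "x \<in> ?L" using S by blast
        qed
        then show ?thesis using True by (auto simp: kids_mtype_Suc kids_tmul)
      qed (simp add: kids_mtype_Suc kids_tmul)
    qed (simp_all add: m l precs_tmul)
  }
qed

lemma mtype_split:
  fixes a b c :: int
  assumes "a \<le> b" "b \<le> c"
  shows "mtype N k {a..<c} E = tmul (mtype N k {a..<b} E) (mtype N k {b..<c} E)"
  using mtype_union[of "{a..<b}" "{b..<c}"] assms by (simp add: ivl_disj_un)

lemma mtype_blocks:
  fixes h :: "int \<Rightarrow> int"
  assumes "strict_mono h"
  shows "mtype N k {h m..<h (m + 1 + int j)} E = tprod (\<lambda>i. mtype N k {h (m + int i)..<h (m + int i + 1)} E) j"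
proof (induction j)
  case (Suc j)
  have "h m \<le> h (m + 1 + int j)" "h (m + 1 + int j) \<le> h (m + 1 + int (Suc j))"
    using assms by (simp_all add: strict_mono_less_eq)
  from mtype_split[OF this] have "mtype N k {h m..<h (m + 1 + int (Suc j))} E =
    tmul (mtype N k {h m..<h (m + 1 + int j)} E) (mtype N k {h (m + 1 + int j)..<h (m + 1 + int (Suc j))} E)" .
  moreover have "m + 1 + int j = m + int (Suc j)" "m + 1 + int (Suc j) = m + int (Suc j) + 1" by auto
  ultimately show ?case using Suc.IH unfolding tprod.simps by metis
qed simp

lemma is_type_tmul: "is_type N k s \<Longrightarrow> is_type N k t \<Longrightarrow> is_type N k (tmul s t)"
proof (induction k arbitrary: s t)
  have *: "precs (tmul s t) \<subseteq> prod_encode ` ({..<N} \<times> {..<N})"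
    if "meets s \<union> precs s \<subseteq> prod_encode ` ({..<N} \<times> {..<N})" "meets t \<union> precs t \<subseteq> prod_encode ` ({..<N} \<times> {..<N})" for s t
  proof -
    have "i < N" if "prod_encode (i, i) \<in> meets s" for i
    proof -
      have "prod_encode (i, i) \<in> prod_encode ` ({..<N} \<times> {..<N})" using that \<open>meets s \<union> precs s \<subseteq> _\<close> by blast
      then show ?thesis by auto
    qed
    moreover have "i < N" if "prod_encode (i, i) \<in> meets t" for i
    proof -
      have "prod_encode (i, i) \<in> prod_encode ` ({..<N} \<times> {..<N})" using that \<open>meets t \<union> precs t \<subseteq> _\<close> by blast
      then show ?thesis by auto
    qed
    ultimately show ?thesis using that unfolding precs_tmul by auto
  qed
  {
    case 0
    then show ?case using *[of s t] by (auto simp: kidset_tmul)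
  next
    case (Suc k)
    then show ?case using *[of s t] by (auto simp: kids_tmul)
  }
qed

lemma is_type_generated: "x \<in> generated A \<Longrightarrow> (\<And>a. a \<in> A \<Longrightarrow> is_type N k a) \<Longrightarrow> is_type N k x"
  by (induction rule: generated.induct) (auto intro: is_type_tmul)


section \<open>Truth in factorised bi-infinite words\<close>

definition block_type :: "nat \<Rightarrow> nat \<Rightarrow> nat \<Rightarrow> int \<Rightarrow> nat" where
  "block_type a b c n = (if n < 0 then a else if n = 0 then b else c)"

text \<open>
  Factorisations of type \<open>\<dots> a a b c c \<dots>\<close>; the block of type
  \<open>b\<close> has number 0.
\<close>

definition zfactored :: "nat \<Rightarrow> nat \<Rightarrow> (nat \<Rightarrow> int set) \<Rightarrow> (int \<Rightarrow> int) \<Rightarrow> nat \<Rightarrow> nat \<Rightarrow> nat \<Rightarrow> bool" where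
  "zfactored N k E h a b c \<longleftrightarrow> strict_mono h \<and> (\<forall>n. mtype N k {h n..<h (n + 1)} E = block_type a b c n)"

lemma int_strict_monoI:
  fixes f :: "int \<Rightarrow> int"
  assumes "\<And>n. f n < f (n + 1)" shows "strict_mono f"
proof (rule strict_monoI)
  have *: "f m < f (m + 1 + int j)" for m j
  proof (induction j)
    case (Suc j)
    then show ?case using assms[of "m + 1 + int j"] by (simp add: ac_simps)
  qed (simp add: assms)
  fix m n :: int assume "m < n"
  then show "f m < f n" using *[of m "nat (n - m - 1)"] by simp
qed

lemma int_strict_mono_block:
  fixes h :: "int \<Rightarrow> int"
  assumes "strict_mono h" shows "\<exists>n. h n \<le> p \<and> p < h (n + 1)"
proof (induction p rule: int_induct[where k = "h 0"])
  case base
  show ?case using assms by (intro exI[of _ 0]) (simp add: strict_mono_less)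
next
  case (step1 p)
  then obtain n where n: "h n \<le> p" "p < h (n + 1)" by blast
  have "h (n + 1) < h (n + 1 + 1)" using assms by (simp add: strict_mono_less)
  then show ?case using n by (cases "p + 1 < h (n + 1)") (auto intro: exI[of _ n] exI[of _ "n + 1"])
next
  case (step2 p)
  then obtain n where n: "h n \<le> p" "p < h (n + 1)" by blast
  have "h (n - 1) < h n" using assms by (simp add: strict_mono_less)
  then show ?case using n by (cases "h n \<le> p - 1") (auto intro: exI[of _ n] exI[of _ "n - 1"])
qed

lemma int_strict_mono_block_unique:
  fixes h :: "int \<Rightarrow> int"
  assumes "strict_mono h" "h m \<le> p" "p < h (m + 1)" "h n \<le> p" "p < h (n + 1)"
  shows "m = n"
proof -
  have "h m < h (n + 1)" "h n < h (m + 1)" using assms by linarith+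
  then show ?thesis using assms(1) by (simp add: strict_mono_less)
qed

text \<open>
  Two blocks on either side of the middle one suffice, since atomic formulas speak about two
  positions only.
\<close>

definition five_blocks :: "nat \<Rightarrow> nat \<Rightarrow> nat \<Rightarrow> nat" where
  "five_blocks a b c = tmul a (tmul a (tmul b (tmul c c)))"

lemma zfactored_five_blocks:
  assumes "zfactored N k E h a b c" shows "five_blocks a b c = mtype N k {h (- 2)..<h 3} E"
proof -
  have h: "strict_mono h" and t: "\<And>n. mtype N k {h n..<h (n + 1)} E = block_type a b c n"
    using assms by (auto simp: zfactored_def)
  have le: "m \<le> n \<Longrightarrow> h m \<le> h n" for m n using h by (simp add: strict_mono_less_eq)
  have "mtype N k {h (- 2)..<h 3} E = tmul (mtype N k {h (-2)..<h (- 1)} E) (tmul (mtype N k {h (- 1)..<h 0} E)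
    (tmul (mtype N k {h 0..<h 1} E) (tmul (mtype N k {h 1..<h 2} E) (mtype N k {h 2..<h 3} E))))"
    using mtype_split[OF le le, of "-2" "-1" 3 N k E] mtype_split[OF le le, of "-1" 0 3 N k E]
      mtype_split[OF le le, of 0 1 3 N k E] mtype_split[OF le le, of 1 2 3 N k E] by simp
  then show ?thesis using t[of "-2"] t[of "-1"] t[of 0] t[of 1] t[of 2]
    by (simp add: block_type_def five_blocks_def)
qed

text \<open>Blocks of equal type have the same facts, so a witness in any block can be moved into
  block -1, 0 or 1, according to the sign of its block number.\<close>

lemma meets_five_blocks:
  assumes z: "zfactored N k E h a b c"
  shows "prod_encode (i, j) \<in> meets (five_blocks a b c) \<longleftrightarrow> i < N \<and> j < N \<and> (\<exists>p. p \<in> E i \<and> p \<in> E j)"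
proof -
  have h: "strict_mono h" and t: "\<And>n. mtype N k {h n..<h (n + 1)} E = block_type a b c n"
    using z by (auto simp: zfactored_def)
  have le: "m \<le> n \<Longrightarrow> h m \<le> h n" for m n using h by (simp add: strict_mono_less_eq)
  have "\<exists>p\<in>{h (- 2)..<h 3}. p \<in> E i \<and> p \<in> E j" if ij: "i < N" "j < N" "p \<in> E i" "p \<in> E j" for p
  proof -
    obtain n where n: "h n \<le> p" "p < h (n + 1)" using int_strict_mono_block[OF h] by blast
    define m where "m = (if n < 0 then - 1 else if n = 0 then 0 else 1 :: int)"
    have "block_type a b c m = block_type a b c n" by (simp add: m_def block_type_def)
    then have "meets (mtype N k {h m..<h (m + 1)} E) = meets (mtype N k {h n..<h (n + 1)} E)" using t by simp
    moreover have "prod_encode (i, j) \<in> meets (mtype N k {h n..<h (n + 1)} E)" using ij n by auto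
    ultimately have "prod_encode (i, j) \<in> meets (mtype N k {h m..<h (m + 1)} E)" by (simp only:)
    then obtain q where "q \<in> {h m..<h (m + 1)}" "q \<in> E i" "q \<in> E j" by auto
    moreover have "h (- 2) \<le> h m" "h (m + 1) \<le> h 3" by (auto intro!: le simp: m_def)
    ultimately show ?thesis by fastforce
  qed
  then show ?thesis unfolding zfactored_five_blocks[OF z] by auto
qed

lemma precs_five_blocks:
  assumes z: "zfactored N k E h a b c"
  shows "prod_encode (i, j) \<in> precs (five_blocks a b c) \<longleftrightarrow> i < N \<and> j < N \<and> (\<exists>p q. p < q \<and> p \<in> E i \<and> q \<in> E j)"
proof -
  have h: "strict_mono h" and t: "\<And>n. mtype N k {h n..<h (n + 1)} E = block_type a b c n"
    using z by (auto simp: zfactored_def)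
  have le: "m \<le> n \<Longrightarrow> h m \<le> h n" for m n using h by (simp add: strict_mono_less_eq)
  have "\<exists>p\<in>{h (- 2)..<h 3}. \<exists>q\<in>{h (- 2)..<h 3}. p < q \<and> p \<in> E i \<and> q \<in> E j"
    if ij: "i < N" "j < N" "p < q" "p \<in> E i" "q \<in> E j" for p q
  proof -
    obtain m where m: "h m \<le> p" "p < h (m + 1)" using int_strict_mono_block[OF h] by blast
    obtain n where n: "h n \<le> q" "q < h (n + 1)" using int_strict_mono_block[OF h] by blast
    have "h m < h (n + 1)" using m n ij by linarith
    then have mn: "m \<le> n" using h by (simp add: strict_mono_less)
    show ?thesis
    proof (cases "m = n")
      case True
      define l where "l = (if n < 0 then - 1 else if n = 0 then 0 else 1 :: int)"
      have "block_type a b c l = block_type a b c n" by (simp add: l_def block_type_def)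
      then have "precs (mtype N k {h l..<h (l + 1)} E) = precs (mtype N k {h n..<h (n + 1)} E)" using t by simp
      moreover have "prod_encode (i, j) \<in> precs (mtype N k {h n..<h (n + 1)} E)"
      proof -
        have "p \<in> {h n..<h (n + 1)}" "q \<in> {h n..<h (n + 1)}" using ij(3) m n True by auto
        then show ?thesis using ij unfolding precs_mtype mem_prec_facts by blast
      qed
      ultimately have "prod_encode (i, j) \<in> precs (mtype N k {h l..<h (l + 1)} E)" by (simp only:)
      then obtain q q' where "q \<in> {h l..<h (l + 1)}" "q' \<in> {h l..<h (l + 1)}" "q < q'" "q \<in> E i" "q' \<in> E j"
        by auto
      moreover have "h (- 2) \<le> h l" "h (l + 1) \<le> h 3" by (auto intro!: le simp: l_def)
      ultimately show ?thesis by fastforce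
    next
      case False
      \<comment> \<open>The relocated blocks keep their types and their order: two left blocks go to
        -2 and -1, two right ones to 1 and 2, and all other pairs fit into -1, 0, 1.\<close>
      define m' where "m' = (if n < 0 then - 2 else if m < 0 then - 1 else if m = 0 then 0 else 1 :: int)"
      define n' where "n' = (if n < 0 then - 1 else if n = 0 then 0 else if m \<le> 0 then 1 else 2 :: int)"
      have "block_type a b c m' = block_type a b c m" "block_type a b c n' = block_type a b c n"
        using mn by (simp_all add: m'_def n'_def block_type_def)
      then have "meets (mtype N k {h m'..<h (m' + 1)} E) = meets (mtype N k {h m..<h (m + 1)} E)"
        "meets (mtype N k {h n'..<h (n' + 1)} E) = meets (mtype N k {h n..<h (n + 1)} E)" using t by simp_all
      moreover have "prod_encode (i, i) \<in> meets (mtype N k {h m..<h (m + 1)} E)"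
        "prod_encode (j, j) \<in> meets (mtype N k {h n..<h (n + 1)} E)" using ij m n by auto
      ultimately have "prod_encode (i, i) \<in> meets (mtype N k {h m'..<h (m' + 1)} E)"
        "prod_encode (j, j) \<in> meets (mtype N k {h n'..<h (n' + 1)} E)" by (simp_all only:)
      then obtain q q' where "q \<in> {h m'..<h (m' + 1)}" "q' \<in> {h n'..<h (n' + 1)}" "q \<in> E i" "q' \<in> E j"
        by auto
      moreover have "h (- 2) \<le> h m'" "h (m' + 1) \<le> h n'" "h n' \<le> h 3" "h (- 2) \<le> h n'" "h (n' + 1) \<le> h 3"
        "h (m' + 1) \<le> h 3" using False mn by (auto intro!: le simp: m'_def n'_def)
      ultimately show ?thesis by (intro bexI[of _ q] bexI[of _ q'] conjI) auto
    qed
  qed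
  then show ?thesis unfolding zfactored_five_blocks[OF z] precs_mtype mem_prec_facts by blast
qed

text \<open>Describes the shapes that can result from overwriting label \<open>i\<close>. The
  stretches \<open>x\<close> and \<open>y\<close> lie between the old middle block and the new
  periodic parts; the new middle block absorbs them.\<close>

definition expansion :: "nat \<Rightarrow> nat \<Rightarrow> nat \<Rightarrow> nat \<Rightarrow> nat \<Rightarrow> nat \<Rightarrow> nat \<Rightarrow> bool" where
  "expansion i a b c a' m c' \<longleftrightarrow> a' \<in> generated (kids i a) \<and> c' \<in> generated (kids i c) \<and>
     (\<exists>x\<in>generated (kids i a). \<exists>b'\<in>kids i b. \<exists>y\<in>generated (kids i c). m = tmul x (tmul b' y))"

text \<open>Every block of the old factorisation can be relabelled independently of the others, so
  any assignment of kids to blocks is realised by one set; regrouping the blocks then yields the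
  prescribed products.\<close>

lemma expansion_realized:
  assumes z: "zfactored N (Suc k) E h a b c" and ext: "expansion i a b c a' m c'" and i: "i < N"
  shows "\<exists>S h'. zfactored N k (E(i := S)) h' a' m c'"
proof -
  have h: "strict_mono h" and t: "\<And>n. mtype N (Suc k) {h n..<h (n + 1)} E = block_type a b c n"
    using z by (auto simp: zfactored_def)
  have le: "m \<le> n \<Longrightarrow> h m \<le> h n" for m n using h by (simp add: strict_mono_less_eq)
  obtain x b' y where x: "x \<in> generated (kids i a)" and b': "b' \<in> kids i b" and y: "y \<in> generated (kids i c)"
    and m: "m = tmul x (tmul b' y)" and a': "a' \<in> generated (kids i a)" and c': "c' \<in> generated (kids i c)"
    using ext by (auto simp: expansion_def)
  obtain \<alpha>a ja where \<alpha>a: "\<forall>l. \<alpha>a l \<in> kids i a" "a' = tprod \<alpha>a ja" using generated_tprod[OF a'] by blast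
  obtain \<alpha>x jx where \<alpha>x: "\<forall>l. \<alpha>x l \<in> kids i a" "x = tprod \<alpha>x jx" using generated_tprod[OF x] by blast
  obtain \<alpha>y jy where \<alpha>y: "\<forall>l. \<alpha>y l \<in> kids i c" "y = tprod \<alpha>y jy" using generated_tprod[OF y] by blast
  obtain \<alpha>c jc where \<alpha>c: "\<forall>l. \<alpha>c l \<in> kids i c" "c' = tprod \<alpha>c jc" using generated_tprod[OF c'] by blast
  \<comment> \<open>Next to \<open>b'\<close> at block 0 stand the \<open>1 + jy\<close> factors of
    \<open>y\<close> on the right and the \<open>1 + jx\<close> factors of \<open>x\<close> on the
    left; beyond them the factors of \<open>c'\<close> and \<open>a'\<close> repeat. As
    \<open>mod\<close> is nonnegative for a positive divisor, the left part is also read from left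
    to right within each period.\<close>
  define \<delta> where "\<delta> n = (if n = 0 then b' else if 0 < n then
      (if n \<le> 1 + int jy then \<alpha>y (nat (n - 1)) else \<alpha>c (nat ((n - (2 + int jy)) mod (1 + int jc))))
      else if - 1 - int jx \<le> n then \<alpha>x (nat (n + 1 + int jx)) else \<alpha>a (nat ((n + 1 + int jx) mod (1 + int ja))))"
    for n :: int
  have "\<delta> n \<in> kids i (block_type a b c n)" for n
    using b' \<alpha>a \<alpha>x \<alpha>y \<alpha>c by (simp add: \<delta>_def block_type_def)
  then have "\<delta> n \<in> kids i (mtype N (Suc k) {h n..<h (n + 1)} E)" for n by (simp add: t)
  then have "\<exists>S. S \<subseteq> {h n..<h (n + 1)} \<and> mtype N k {h n..<h (n + 1)} (E(i := S)) = \<delta> n" for n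
  proof -
    have "\<delta> n \<in> {mtype N k {h n..<h (n + 1)} (E(i := S)) |S. S \<subseteq> {h n..<h (n + 1)}}"
      using \<open>\<And>n. \<delta> n \<in> kids i (mtype N (Suc k) {h n..<h (n + 1)} E)\<close>[of n] i
      by (simp only: kids_mtype_Suc if_True)
    then obtain S where "\<delta> n = mtype N k {h n..<h (n + 1)} (E(i := S))" "S \<subseteq> {h n..<h (n + 1)}"
      by (elim CollectE exE conjE)
    then show ?thesis by (intro exI[of _ S] conjI) (simp_all only:)
  qed
  then obtain T where T: "\<And>n. T n \<subseteq> {h n..<h (n + 1)}" "\<And>n. mtype N k {h n..<h (n + 1)} (E(i := T n)) = \<delta> n"
    by metis
  define S where "S = (\<Union>n. T n)"
  have "S \<inter> {h n..<h (n + 1)} = T n" for n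
  proof
    show "T n \<subseteq> S \<inter> {h n..<h (n + 1)}" using T(1)[of n] by (auto simp: S_def)
    show "S \<inter> {h n..<h (n + 1)} \<subseteq> T n"
    proof
      fix p assume "p \<in> S \<inter> {h n..<h (n + 1)}"
      then obtain l where "p \<in> T l" "h n \<le> p" "p < h (n + 1)" by (auto simp: S_def)
      moreover from this have "h l \<le> p" "p < h (l + 1)" using T(1)[of l] by auto
      ultimately show "p \<in> T n" using int_strict_mono_block_unique[OF h] by metis
    qed
  qed
  then have "mtype N k {h n..<h (n + 1)} (E(i := S)) = mtype N k {h n..<h (n + 1)} (E(i := T n))" for n
    by (intro mtype_cong) (use T(1) in auto)
  then have \<delta>: "mtype N k {h n..<h (n + 1)} (E(i := S)) = \<delta> n" for n using T(2) by simp
  have seg: "mtype N k {h l..<h (l + 1 + int j)} (E(i := S)) = tprod (\<lambda>u. \<delta> (l + int u)) j" for l j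
    using mtype_blocks[OF h] \<delta> by simp
  \<comment> \<open>One new block is one full period of \<open>\<delta>\<close>, except that block 0
    comprises the factors of \<open>x\<close>, \<open>b'\<close> and \<open>y\<close>.\<close>
  define h' where "h' n = (if n \<le> 0 then h (n * (1 + int ja) - 1 - int jx) else h ((n - 1) * (1 + int jc) + 2 + int jy))"
    for n :: int
  have "zfactored N k (E(i := S)) h' a' m c'"
    unfolding zfactored_def
  proof (intro conjI allI)
    show "strict_mono h'"
    proof (rule int_strict_monoI)
      fix n :: int
      consider "n < 0" | "n = 0" | "0 < n" by linarith
      then show "h' n < h' (n + 1)"
        by cases (use h in \<open>simp_all add: h'_def strict_mono_less algebra_simps\<close>)
    qed
    fix n :: int
    consider "n < 0" | "n = 0" | "0 < n" by linarith
    then show "mtype N k {h' n..<h' (n + 1)} (E(i := S)) = block_type a' m c' n"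
    proof cases
      case 1
      define l where "l = n * (1 + int ja) - 1 - int jx"
      have "{h' n..<h' (n + 1)} = {h l..<h (l + 1 + int ja)}"
        using 1 by (simp add: h'_def l_def algebra_simps)
      moreover have "tprod (\<lambda>u. \<delta> (l + int u)) ja = tprod \<alpha>a ja"
      proof (rule tprod_cong)
        fix u assume u: "u \<le> ja"
        have "(l + int u + 1 + int jx) mod (1 + int ja) = (n * (1 + int ja) + int u) mod (1 + int ja)"
          by (simp add: l_def algebra_simps)
        also have "\<dots> = int u" using u by (simp only: mod_mult_self3) simp
        finally have 2: "(l + int u + 1 + int jx) mod (1 + int ja) = int u" .
        have "n * (1 + int ja) \<le> - 1 * (1 + int ja)" using 1 by (intro mult_right_mono) auto
        then have "l + int u < - 1 - int jx" using u by (simp add: l_def)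
        then show "\<delta> (l + int u) = \<alpha>a u" using 2 by (simp add: \<delta>_def)
      qed
      ultimately show ?thesis using 1 seg[of l ja] \<alpha>a(2) by (simp add: block_type_def)
    next
      case 2
      have "tprod (\<lambda>u. \<delta> (- 1 - int jx + int u)) jx = tprod \<alpha>x jx"
        by (rule tprod_cong) (simp add: \<delta>_def)
      then have "mtype N k {h (- 1 - int jx)..<h 0} (E(i := S)) = x"
        using seg[of "- 1 - int jx" jx] \<alpha>x(2) by simp
      moreover have "tprod (\<lambda>u. \<delta> (1 + int u)) jy = tprod \<alpha>y jy"
        by (rule tprod_cong) (simp add: \<delta>_def)
      then have "mtype N k {h 1..<h (2 + int jy)} (E(i := S)) = y"
        using seg[of 1 jy] \<alpha>y(2) by simp
      moreover have "mtype N k {h 0..<h 1} (E(i := S)) = b'" using \<delta>[of 0] by (simp add: \<delta>_def)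
      moreover have "{h' n..<h' (n + 1)} = {h (- 1 - int jx)..<h (2 + int jy)}"
        using 2 by (simp add: h'_def)
      moreover have "h (- 1 - int jx) \<le> h 0" "h 0 \<le> h 1" "h 1 \<le> h (2 + int jy)" "h 0 \<le> h (2 + int jy)"
        by (auto intro!: le)
      ultimately show ?thesis using 2 mtype_split[of "h (- 1 - int jx)" "h 0" "h (2 + int jy)" N k "E(i := S)"]
          mtype_split[of "h 0" "h 1" "h (2 + int jy)" N k "E(i := S)"]
        by (simp add: block_type_def m)
    next
      case 3
      define l where "l = (n - 1) * (1 + int jc) + 2 + int jy"
      have "{h' n..<h' (n + 1)} = {h l..<h (l + 1 + int jc)}"
        using 3 by (simp add: h'_def l_def algebra_simps)
      moreover have "tprod (\<lambda>u. \<delta> (l + int u)) jc = tprod \<alpha>c jc"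
      proof (rule tprod_cong)
        fix u assume u: "u \<le> jc"
        have "(l + int u - (2 + int jy)) mod (1 + int jc) = ((n - 1) * (1 + int jc) + int u) mod (1 + int jc)"
          by (simp add: l_def)
        also have "\<dots> = int u" using u by (simp only: mod_mult_self3) simp
        finally have 2: "(l + int u - (2 + int jy)) mod (1 + int jc) = int u" .
        have "0 \<le> (n - 1) * (1 + int jc)" using 3 by simp
        then have "1 + int jy < l + int u" by (simp add: l_def)
        then show "\<delta> (l + int u) = \<alpha>c u" using 2 by (simp add: \<delta>_def)
      qed
      ultimately show ?thesis using 3 seg[of l jc] \<alpha>c(2) by (simp add: block_type_def)
    qed
  qed
  then show ?thesis by blast
qed

text \<open>Ramsey's theorem colours unordered pairs; \<open>Min\<close> and \<open>Max\<close>
  orient them, and enumerating the homogeneous set gives an increasing sequence.\<close>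

lemma ramsey_strict_mono:
  fixes f :: "nat \<Rightarrow> nat \<Rightarrow> nat"
  assumes "\<And>m n. f m n < s"
  shows "\<exists>r t. strict_mono (r :: nat \<Rightarrow> nat) \<and> (\<forall>m n. m < n \<longrightarrow> f (r m) (r n) = t)"
proof -
  have "\<forall>x\<in>UNIV. \<forall>y\<in>UNIV. x \<noteq> y \<longrightarrow> f (Min {x, y}) (Max {x, y}) < s" using assms by blast
  from Ramsey2[OF infinite_UNIV_nat this] obtain Y t where Y: "infinite Y"
    "\<forall>x\<in>Y. \<forall>y\<in>Y. x \<noteq> y \<longrightarrow> f (Min {x, y}) (Max {x, y}) = t" by blast
  have "f (enumerate Y m) (enumerate Y n) = t" if "m < n" for m n
  proof -
    have "enumerate Y m < enumerate Y n" using that Y(1) by (simp add: enumerate_mono)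
    moreover have "enumerate Y m \<in> Y" "enumerate Y n \<in> Y" using Y(1) by (auto intro: enumerate_in_set)
    ultimately show ?thesis using Y(2)[rule_format, of "enumerate Y m" "enumerate Y n"] by simp
  qed
  then show ?thesis using strict_mono_enumerate[OF Y(1)] by blast
qed

text \<open>Converse of \<open>expansion_realized\<close>: in each half the pairs of cuts are
  coloured by the type of the interval between them. A homogeneous sequence of cuts gives the
  repeated type, which is a product of kids because every interval between cuts consists of old
  blocks.\<close>

lemma expansion_exists:
  assumes z: "zfactored N (Suc k) E h a b c" and i: "i < N"
  shows "\<exists>h' a' m c'. expansion i a b c a' m c' \<and> zfactored N k (E(i := S)) h' a' m c'"
proof -
  have h: "strict_mono h" and t: "\<And>n. mtype N (Suc k) {h n..<h (n + 1)} E = block_type a b c n"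
    using z by (auto simp: zfactored_def)
  have le: "m \<le> n \<Longrightarrow> h m \<le> h n" for m n using h by (simp add: strict_mono_less_eq)
  let ?E = "E(i := S)"
  define \<beta> where "\<beta> n = mtype N k {h n..<h (n + 1)} ?E" for n
  have \<beta>: "\<beta> n \<in> kids i (block_type a b c n)" for n
  proof -
    have "\<beta> n = mtype N k {h n..<h (n + 1)} (E(i := S \<inter> {h n..<h (n + 1)}))"
      unfolding \<beta>_def by (rule mtype_cong) auto
    then have "\<beta> n \<in> kids i (mtype N (Suc k) {h n..<h (n + 1)} E)" using i by (auto simp: kids_mtype_Suc simp del: fun_upd_apply)
    then show ?thesis by (simp add: t)
  qed
  have seg: "mtype N k {h m..<h n} ?E \<in> generated A" if "m < n" "\<And>l. m \<le> l \<Longrightarrow> l < n \<Longrightarrow> \<beta> l \<in> A" for m n A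
  proof -
    define j where "j = nat (n - m - 1)"
    have n: "n = m + 1 + int j" using that(1) by (simp add: j_def)
    have "mtype N k {h m..<h n} ?E = tprod (\<lambda>u. \<beta> (m + int u)) j"
      unfolding n \<beta>_def by (rule mtype_blocks[OF h])
    also have "\<dots> \<in> generated A" by (rule tprod_generated) (use that(2) n in auto)
    finally show ?thesis .
  qed
  have segl: "mtype N k {h m..<h n} ?E \<in> generated (kids i a)" if "m < n" "n \<le> 0" for m n
  proof (intro seg that)
    fix l assume "m \<le> l" "l < n"
    then show "\<beta> l \<in> kids i a" using \<beta>[of l] that by (simp add: block_type_def)
  qed
  have segr: "mtype N k {h m..<h n} ?E \<in> generated (kids i c)" if "m < n" "1 \<le> m" for m n
  proof (intro seg that)
    fix l assume "m \<le> l" "l < n"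
    then show "\<beta> l \<in> kids i c" using \<beta>[of l] that by (simp add: block_type_def)
  qed
  \<comment> \<open>Cuts start one block away from the middle, at \<open>2\<close> and at
    \<open>- 1\<close>, so that the leftover stretches \<open>?x\<close> and \<open>?y\<close> are
    nonempty and belong to \<open>generated\<close>.\<close>
  obtain r :: "nat \<Rightarrow> nat" and c' where r: "strict_mono r"
    "\<And>m n. m < n \<Longrightarrow> mtype N k {h (2 + int (r m))..<h (2 + int (r n))} ?E = c'"
    using ramsey_strict_mono[of "\<lambda>m n. mtype N k {h (2 + int m)..<h (2 + int n)} ?E", OF mtype_less] by blast
  obtain l :: "nat \<Rightarrow> nat" and a' where l: "strict_mono l"
    "\<And>m n. m < n \<Longrightarrow> mtype N k {h (- 1 - int (l n))..<h (- 1 - int (l m))} ?E = a'"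
    using ramsey_strict_mono[of "\<lambda>m n. mtype N k {h (- 1 - int n)..<h (- 1 - int m)} ?E", OF mtype_less] by blast
  define h' where "h' n = (if n \<le> 0 then h (- 1 - int (l (nat (- n)))) else h (2 + int (r (nat (n - 1)))))" for n :: int
  let ?x = "mtype N k {h (- 1 - int (l 0))..<h 0} ?E" and ?y = "mtype N k {h 1..<h (2 + int (r 0))} ?E"
  let ?m = "tmul ?x (tmul (\<beta> 0) ?y)"
  have r1: "r m < r (Suc m)" and l1: "l m < l (Suc m)" for m
    using r(1) l(1) by (auto simp: strict_mono_def)
  have nats: "nat (- n) = Suc (nat (- (n + 1)))" if "n < 0" for n using that by linarith
  have natr: "nat n = Suc (nat (n - 1))" if "0 < n" for n using that by linarith
  have "zfactored N k ?E h' a' ?m c'"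
    unfolding zfactored_def
  proof (intro conjI allI)
    show "strict_mono h'"
    proof (rule int_strict_monoI)
      fix n :: int
      consider "n < 0" | "n = 0" | "0 < n" by linarith
      then show "h' n < h' (n + 1)"
      proof cases
        case 1
        then show ?thesis using h l1[of "nat (- (n + 1))"] nats[OF 1] by (simp add: h'_def strict_mono_less)
      next
        case 3
        then show ?thesis using h r1[of "nat (n - 1)"] natr[OF 3] by (simp add: h'_def strict_mono_less)
      qed (use h in \<open>simp add: h'_def strict_mono_less\<close>)
    qed
    fix n :: int
    consider "n < 0" | "n = 0" | "0 < n" by linarith
    then show "mtype N k {h' n..<h' (n + 1)} ?E = block_type a' ?m c' n"
    proof cases
      case 1
      then show ?thesis using l(2)[of "nat (- (n + 1))" "Suc (nat (- (n + 1)))"] nats[OF 1]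
        by (simp add: h'_def block_type_def)
    next
      case 2
      have *: "h (- 1 - int (l 0)) \<le> h 0" "h 0 \<le> h 1" "h 1 \<le> h (2 + int (r 0))" "h 0 \<le> h (2 + int (r 0))"
        by (auto intro!: le)
      show ?thesis using 2 mtype_split[OF *(1,4), of N k ?E] mtype_split[OF *(2,3), of N k ?E]
        by (simp add: h'_def block_type_def \<beta>_def)
    next
      case 3
      then show ?thesis using r(2)[of "nat (n - 1)" "Suc (nat (n - 1))"] natr[OF 3]
        by (simp add: h'_def block_type_def)
    qed
  qed
  moreover have "expansion i a b c a' ?m c'"
    unfolding expansion_def
  proof (intro conjI bexI)
    show "a' \<in> generated (kids i a)" using l(2)[of 0 1] segl[of "- 1 - int (l 1)" "- 1 - int (l 0)"] l1[of 0] by simp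
    show "c' \<in> generated (kids i c)" using r(2)[of 0 1] segr[of "2 + int (r 0)" "2 + int (r 1)"] r1[of 0] by simp
    show "\<beta> 0 \<in> kids i b" using \<beta>[of 0] by (simp add: block_type_def)
    show "?x \<in> generated (kids i a)" "?y \<in> generated (kids i c)" by (auto intro!: segl segr)
  qed (rule refl)
  ultimately show ?thesis by blast
qed

section \<open>Truth of formulas evaluated on triples of types\<close>

definition is_sing :: "nat \<Rightarrow> nat \<Rightarrow> bool" where
  "is_sing i t \<longleftrightarrow> prod_encode (i, i) \<in> meets t \<and> prod_encode (i, i) \<notin> precs t"

text \<open>An element quantifier is a set quantifier filtered by the singleton test; this is why
  types need only one sort of kids.\<close>

primrec type_sat :: "mso \<Rightarrow> nat \<Rightarrow> nat \<Rightarrow> nat \<Rightarrow> bool" where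
  "type_sat (Le x y) a b c \<longleftrightarrow> prod_encode (2 * x + 1, 2 * y + 1) \<in> meets (five_blocks a b c) \<union> precs (five_blocks a b c)"
| "type_sat (Eq x y) a b c \<longleftrightarrow> prod_encode (2 * x + 1, 2 * y + 1) \<in> meets (five_blocks a b c)"
| "type_sat (InP x) a b c \<longleftrightarrow> prod_encode (2 * x + 1, 0) \<in> meets (five_blocks a b c)"
| "type_sat (Mem x X) a b c \<longleftrightarrow> prod_encode (2 * x + 1, 2 * X + 2) \<in> meets (five_blocks a b c)"
| "type_sat (Neg \<phi>) a b c \<longleftrightarrow> \<not> type_sat \<phi> a b c"
| "type_sat (Conj \<phi> \<psi>) a b c \<longleftrightarrow> type_sat \<phi> a b c \<and> type_sat \<psi> a b c"
| "type_sat (ExElem x \<phi>) a b c \<longleftrightarrow>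
     (\<exists>a' m c'. expansion (2 * x + 1) a b c a' m c' \<and> is_sing (2 * x + 1) (five_blocks a' m c') \<and> type_sat \<phi> a' m c')"
| "type_sat (ExSet X \<phi>) a b c \<longleftrightarrow> (\<exists>a' m c'. expansion (2 * X + 2) a b c a' m c' \<and> type_sat \<phi> a' m c')"

primrec var_indices :: "mso \<Rightarrow> nat set" where
  "var_indices (Le x y) = {2 * x + 1, 2 * y + 1}"
| "var_indices (Eq x y) = {2 * x + 1, 2 * y + 1}"
| "var_indices (InP x) = {2 * x + 1}"
| "var_indices (Mem x X) = {2 * x + 1, 2 * X + 2}"
| "var_indices (Neg \<phi>) = var_indices \<phi>"
| "var_indices (Conj \<phi> \<psi>) = var_indices \<phi> \<union> var_indices \<psi>"
| "var_indices (ExElem x \<phi>) = insert (2 * x + 1) (var_indices \<phi>)"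
| "var_indices (ExSet X \<phi>) = insert (2 * X + 2) (var_indices \<phi>)"

lemma is_sing_five_blocks:
  assumes "zfactored N k E h a b c" "i < N"
  shows "is_sing i (five_blocks a b c) \<longleftrightarrow> (\<exists>p. E i = {p})"
proof -
  have "is_sing i (five_blocks a b c) \<longleftrightarrow> (\<exists>p. p \<in> E i) \<and> (\<forall>p q. p \<in> E i \<longrightarrow> q \<in> E i \<longrightarrow> \<not> p < q)"
    unfolding is_sing_def meets_five_blocks[OF assms(1)] precs_five_blocks[OF assms(1)] using assms(2) by blast
  also have "\<dots> \<longleftrightarrow> (\<exists>p. E i = {p})"
  proof
    assume *: "(\<exists>p. p \<in> E i) \<and> (\<forall>p q. p \<in> E i \<longrightarrow> q \<in> E i \<longrightarrow> \<not> p < q)"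
    then obtain p where "p \<in> E i" by blast
    moreover have "q = p" if "q \<in> E i" for q using * that \<open>p \<in> E i\<close> by (meson linorder_neqE)
    ultimately show "\<exists>p. E i = {p}" by blast
  qed auto
  finally show ?thesis .
qed

text \<open>By induction on the formula: each quantifier costs one rank.
  \<open>expansion_realized\<close> turns a chosen triple into a witness set, and
  \<open>expansion_exists\<close> turns a witness into a triple.\<close>

theorem type_sat_sat:
  assumes "zfactored N k E h a b c" "qrank \<phi> \<le> k" "0 < N" "var_indices \<phi> \<subseteq> {..<N}" "E 0 = Collect \<xi>"
    "\<forall>x\<in>free_elem \<phi>. E (2 * x + 1) = {e x}" "\<forall>X\<in>free_set \<phi>. E (2 * X + 2) = Es X"
  shows "type_sat \<phi> a b c \<longleftrightarrow> sat UNIV \<xi> e Es \<phi>"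
  using assms
proof (induction \<phi> arbitrary: k E h a b c e Es)
  case (Le x y)
  show ?case using Le meets_five_blocks[OF Le(1)] precs_five_blocks[OF Le(1)] by (auto simp del: One_nat_def)
next
  case (Eq x y)
  then show ?case using meets_five_blocks[OF Eq(1)] by auto
next
  case (InP x)
  then show ?case using meets_five_blocks[OF InP(1)] by auto
next
  case (Mem x X)
  then show ?case using meets_five_blocks[OF Mem(1)] by auto
next
  case (Neg \<phi>)
  have "type_sat \<phi> a b c \<longleftrightarrow> sat UNIV \<xi> e Es \<phi>"
    by (rule Neg.IH[OF Neg.prems(1)]) (use Neg.prems in auto)
  then show ?case by simp
next
  case (Conj \<phi> \<psi>)
  have "type_sat \<phi> a b c \<longleftrightarrow> sat UNIV \<xi> e Es \<phi>"
    by (rule Conj.IH(1)[OF Conj.prems(1)]) (use Conj.prems in auto)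
  moreover have "type_sat \<psi> a b c \<longleftrightarrow> sat UNIV \<xi> e Es \<psi>"
    by (rule Conj.IH(2)[OF Conj.prems(1)]) (use Conj.prems in auto)
  ultimately show ?case by simp
next
  case (ExElem x \<phi>)
  let ?i = "2 * x + 1"
  obtain k' where k: "k = Suc k'" "qrank \<phi> \<le> k'" using ExElem.prems(2) by (cases k) auto
  note z = ExElem.prems(1)[unfolded k(1)]
  have i: "?i < N" using ExElem.prems(4) by simp
  have *: "type_sat \<phi> a' m c' \<longleftrightarrow> sat UNIV \<xi> (e(x := d)) Es \<phi>" if "zfactored N k' (E(?i := {d})) h' a' m c'" for a' m c' h' d
  proof (rule ExElem.IH[OF that k(2) ExElem.prems(3)])
    show "var_indices \<phi> \<subseteq> {..<N}" "(E(?i := {d})) 0 = Collect \<xi>" using ExElem.prems by auto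
    show "\<forall>y\<in>free_elem \<phi>. (E(?i := {d})) (2 * y + 1) = {(e(x := d)) y}"
      using ExElem.prems(6) by auto
    show "\<forall>X\<in>free_set \<phi>. (E(?i := {d})) (2 * X + 2) = Es X"
    proof
      fix X assume "X \<in> free_set \<phi>"
      moreover have "2 * X + 2 \<noteq> ?i" by presburger
      ultimately show "(E(?i := {d})) (2 * X + 2) = Es X" using ExElem.prems(7) by simp
    qed
  qed
  show ?case
  proof
    assume "type_sat (ExElem x \<phi>) a b c"
    then obtain a' m c' where ext: "expansion ?i a b c a' m c'" and s: "is_sing ?i (five_blocks a' m c')" and type_sat: "type_sat \<phi> a' m c'"
      by auto
    obtain S h' where zS: "zfactored N k' (E(?i := S)) h' a' m c'" using expansion_realized[OF z ext i] by blast
    obtain d where "S = {d}" using s is_sing_five_blocks[OF zS i] by auto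
    then show "sat UNIV \<xi> e Es (ExElem x \<phi>)" using * zS type_sat by auto
  next
    assume "sat UNIV \<xi> e Es (ExElem x \<phi>)"
    then obtain d where d: "sat UNIV \<xi> (e(x := d)) Es \<phi>" by auto
    obtain h' a' m c' where ext: "expansion ?i a b c a' m c'" and zS: "zfactored N k' (E(?i := {d})) h' a' m c'"
      using expansion_exists[OF z i] by blast
    have "type_sat \<phi> a' m c'" "is_sing ?i (five_blocks a' m c')" using *[OF zS] d is_sing_five_blocks[OF zS i] by simp_all
    with ext show "type_sat (ExElem x \<phi>) a b c" unfolding type_sat.simps by blast
  qed
next
  case (ExSet X \<phi>)
  let ?i = "2 * X + 2"
  obtain k' where k: "k = Suc k'" "qrank \<phi> \<le> k'" using ExSet.prems(2) by (cases k) auto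
  note z = ExSet.prems(1)[unfolded k(1)]
  have i: "?i < N" using ExSet.prems(4) by simp
  have *: "type_sat \<phi> a' m c' \<longleftrightarrow> sat UNIV \<xi> e (Es(X := S)) \<phi>" if "zfactored N k' (E(?i := S)) h' a' m c'" for a' m c' h' S
  proof (rule ExSet.IH[OF that k(2) ExSet.prems(3)])
    show "var_indices \<phi> \<subseteq> {..<N}" "(E(?i := S)) 0 = Collect \<xi>" using ExSet.prems by auto
    show "\<forall>Y\<in>free_set \<phi>. (E(?i := S)) (2 * Y + 2) = (Es(X := S)) Y"
      using ExSet.prems(7) by auto
    show "\<forall>x\<in>free_elem \<phi>. (E(?i := S)) (2 * x + 1) = {e x}"
    proof
      fix x assume "x \<in> free_elem \<phi>"
      moreover have "2 * x + 1 \<noteq> ?i" by presburger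
      ultimately show "(E(?i := S)) (2 * x + 1) = {e x}" using ExSet.prems(6) by simp
    qed
  qed
  show ?case
  proof
    assume "type_sat (ExSet X \<phi>) a b c"
    then obtain a' m c' where ext: "expansion ?i a b c a' m c'" and type_sat: "type_sat \<phi> a' m c'"
      by auto
    obtain S h' where zS: "zfactored N k' (E(?i := S)) h' a' m c'" using expansion_realized[OF z ext i] by blast
    then show "sat UNIV \<xi> e Es (ExSet X \<phi>)" using * type_sat by auto
  next
    assume "sat UNIV \<xi> e Es (ExSet X \<phi>)"
    then obtain S where d: "sat UNIV \<xi> e (Es(X := S)) \<phi>" by auto
    obtain h' a' m c' where ext: "expansion ?i a b c a' m c'" and zS: "zfactored N k' (E(?i := S)) h' a' m c'"
      using expansion_exists[OF z i] by blast
    have "type_sat \<phi> a' m c'" using *[OF zS] d by simp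
    with ext show "type_sat (ExSet X \<phi>) a b c" unfolding type_sat.simps by blast
  qed
qed


section \<open>Rich words\<close>

text \<open>The idempotent is a power lying in a minimal right ideal. For \<open>s\<close> in
  \<open>C\<close>, the element e s e lies in that ideal and by minimality generates all of it, so
  some right multiple of e s e is \<open>e\<close>.\<close>

lemma finite_semigroup_kernel_idempotent:
  fixes f :: "'a \<Rightarrow> 'a \<Rightarrow> 'a" (infixl "\<cdot>" 70)
  assumes assoc: "\<And>a b c. (a \<cdot> b) \<cdot> c = a \<cdot> (b \<cdot> c)"
    and C: "finite C" "C \<noteq> {}" "\<And>a b. a \<in> C \<Longrightarrow> b \<in> C \<Longrightarrow> a \<cdot> b \<in> C"
  shows "\<exists>e\<in>C. e \<cdot> e = e \<and> (\<forall>s\<in>C. \<exists>x\<in>C. e \<cdot> (s \<cdot> (e \<cdot> (x \<cdot> e))) = e)"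
proof -
  define I where "I p = (\<lambda>x. p \<cdot> x) ` C" for p
  \<comment> \<open>Least cardinality makes \<open>I p\<close> minimal among the right ideals
    \<open>I q\<close>; hence each of its elements generates it.\<close>
  define p where "p = arg_min_on (\<lambda>p. card (I p)) C"
  have p: "p \<in> C" "\<And>q. q \<in> C \<Longrightarrow> card (I p) \<le> card (I q)"
    unfolding p_def using C by (auto intro: arg_min_if_finite(1) arg_min_least)
  have fin: "finite (I q)" for q using C(1) by (simp add: I_def)
  have sub: "I p \<subseteq> C" using p C(3) by (auto simp: I_def)
  have min: "I r = I p" if r: "r \<in> I p" for r
  proof -
    obtain x where x: "x \<in> C" "r = p \<cdot> x" using r by (auto simp: I_def)
    have "I r \<subseteq> I p" unfolding I_def x(2) assoc using x(1) C(3) by auto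
    moreover have "card (I p) \<le> card (I r)" using p x C(3) by auto
    ultimately show ?thesis using fin by (simp add: card_subset_eq card_mono le_antisym)
  qed
  \<comment> \<open>\<open>pw n\<close> is the power of \<open>p\<close> with exponent
    \<open>n + 1\<close>, which explains the \<open>Suc\<close> in \<open>pw_add\<close>.\<close>
  define pw where "pw n = rec_nat p (\<lambda>_ y. y \<cdot> p) n" for n :: nat
  have pw_add: "pw m \<cdot> pw n = pw (Suc (m + n))" for m n
    by (induction n) (simp_all add: pw_def assoc[symmetric])
  have pwC: "pw n \<in> C" for n by (induction n) (auto simp: pw_def p C(3))
  have "\<not> inj pw"
    using pwC C(1) by (meson UNIV_I finite_imageD finite_subset image_subsetI infinite_UNIV_nat)
  then obtain i j where ij: "i < j" "pw i = pw j"
    unfolding inj_def by (metis linorder_neqE_nat)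
  define d where "d = j - i"
  have d: "0 < d" "pw (i + d) = pw i" using ij by (auto simp: d_def)
  have per: "pw (m + d) = pw m" if "i \<le> m" for m
  proof (cases "m = i")
    case False
    then have "Suc (i + (m - i - 1)) = m" "Suc (i + d + (m - i - 1)) = m + d" using that by auto
    then show ?thesis using pw_add[of i "m - i - 1"] pw_add[of "i + d" "m - i - 1"] d(2) by (simp add: add.commute)
  qed (simp add: d)
  have per': "pw (m + t * d) = pw m" if "i \<le> m" for m t
    by (induction t) (use per[of "m + _ * d"] that in \<open>auto simp: add.assoc add.commute[of d]\<close>)
  \<comment> \<open>The exponent \<open>m + 1\<close> is a multiple of the period \<open>d\<close>,
    and \<open>m\<close> is past the preperiod \<open>i\<close>, so squaring does not change the
    power. The factor is at least 2, which gives \<open>1 \<le> m\<close> and thereby places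
    \<open>e\<close> in \<open>I p\<close>.\<close>
  define m where "m = Suc (Suc i) * d - 1"
  have m: "Suc (m + m) = m + Suc (Suc i) * d" "i \<le> m" "1 \<le> m"
  proof -
    have "Suc (Suc i) * 1 \<le> Suc (Suc i) * d" using d(1) by (intro mult_le_mono2) simp
    then show "Suc (m + m) = m + Suc (Suc i) * d" "i \<le> m" "1 \<le> m" by (simp_all add: m_def)
  qed
  define e where "e = pw m"
  have ee: "e \<cdot> e = e" using pw_add[of m m] per'[OF m(2), of "Suc (Suc i)"] unfolding e_def m(1) by simp
  have pwI: "pw (Suc n) \<in> I p" for n
    using pw_add[of 0 n] pwC[of n] by (force simp: I_def pw_def[of 0])
  have eI: "e \<in> I p" using pwI[of "m - 1"] m(3) by (simp add: e_def)
  have eC: "e \<in> C" using eI sub by blast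
  have "\<exists>x\<in>C. e \<cdot> (s \<cdot> (e \<cdot> (x \<cdot> e))) = e" if s: "s \<in> C" for s
  proof -
    have "e \<cdot> (s \<cdot> e) \<in> I e" using s eC C(3) by (simp add: I_def)
    then have "e \<cdot> (s \<cdot> e) \<in> I p" using min[OF eI] by simp
    from min[OF this] have "e \<in> I (e \<cdot> (s \<cdot> e))" using eI by simp
    then obtain x where x: "x \<in> C" "e = e \<cdot> (s \<cdot> e) \<cdot> x" by (auto simp: I_def)
    have "e \<cdot> (s \<cdot> (e \<cdot> (x \<cdot> e))) = (e \<cdot> (s \<cdot> e) \<cdot> x) \<cdot> e" by (simp add: assoc)
    also have "\<dots> = e" using x(2) ee by simp
    finally show ?thesis using x(1) by blast
  qed
  with ee eC show ?thesis by blast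
qed

section \<open>Types of letters and finite words\<close>

text \<open>A one-point interval has two subsets only, so overwriting label \<open>i\<close> either
  inserts it or removes it. This describes the type by finite data, as needed for computing
  it.\<close>

primrec point_type :: "nat \<Rightarrow> nat \<Rightarrow> nat set \<Rightarrow> nat" where
  "point_type N 0 A = mk_type (prod_encode ` (A \<times> A)) {} {}"
| "point_type N (Suc k) A = mk_type (prod_encode ` (A \<times> A)) {}
     {prod_encode (i, point_type N k B) |i B. i < N \<and> (B = insert i A \<or> B = A - {i})}"

lemma mtype_point: "mtype N k {p} E = point_type N k {i. i < N \<and> p \<in> E i}"
proof (induction k arbitrary: E)
  have m: "meet_facts N {p} E = prod_encode ` ({i. i < N \<and> p \<in> E i} \<times> {i. i < N \<and> p \<in> E i})"
    and l: "prec_facts N {p} E = {}" for E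
    by (auto simp: meet_facts_def prec_facts_def)
  {
    case 0
    show ?case by (simp add: mtype.simps m l)
  next
    case (Suc k)
    let ?A = "{i. i < N \<and> p \<in> E i}"
    have "mtype N k {p} (E(i := {p})) = point_type N k (insert i ?A)" "mtype N k {p} (E(i := {})) = point_type N k (?A - {i})"
      if "i < N" for i
    proof -
      have "{j. j < N \<and> p \<in> (E(i := {p})) j} = insert i ?A" "{j. j < N \<and> p \<in> (E(i := {})) j} = ?A - {i}"
        using that by auto
      then show "mtype N k {p} (E(i := {p})) = point_type N k (insert i ?A)" "mtype N k {p} (E(i := {})) = point_type N k (?A - {i})"
        unfolding Suc by simp_all
    qed
    then have "{prod_encode (i, mtype N k {p} (E(i := S))) |i S. i < N \<and> S \<subseteq> {p}} =
      {prod_encode (i, point_type N k B) |i B. i < N \<and> (B = insert i ?A \<or> B = ?A - {i})}"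
      by (auto simp: subset_singleton_iff simp del: fun_upd_apply) (metis empty_subsetI subset_refl)+
    then show ?case by (simp add: mtype.simps m l del: fun_upd_apply)
  }
qed

text \<open>All variables start with the empty label: in a sentence each of them is overwritten by
  its quantifier before it is used.\<close>

definition labelling :: "(int \<Rightarrow> bool) \<Rightarrow> nat \<Rightarrow> int set" where
  "labelling \<xi> = (\<lambda>_. {})(0 := Collect \<xi>)"

definition letter :: "nat \<Rightarrow> nat \<Rightarrow> bool \<Rightarrow> nat" where
  "letter N k b = point_type N k (if b then {0} else {})"

definition word_types :: "nat \<Rightarrow> nat \<Rightarrow> nat set" where
  "word_types N k = generated {letter N k False, letter N k True}"

definition word_type :: "nat \<Rightarrow> nat \<Rightarrow> bool list \<Rightarrow> nat" where
  "word_type N k w = tprod (\<lambda>i. letter N k (w ! i)) (length w - 1)"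

definition occurs :: "(int \<Rightarrow> bool) \<Rightarrow> int \<Rightarrow> bool list \<Rightarrow> bool" where
  "occurs \<xi> p w \<longleftrightarrow> (\<forall>i<length w. \<xi> (p + int i) = w ! i)"

lemma mtype_letter: "0 < N \<Longrightarrow> mtype N k {p} (labelling \<xi>) = letter N k (\<xi> p)"
proof -
  assume "0 < N"
  then have "{i. i < N \<and> p \<in> labelling \<xi> i} = (if \<xi> p then {0} else {})" by (auto simp: labelling_def)
  then show ?thesis by (simp add: mtype_point letter_def)
qed

lemma mtype_letters:
  "0 < N \<Longrightarrow> mtype N k {p..<p + 1 + int j} (labelling \<xi>) = tprod (\<lambda>i. letter N k (\<xi> (p + int i))) j"
proof -
  assume "0 < N"
  moreover have "{q..<q + 1} = {q}" for q :: int by auto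
  ultimately show ?thesis
    using mtype_blocks[of "\<lambda>n. n" N k p j "labelling \<xi>"] mtype_letter by (simp add: strict_mono_def)
qed

lemma mtype_in_word_types: "0 < N \<Longrightarrow> p < q \<Longrightarrow> mtype N k {p..<q} (labelling \<xi>) \<in> word_types N k"
proof -
  assume "0 < N" "p < q"
  then have "mtype N k {p..<q} (labelling \<xi>) = tprod (\<lambda>i. letter N k (\<xi> (p + int i))) (nat (q - p - 1))"
    using mtype_letters[of N k p "nat (q - p - 1)" \<xi>] by simp
  moreover have "letter N k b \<in> {letter N k False, letter N k True}" for b by (cases b) auto
  ultimately show ?thesis by (simp only: word_types_def tprod_generated)
qed

lemma mtype_occurs:
  assumes "0 < N" "w \<noteq> []" "occurs \<xi> p w" "q = p + int (length w)"
  shows "mtype N k {p..<q} (labelling \<xi>) = word_type N k w"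
proof -
  have q: "q = p + 1 + int (length w - 1)" using assms(2,4) by (cases w) auto
  show ?thesis unfolding q mtype_letters[OF assms(1)] word_type_def
  proof (rule tprod_cong)
    fix i assume "i \<le> length w - 1"
    then have "i < length w" using assms(2) by (cases w) auto
    then show "letter N k (\<xi> (p + int i)) = letter N k (w ! i)" using assms(3) by (simp add: occurs_def)
  qed
qed

lemma word_types_word: "x \<in> word_types N k \<Longrightarrow> \<exists>w. w \<noteq> [] \<and> x = word_type N k w"
proof -
  assume "x \<in> word_types N k"
  then obtain \<alpha> j where \<alpha>: "\<forall>i. \<alpha> i \<in> {letter N k False, letter N k True}" "x = tprod \<alpha> j"
    unfolding word_types_def using generated_tprod by blast
  define w where "w = map (\<lambda>i. \<alpha> i = letter N k True) [0..<Suc j]"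
  have "tprod (\<lambda>i. letter N k (w ! i)) j = tprod \<alpha> j"
  proof (rule tprod_cong)
    fix i assume "i \<le> j"
    then have "w ! i \<longleftrightarrow> \<alpha> i = letter N k True" unfolding w_def by (subst nth_map) (simp_all del: upt_Suc)
    then show "letter N k (w ! i) = \<alpha> i" using \<alpha>(1) by (cases "w ! i") (auto, metis)
  qed
  then show ?thesis using \<alpha>(2) by (intro exI[of _ w]) (simp add: word_type_def w_def)
qed

lemma word_types_tmul: "x \<in> word_types N k \<Longrightarrow> y \<in> word_types N k \<Longrightarrow> tmul x y \<in> word_types N k"
  by (simp add: word_types_def generated_tmul)

lemma is_type_letter: "0 < N \<Longrightarrow> is_type N k (letter N k b)"
  using is_type_mtype[of N k "{0}" "labelling (\<lambda>_. b)"] by (simp add: mtype_letter)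

lemma is_type_word_types: "0 < N \<Longrightarrow> x \<in> word_types N k \<Longrightarrow> is_type N k x"
  unfolding word_types_def by (erule is_type_generated) (auto simp: is_type_letter)

lemma word_types_less: "0 < N \<Longrightarrow> x \<in> word_types N k \<Longrightarrow> x < type_bound N k"
  by (simp add: is_type_word_types is_type_less_type_bound)

text \<open>Membership in the minimal ideal is replaced by a solvability condition that quantifies
  over the finite set \<open>word_types N k\<close> only, so that a kernel idempotent can be found
  by search.\<close>

definition kernel_idem :: "nat \<Rightarrow> nat \<Rightarrow> nat \<Rightarrow> bool" where
  "kernel_idem N k e \<longleftrightarrow> e \<in> word_types N k \<and> tmul e e = e \<and>
     (\<forall>s\<in>word_types N k. \<exists>x\<in>word_types N k. tmul e (tmul s (tmul e (tmul x e))) = e)"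

lemma kernel_idem_exists: "0 < N \<Longrightarrow> \<exists>e. kernel_idem N k e"
proof -
  assume N: "0 < N"
  have "finite (word_types N k)" using word_types_less[OF N] by (metis finite_nat_iff_bounded lessThan_iff subsetI)
  moreover have "word_types N k \<noteq> {}" by (auto simp: word_types_def intro: generated.base)
  ultimately show ?thesis
    using finite_semigroup_kernel_idempotent[of tmul "word_types N k"] tmul_assoc word_types_tmul unfolding kernel_idem_def by blast
qed

definition kernel_group :: "nat \<Rightarrow> nat \<Rightarrow> nat \<Rightarrow> nat set" where
  "kernel_group N k e = {tmul e (tmul s e) |s. s \<in> word_types N k}"

text \<open>The local monoid e S e has right inverses by \<open>kernel_idem\<close>, and a monoid
  with right inverses is a group.\<close>

lemma kernel_group_props:
  assumes e: "kernel_idem N k e"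
  shows "kernel_group N k e \<subseteq> word_types N k" "e \<in> kernel_group N k e"
    "g \<in> kernel_group N k e \<Longrightarrow> tmul e g = g" "g \<in> kernel_group N k e \<Longrightarrow> tmul g e = g"
    "g \<in> kernel_group N k e \<Longrightarrow> g' \<in> kernel_group N k e \<Longrightarrow> tmul g g' \<in> kernel_group N k e"
    "g \<in> kernel_group N k e \<Longrightarrow> \<exists>x\<in>kernel_group N k e. tmul g x = e \<and> tmul x g = e"
proof -
  have eW: "e \<in> word_types N k" and ee: "tmul e e = e"
    and inv: "\<And>s. s \<in> word_types N k \<Longrightarrow> \<exists>x\<in>word_types N k. tmul e (tmul s (tmul e (tmul x e))) = e"
    using e by (auto simp: kernel_idem_def)
  have ee': "tmul e (tmul e y) = tmul e y" for y using ee tmul_assoc by metis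
  show "kernel_group N k e \<subseteq> word_types N k" using eW by (auto simp: kernel_group_def intro!: word_types_tmul)
  show "e \<in> kernel_group N k e" using eW ee by (force simp: kernel_group_def)
  show l: "tmul e g = g" if "g \<in> kernel_group N k e" for g using that by (auto simp: kernel_group_def ee')
  show r: "tmul g e = g" if "g \<in> kernel_group N k e" for g using that by (auto simp: kernel_group_def tmul_assoc ee)
  show "tmul g g' \<in> kernel_group N k e" if gg: "g \<in> kernel_group N k e" "g' \<in> kernel_group N k e" for g g'
  proof -
    obtain s s' where "g = tmul e (tmul s e)" "g' = tmul e (tmul s' e)" "s \<in> word_types N k" "s' \<in> word_types N k"
      using gg by (auto simp: kernel_group_def)
    then have "tmul g g' = tmul e (tmul (tmul s (tmul e s')) e)" "tmul s (tmul e s') \<in> word_types N k"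
      using eW by (auto simp: tmul_assoc ee' intro!: word_types_tmul)
    then show ?thesis by (auto simp: kernel_group_def)
  qed
  have ri: "\<exists>x\<in>kernel_group N k e. tmul g x = e" if g: "g \<in> kernel_group N k e" for g
  proof -
    obtain s where s: "g = tmul e (tmul s e)" "s \<in> word_types N k" using g by (auto simp: kernel_group_def)
    obtain x where x: "x \<in> word_types N k" "tmul e (tmul s (tmul e (tmul x e))) = e" using inv[OF s(2)] by blast
    have "tmul g (tmul e (tmul x e)) = e" using x(2) by (simp add: s(1) tmul_assoc ee')
    then show ?thesis using x(1) by (auto simp: kernel_group_def)
  qed
  show "\<exists>x\<in>kernel_group N k e. tmul g x = e \<and> tmul x g = e" if g: "g \<in> kernel_group N k e" for g
  proof -
    obtain x where x: "x \<in> kernel_group N k e" "tmul g x = e" using ri[OF g] by blast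
    obtain y where y: "y \<in> kernel_group N k e" "tmul x y = e" using ri[OF x(1)] by blast
    \<comment> \<open>If x is a right inverse of g and y one of x, then g = y, so x is a two-sided
      inverse.\<close>
    have "g = tmul g (tmul x y)" using y(2) r[OF g] by simp
    also have "\<dots> = tmul (tmul g x) y" by (simp add: tmul_assoc)
    also have "\<dots> = y" using x(2) l[OF y(1)] by simp
    finally show ?thesis using x y by auto
  qed
qed

lemma kernel_group_cancel:
  assumes e: "kernel_idem N k e" and g: "g \<in> kernel_group N k e" and s: "s \<in> kernel_group N k e"
  shows "tmul g s = g \<Longrightarrow> s = e" "tmul s g = g \<Longrightarrow> s = e"
proof -
  obtain x where x: "tmul g x = e" "tmul x g = e" using kernel_group_props(6)[OF e g] by blast
  show "s = e" if "tmul g s = g"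
    using that x kernel_group_props(3)[OF e s] by (metis tmul_assoc)
  show "s = e" if "tmul s g = g"
    using that x kernel_group_props(4)[OF e s] by (metis tmul_assoc)
qed

text \<open>If every value had a last occurrence, a position beyond the finitely many last
  occurrences could take no value.\<close>

lemma unbounded_pigeonhole:
  fixes f :: "int \<Rightarrow> nat"
  assumes Y: "\<And>b. \<exists>q>b. Q q" and f: "\<And>q. f q < s"
  shows "\<exists>t. \<forall>b. \<exists>q>b. Q q \<and> f q = t"
proof (rule ccontr)
  assume "\<not> ?thesis"
  then have "\<forall>t. \<exists>b. \<forall>q>b. Q q \<longrightarrow> f q \<noteq> t" by blast
  then obtain B where B: "\<And>t q. B t < q \<Longrightarrow> Q q \<Longrightarrow> f q \<noteq> t" by metis
  obtain q where q: "Max (insert 0 (B ` {..<s})) < q" "Q q" using Y by blast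
  have "B (f q) \<le> Max (insert 0 (B ` {..<s}))" using f by (intro Max_ge) auto
  then show False using B[of "f q" q] q by linarith
qed

lemma unbounded_sequence:
  assumes "\<And>b. \<exists>q>b. Q (q :: int)"
  shows "\<exists>r :: nat \<Rightarrow> int. \<forall>n. Q (r n) \<and> r n + d \<le> r (Suc n)"
proof -
  have "\<exists>r. \<forall>n. Q (r n) \<and> r n + d \<le> r (Suc n)"
  proof (rule dependent_nat_choice)
    show "\<exists>q. Q q" using assms by blast
    show "\<exists>q'. Q q' \<and> q + d \<le> q'" for q using assms[of "q + d"] by force
  qed
  then show ?thesis .
qed

definition rich :: "(int \<Rightarrow> bool) \<Rightarrow> bool" where
  "rich \<xi> \<longleftrightarrow> (\<forall>w b. (\<exists>p>b. occurs \<xi> p w) \<and> (\<exists>p<b. occurs \<xi> p w))"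

lemma occurs_append: "occurs \<xi> p (u @ v) \<longleftrightarrow> occurs \<xi> p u \<and> occurs \<xi> (p + int (length u)) v"
proof
  assume *: "occurs \<xi> p (u @ v)"
  have "\<xi> (p + int (length u) + int i) = v ! i" if "i < length v" for i
    using * that unfolding occurs_def by (metis add.assoc add_less_cancel_left length_append nth_append_length_plus of_nat_add)
  moreover have "\<xi> (p + int i) = u ! i" if "i < length u" for i
    using * that unfolding occurs_def by (metis length_append nth_append trans_less_add1)
  ultimately show "occurs \<xi> p u \<and> occurs \<xi> (p + int (length u)) v" by (simp add: occurs_def)
next
  assume *: "occurs \<xi> p u \<and> occurs \<xi> (p + int (length u)) v"
  show "occurs \<xi> p (u @ v)" unfolding occurs_def
  proof (intro allI impI)
    fix i assume i: "i < length (u @ v)"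
    show "\<xi> (p + int i) = (u @ v) ! i"
    proof (cases "i < length u")
      case False
      have "\<xi> (p + int (length u) + int (i - length u)) = v ! (i - length u)"
      proof -
        have "i - length u < length v" using i False by auto
        then show ?thesis using * unfolding occurs_def by blast
      qed
      moreover have "p + int (length u) + int (i - length u) = p + int i" using False by simp
      ultimately show ?thesis using False by (simp only: nth_append if_False)
    qed (use * in \<open>simp add: occurs_def nth_append\<close>)
  qed
qed

text \<open>All right cuts are chosen with the same type \<open>gr\<close> seen from a fixed cut
  \<open>p0\<close>. For consecutive ones, \<open>gr\<close> times the type in between is
  \<open>gr\<close> again, so cancellation in the group forces that type to be \<open>e\<close>;
  likewise on the left with \<open>gl\<close>. The middle block is the product of both.\<close>

lemma rich_zfactored:
  assumes N: "0 < N" and \<xi>: "rich \<xi>" and e: "kernel_idem N k e"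
  shows "\<exists>h g. g \<in> kernel_group N k e \<and> zfactored N k (labelling \<xi>) h e g e"
proof -
  have eW: "e \<in> word_types N k" using e by (simp add: kernel_idem_def)
  obtain w where w: "w \<noteq> []" "e = word_type N k w" using word_types_word[OF eW] by blast
  define l where "l = int (length w)"
  \<comment> \<open>Cuts at this distance leave room for \<open>w\<close> after the first cut,
    \<open>w\<close> before the second and at least one letter in between, so the type has the form
    e s e.\<close>
  define d where "d = 2 * l + 1"
  define t where "t p q = mtype N k {p..<q} (labelling \<xi>)" for p q
  \<comment> \<open>A cut is the middle of an occurrence of the square of \<open>w\<close>, so that
    blocks on either side of it begin or end with \<open>w\<close>.\<close>
  define cut where "cut p \<longleftrightarrow> occurs \<xi> (p - l) (w @ w)" for p
  have l: "0 < l" using w(1) by (simp add: l_def)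
  have tspl: "t p r = tmul (t p q) (t q r)" if "p \<le> q" "q \<le> r" for p q r
    using mtype_split[OF that] by (simp add: t_def)
  have cut_t: "t (p - l) p = e" "t p (p + l) = e" if "cut p" for p
    using that w mtype_occurs[OF N w(1), of \<xi> "p - l" p] mtype_occurs[OF N w(1), of \<xi> p "p + l"]
    by (simp_all add: cut_def occurs_append t_def l_def)
  have tKG: "t p q \<in> kernel_group N k e" if "cut p" "cut q" "p + d \<le> q" for p q
  proof -
    have "t p q = tmul (t p (p + l)) (tmul (t (p + l) (q - l)) (t (q - l) q))"
      using tspl[of p "p + l" q] tspl[of "p + l" "q - l" q] that(3) l by (simp add: d_def)
    moreover have "t (p + l) (q - l) \<in> word_types N k" using mtype_in_word_types[OF N] that(3) by (simp add: t_def d_def)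
    ultimately show ?thesis using cut_t that by (auto simp: kernel_group_def)
  qed
  have cutR: "\<exists>p>b. cut p" for b
  proof -
    obtain p where "b < p" "occurs \<xi> p (w @ w)" using \<xi> unfolding rich_def by blast
    then show ?thesis using l by (intro exI[of _ "p + l"]) (simp add: cut_def)
  qed
  have cutL: "\<exists>p<b. cut p" for b
  proof -
    obtain p where "p < b - l" "occurs \<xi> p (w @ w)" using \<xi> unfolding rich_def by blast
    then show ?thesis using l by (intro exI[of _ "p + l"]) (simp add: cut_def)
  qed
  obtain p0 where p0: "cut p0" using cutR by blast
  have "\<exists>q>b. cut q \<and> p0 + d \<le> q" for b using cutR[of "max b (p0 + d)"] by auto
  from unbounded_pigeonhole[OF this, of "\<lambda>q. t p0 q" "type_bound N k"]
  obtain gr where "\<And>b. \<exists>q>b. (cut q \<and> p0 + d \<le> q) \<and> t p0 q = gr" using mtype_less by (auto simp: t_def)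
  from unbounded_sequence[OF this, of d]
  obtain r where r: "\<And>n. cut (r n)" "\<And>n. p0 + d \<le> r n" "\<And>n. t p0 (r n) = gr" "\<And>n. r n + d \<le> r (Suc n)"
    by blast
  \<comment> \<open>Negated positions let the statements about sets unbounded above serve the left
    half.\<close>
  have "\<exists>q>b. cut (- q) \<and> - q + d \<le> p0" for b
  proof -
    obtain p where "p < min (- b) (p0 - d)" "cut p" using cutL by blast
    then show ?thesis by (intro exI[of _ "- p"]) auto
  qed
  from unbounded_pigeonhole[OF this, of "\<lambda>q. t (- q) p0" "type_bound N k"]
  obtain gl where "\<And>b. \<exists>q>b. (cut (- q) \<and> - q + d \<le> p0) \<and> t (- q) p0 = gl" using mtype_less by (auto simp: t_def)
  from unbounded_sequence[OF this, of d]
  obtain s where s: "\<And>n. cut (- s n)" "\<And>n. - s n + d \<le> p0" "\<And>n. t (- s n) p0 = gl" "\<And>n. s n + d \<le> s (Suc n)"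
    by blast
  have d: "0 < d" using l by (simp add: d_def)
  have rr: "t (r n) (r (Suc n)) = e" for n
  proof (rule kernel_group_cancel(1)[OF e])
    show "gr \<in> kernel_group N k e" using tKG[OF p0 r(1) r(2)] r(3) by simp
    show "t (r n) (r (Suc n)) \<in> kernel_group N k e" by (rule tKG[OF r(1) r(1) r(4)])
    show "tmul gr (t (r n) (r (Suc n))) = gr"
      using tspl[of p0 "r n" "r (Suc n)"] r(2)[of n] r(4)[of n] d r(3) by simp
  qed
  have ss: "t (- s (Suc n)) (- s n) = e" for n
  proof (rule kernel_group_cancel(2)[OF e])
    show "gl \<in> kernel_group N k e" using tKG[OF s(1) p0 s(2)] s(3) by simp
    show "t (- s (Suc n)) (- s n) \<in> kernel_group N k e" using s(4)[of n] by (intro tKG s(1)) simp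
    show "tmul (t (- s (Suc n)) (- s n)) gl = gl"
      using tspl[of "- s (Suc n)" "- s n" p0] s(2)[of n] s(4)[of n] d s(3) by simp
  qed
  define h where "h n = (if n \<le> 0 then - s (nat (- n)) else r (nat (n - 1)))" for n :: int
  have nats: "nat (- n) = Suc (nat (- (n + 1)))" if "n < 0" for n using that by linarith
  have natr: "nat n = Suc (nat (n - 1))" if "0 < n" for n using that by linarith
  have "zfactored N k (labelling \<xi>) h e (tmul gl gr) e"
    unfolding zfactored_def
  proof (intro conjI allI)
    show "strict_mono h"
    proof (rule int_strict_monoI)
      fix n :: int
      consider "n < 0" | "n = 0" | "0 < n" by linarith
      then show "h n < h (n + 1)"
      proof cases
        case 1
        then show ?thesis using s(4)[of "nat (- (n + 1))"] nats[OF 1] d by (simp add: h_def)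
      next
        case 2
        then show ?thesis using s(2)[of 0] r(2)[of 0] d by (simp add: h_def)
      next
        case 3
        then show ?thesis using r(4)[of "nat (n - 1)"] natr[OF 3] d by (simp add: h_def)
      qed
    qed
    fix n :: int
    consider "n < 0" | "n = 0" | "0 < n" by linarith
    then show "mtype N k {h n..<h (n + 1)} (labelling \<xi>) = block_type e (tmul gl gr) e n"
      unfolding t_def[symmetric]
    proof cases
      case 1
      then show "t (h n) (h (n + 1)) = block_type e (tmul gl gr) e n"
        using ss[of "nat (- (n + 1))"] nats[OF 1] by (simp add: h_def block_type_def)
    next
      case 2
      then show "t (h n) (h (n + 1)) = block_type e (tmul gl gr) e n"
        using tspl[of "- s 0" p0 "r 0"] s(2)[of 0] r(2)[of 0] d s(3) r(3) by (simp add: h_def block_type_def)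
    next
      case 3
      then show "t (h n) (h (n + 1)) = block_type e (tmul gl gr) e n"
        using rr[of "nat (n - 1)"] natr[OF 3] by (simp add: h_def block_type_def)
    qed
  qed
  moreover have "tmul gl gr \<in> kernel_group N k e"
    using kernel_group_props(5)[OF e, of gl gr] tKG[OF s(1) p0 s(2), of 0] tKG[OF p0 r(1) r(2), of 0] s(3) r(3) by simp
  ultimately show ?thesis by blast
qed

text \<open>
  With \<open>x\<close> inverse to \<open>g\<close>, the word \<open>\<dots> x g x g e e
  \<dots>\<close> can be cut into \<open>\<dots> (x g) (x g) e e \<dots>\<close> as well as into
  \<open>\<dots> (g x) (g x) g e e \<dots>\<close>.
\<close>

lemma kernel_idem_middle_zfactored:
  assumes N: "0 < N" and e: "kernel_idem N k e" and g: "g \<in> kernel_group N k e"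
  shows "\<exists>\<zeta> h h'. zfactored N k (labelling \<zeta>) h e e e \<and> zfactored N k (labelling \<zeta>) h' e g e"
proof -
  obtain x where x: "x \<in> kernel_group N k e" "tmul g x = e" "tmul x g = e" using kernel_group_props(6)[OF e g] by blast
  obtain w where w: "w \<noteq> []" "e = word_type N k w" using word_types_word[of e N k] e by (auto simp: kernel_idem_def)
  obtain q where q: "q \<noteq> []" "g = word_type N k q" using word_types_word[of g N k] g kernel_group_props(1)[OF e] by blast
  obtain y where y: "y \<noteq> []" "x = word_type N k y" using word_types_word[of x N k] x(1) kernel_group_props(1)[OF e] by blast
  define L where "L = int (length (y @ q))"
  define l where "l = int (length w)"
  define \<zeta> where "\<zeta> p = (if p < 0 then (y @ q) ! nat (p mod L) else w ! nat (p mod l))" for p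
  have Ll: "0 < L" "0 < l" "int (length q) < L"
    using q(1) y(1) w(1)[folded length_greater_0_conv] by (simp_all add: L_def l_def flip: length_greater_0_conv)
  define t where "t p q = mtype N k {p..<q} (labelling \<zeta>)" for p q
  have tspl: "t p r = tmul (t p q) (t q r)" if "p \<le> q" "q \<le> r" for p q r
    using mtype_split[OF that] by (simp add: t_def)
  have occL: "occurs \<zeta> (n * L) (y @ q)" if "n < 0" for n
    unfolding occurs_def
  proof (intro allI impI)
    fix i assume i: "i < length (y @ q)"
    have "n * L \<le> - 1 * L" using that Ll by (intro mult_right_mono) auto
    then have "n * L + int i < 0" using i by (simp add: L_def)
    moreover have "(n * L + int i) mod L = int i" using i Ll by (simp only: mod_mult_self3) (simp add: L_def)
    ultimately show "\<zeta> (n * L + int i) = (y @ q) ! i" by (simp add: \<zeta>_def)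
  qed
  have occR: "occurs \<zeta> (n * l) w" if "0 \<le> n" for n
    unfolding occurs_def
  proof (intro allI impI)
    fix i assume i: "i < length w"
    have "0 \<le> n * l" using that Ll by simp
    then have "\<not> n * l + int i < 0" by simp
    moreover have "(n * l + int i) mod l = int i" using i Ll by (simp only: mod_mult_self3) (simp add: l_def)
    ultimately show "\<zeta> (n * l + int i) = w ! i" by (simp add: \<zeta>_def)
  qed
  have ty: "t (n * L) (n * L + int (length y)) = x" "t (n * L + int (length y)) ((n + 1) * L) = g" if "n < 0" for n
    using occL[OF that] mtype_occurs[OF N y(1), of \<zeta> "n * L"] mtype_occurs[OF N q(1), of \<zeta> "n * L + int (length y)" "(n + 1) * L"]
    by (simp_all add: occurs_append t_def y(2) q(2) L_def algebra_simps)
  have tw: "t (n * l) ((n + 1) * l) = e" if "0 \<le> n" for n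
    using occR[OF that] mtype_occurs[OF N w(1), of \<zeta> "n * l" "(n + 1) * l"]
    by (simp add: t_def w(2) l_def algebra_simps)
  define h where "h n = (if n \<le> 0 then n * L else n * l)" for n
  \<comment> \<open>On the left the cuts now fall between \<open>y\<close> and \<open>q\<close>. The
    last \<open>q\<close> before position 0 becomes block 0, which shifts the numbers of the right
    blocks by one.\<close>
  define h' where "h' n = (if n \<le> 0 then n * L - int (length q) else (n - 1) * l)" for n
  have "zfactored N k (labelling \<zeta>) h e e e"
    unfolding zfactored_def t_def[symmetric]
  proof (intro conjI allI)
    show "strict_mono h"
    proof (rule int_strict_monoI)
      fix n :: int
      consider "n < 0" | "n = 0" | "0 < n" by linarith
      then show "h n < h (n + 1)" by cases (use Ll in \<open>simp_all add: h_def algebra_simps\<close>)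
    qed
    fix n :: int
    show "t (h n) (h (n + 1)) = block_type e e e n"
    proof (cases "n < 0")
      case True
      have "t (n * L) ((n + 1) * L) = tmul (t (n * L) (n * L + int (length y))) (t (n * L + int (length y)) ((n + 1) * L))"
        by (rule tspl) (simp_all add: L_def algebra_simps)
      then show ?thesis using True ty[OF True] x by (simp add: h_def block_type_def)
    next
      case False
      then have "h n = n * l" "h (n + 1) = (n + 1) * l" by (auto simp: h_def)
      then show ?thesis using False tw[of n] by (simp add: block_type_def)
    qed
  qed
  moreover have "zfactored N k (labelling \<zeta>) h' e g e"
    unfolding zfactored_def t_def[symmetric]
  proof (intro conjI allI)
    show "strict_mono h'"
    proof (rule int_strict_monoI)
      fix n :: int
      consider "n < 0" | "n = 0" | "0 < n" by linarith
      then show "h' n < h' (n + 1)" by cases (use Ll q in \<open>simp_all add: h'_def algebra_simps\<close>)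
    qed
    fix n :: int
    consider "n < 0" | "n = 0" | "0 < n" by linarith
    then show "t (h' n) (h' (n + 1)) = block_type e g e n"
    proof cases
      case 1
      have eq: "n * L - int (length q) = (n - 1) * L + int (length y)"
        "(n + 1) * L - int (length q) = n * L + int (length y)" by (simp_all add: L_def algebra_simps)
      have "t (n * L - int (length q)) ((n + 1) * L - int (length q)) =
        tmul (t ((n - 1) * L + int (length y)) (n * L)) (t (n * L) (n * L + int (length y)))"
        unfolding eq by (rule tspl) (simp_all add: L_def algebra_simps)
      then show ?thesis using 1 ty(1)[of n] ty(2)[of "n - 1"] x by (simp add: h'_def block_type_def)
    next
      case 2
      then show ?thesis using ty(2)[of "- 1"] by (simp add: h'_def block_type_def L_def)
    next
      case 3
      then show ?thesis using tw[of "n - 1"] by (simp add: h'_def block_type_def)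
    qed
  qed
  ultimately show ?thesis by blast
qed

text \<open>The auxiliary word \<zeta> has both factorisations, so its truth value identifies the
  verdicts of (e, g, e) and (e, e, e). The right-hand side depends on \<xi> no longer.\<close>

theorem rich_models_iff:
  assumes N: "0 < N" "var_indices \<phi> \<subseteq> {..<N}" "qrank \<phi> \<le> k" and \<phi>: "sentence \<phi>"
    and \<xi>: "rich \<xi>" and e: "kernel_idem N k e"
  shows "models UNIV \<xi> \<phi> \<longleftrightarrow> type_sat \<phi> e e e"
proof -
  obtain h g where g: "g \<in> kernel_group N k e" "zfactored N k (labelling \<xi>) h e g e" using rich_zfactored[OF N(1) \<xi> e] by blast
  obtain \<zeta> h1 h2 where z: "zfactored N k (labelling \<zeta>) h1 e e e" "zfactored N k (labelling \<zeta>) h2 e g e"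
    using kernel_idem_middle_zfactored[OF N(1) e g(1)] by blast
  have sat: "sat UNIV \<eta> es Es \<phi> \<longleftrightarrow> type_sat \<phi> a b c" if "zfactored N k (labelling \<eta>) h a b c" for \<eta> es Es h a b c
    using type_sat_sat[OF that N(3) N(1) N(2), of \<eta> es Es] \<phi> by (simp add: sentence_def labelling_def)
  have "type_sat \<phi> e g e \<longleftrightarrow> type_sat \<phi> e e e" using sat[OF z(1)] sat[OF z(2)] by blast
  then show ?thesis unfolding models_def using sat[OF g(2)] by simp
qed


section \<open>Decidability for rich words\<close>

lemma cfun_filter:
  assumes "cpred (\<lambda>z. P (pfst z) (psnd z))" "cfun n"
  shows "cfun (\<lambda>x. set_encode {y. y < n x \<and> P y x})"
  using cfun_image[of "\<lambda>y x. y", OF cfun_pfst[OF cfun_id] assms] by simp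

lemma cfun_union:
  assumes f: "cfun f" and g: "cfun g"
  shows "cfun (\<lambda>x. set_encode (set_decode (f x) \<union> set_decode (g x)))"
proof -
  have "cfun (\<lambda>x. set_encode {y. y < f x + g x \<and> (y \<in> set_decode (f x) \<or> y \<in> set_decode (g x))})"
    by (intro cfun_filter cfun_intros f g cfun_comp[OF f] cfun_comp[OF g])
  moreover have "{y. y < a + b \<and> (y \<in> set_decode a \<or> y \<in> set_decode b)} = set_decode a \<union> set_decode b" for a b
    by (auto dest: set_decode_less)
  ultimately show ?thesis by simp
qed

lemma cfun_insert:
  assumes f: "cfun f" and g: "cfun g"
  shows "cfun (\<lambda>x. set_encode (insert (f x) (set_decode (g x))))"
proof -
  have "cfun (\<lambda>x. if f x \<in> set_decode (g x) then g x else 2 ^ f x + g x)" by (intro cfun_intros f g)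
  then show ?thesis by (rule cfun_cong) (simp add: insert_absorb)
qed

lemma cfun_remove:
  assumes f: "cfun f" and g: "cfun g"
  shows "cfun (\<lambda>x. set_encode (set_decode (g x) - {f x}))"
proof -
  have "cfun (\<lambda>x. set_encode {y. y < g x \<and> (y \<in> set_decode (g x) \<and> y \<noteq> f x)})"
    by (intro cfun_filter cfun_intros f g cfun_comp[OF f] cfun_comp[OF g])
  moreover have "{y. y < b \<and> (y \<in> set_decode b \<and> y \<noteq> a)} = set_decode b - {a}" for a b
    by (auto dest: set_decode_less)
  ultimately show ?thesis by simp
qed

lemma cfun_set_pair:
  assumes f: "cfun f" and g: "cfun g" shows "cfun (\<lambda>x. set_encode {f x, g x})"
  using cfun_insert[OF f cfun_insert[OF g cfun_const[of 0]]] by (simp del: set_encode_insert)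

lemma cpred_meets: "cfun f \<Longrightarrow> cfun g \<Longrightarrow> cpred (\<lambda>x. f x \<in> meets (g x))"
  unfolding meets_def by (intro cfun_intros)

lemma cpred_precs: "cfun f \<Longrightarrow> cfun g \<Longrightarrow> cpred (\<lambda>x. f x \<in> precs (g x))"
  unfolding precs_def by (intro cfun_intros)

lemma cpred_kidset: "cfun f \<Longrightarrow> cfun g \<Longrightarrow> cpred (\<lambda>x. f x \<in> kidset (g x))"
  unfolding kidset_def by (intro cfun_intros)

lemma meets_less: "y \<in> meets t \<Longrightarrow> y < t"
  unfolding meets_def using set_decode_less pfst_le[of t] by fastforce

lemma kidset_less: "y \<in> kidset t \<Longrightarrow> y < t"
  unfolding kidset_def using set_decode_less psnd_le[of "psnd t"] psnd_le[of t] by fastforce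

text \<open>Recursion on the code of the pair of factors, which decreases because the kids of both
  factors are smaller.\<close>

lemma cfun_tmul: "cfun f \<Longrightarrow> cfun g \<Longrightarrow> cfun (\<lambda>x. tmul (f x) (g x))"
proof -
  \<comment> \<open>The body of \<open>tmul\<close> with bounded generators and with unions of
    decoded sets, the shapes that \<open>cfun_image2\<close> and \<open>cfun_union\<close>
    accept.\<close>
  define B where "B z n F = prod_encode
    (set_encode (set_decode (pfst (pfst n)) \<union> set_decode (pfst (psnd n))), prod_encode
    (set_encode (set_decode (set_encode (set_decode (pfst (psnd (pfst n))) \<union> set_decode (pfst (psnd (psnd n))))) \<union>
       set_decode (set_encode {prod_encode (pfst i, pfst j) |i j. i < pfst n \<and> j < psnd n \<and>
       (i \<in> meets (pfst n) \<and> j \<in> meets (psnd n) \<and> pfst i = psnd i \<and> pfst j = psnd j)})),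
     set_encode {prod_encode (pfst x, F (prod_encode (psnd x, psnd y))) |x y. x < pfst n \<and> y < psnd n \<and>
       (x \<in> kidset (pfst n) \<and> y \<in> kidset (psnd n) \<and> pfst x = pfst y)}))"
    for z n :: nat and F :: "nat \<Rightarrow> nat"
  have "cfun (\<lambda>x. tmul (pfst x) (psnd x))"
  proof (rule cfun_course_of_values[where F = "\<lambda>z n. tmul (pfst n) (psnd n)" and B = B, OF _ _ _ cfun_id cfun_id])
    show "tmul (pfst n) (psnd n) = B z n (\<lambda>n. tmul (pfst n) (psnd n))" for z n
    proof -
      have f: "finite {prod_encode (pfst i, pfst j) |i j. i < pfst n \<and> j < psnd n \<and>
        (i \<in> meets (pfst n) \<and> j \<in> meets (psnd n) \<and> pfst i = psnd i \<and> pfst j = psnd j)}"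
        by (rule finite_subset[of _ "(\<lambda>(i, j). prod_encode (pfst i, pfst j)) ` ({..<pfst n} \<times> {..<psnd n})"]) auto
      have 1: "{prod_encode (pfst i, pfst j) |i j. i \<in> meets (pfst n) \<and> j \<in> meets (psnd n) \<and> pfst i = psnd i \<and> pfst j = psnd j} =
        {prod_encode (pfst i, pfst j) |i j. i < pfst n \<and> j < psnd n \<and>
        (i \<in> meets (pfst n) \<and> j \<in> meets (psnd n) \<and> pfst i = psnd i \<and> pfst j = psnd j)}"
        by (auto dest: meets_less)
      have 2: "(\<lambda>(x, y). prod_encode (pfst x, tmul (psnd x) (psnd y))) `
          {(x, y). x \<in> kidset (pfst n) \<and> y \<in> kidset (psnd n) \<and> pfst x = pfst y} =
        {prod_encode (pfst x, tmul (psnd x) (psnd y)) |x y. x < pfst n \<and> y < psnd n \<and>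
        (x \<in> kidset (pfst n) \<and> y \<in> kidset (psnd n) \<and> pfst x = pfst y)}"
        by (auto dest: kidset_less)
      show ?thesis
        unfolding B_def pfst_encode psnd_encode set_encode_inverse[OF f] set_encode_inverse[OF finite_UnI[OF finite_set_decode finite_set_decode]]
        by (subst tmul.simps) (simp only: mk_type_def 1 2, simp only: meets_def precs_def)
    qed
    show "B z n F = B z n G" if "\<And>i. i < n \<Longrightarrow> F i = G i" for z n F G
    proof -
      have "F (prod_encode (psnd x, psnd y)) = G (prod_encode (psnd x, psnd y))"
        if "x \<in> kidset (pfst n)" "y \<in> kidset (psnd n)" for x y
      proof -
        have "prod_encode (psnd x, psnd y) < prod_encode (pfst n, psnd n)"
          using that psnd_kidset_less by (intro prod_encode_strict_mono) auto
        then show ?thesis using \<open>\<And>i. i < n \<Longrightarrow> F i = G i\<close> by simp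
      qed
      then have "{prod_encode (pfst x, F (prod_encode (psnd x, psnd y))) |x y. x < pfst n \<and> y < psnd n \<and>
          (x \<in> kidset (pfst n) \<and> y \<in> kidset (psnd n) \<and> pfst x = pfst y)} =
        {prod_encode (pfst x, G (prod_encode (psnd x, psnd y))) |x y. x < pfst n \<and> y < psnd n \<and>
          (x \<in> kidset (pfst n) \<and> y \<in> kidset (psnd n) \<and> pfst x = pfst y)}"
        by (intro Collect_cong) (metis (no_types, lifting))
      then show ?thesis unfolding B_def by (simp only:)
    qed
    show "cfun (\<lambda>w. B (pfst w) (pfst (psnd w)) (\<lambda>i. cnth (psnd (psnd w)) (pfst (psnd w) - 1 - i)))"
      unfolding B_def by (intro cfun_union cfun_intros cpred_meets cpred_kidset)
  qed
  from cfun_comp[OF this cfun_pair] show "cfun f \<Longrightarrow> cfun g \<Longrightarrow> cfun (\<lambda>x. tmul (f x) (g x))" by simp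
qed

definition kidsc :: "nat \<Rightarrow> nat \<Rightarrow> nat" where "kidsc i t = set_encode (kids i t)"

lemma kids_image: "kids i t = {psnd u |u. u < t \<and> (u \<in> kidset t \<and> pfst u = i)}"
proof -
  have "a \<in> kids i t \<longleftrightarrow> (\<exists>u. a = psnd u \<and> u \<in> kidset t \<and> pfst u = i)" for a
    unfolding kids_def by (metis (mono_tags, lifting) mem_Collect_eq pfst_encode prod_encode_pfst_psnd psnd_encode)
  then show ?thesis using kidset_less by blast
qed

lemma finite_kids [simp]: "finite (kids i t)"
  unfolding kids_image by simp

lemma set_decode_kidsc [simp]: "set_decode (kidsc i t) = kids i t"
  by (simp add: kidsc_def)

lemma cfun_kidsc: "cfun i \<Longrightarrow> cfun t \<Longrightarrow> cfun (\<lambda>x. kidsc (i x) (t x))"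
proof -
  assume i: "cfun i" and t: "cfun t"
  show ?thesis unfolding kidsc_def kids_image
    by (intro cfun_image cfun_intros cpred_kidset i t cfun_comp[OF i] cfun_comp[OF t])
qed

text \<open>
  \<open>M\<close> rounds reach the closure if it is contained in \<open>{..<M}\<close>.
\<close>

definition generatedc :: "nat \<Rightarrow> nat \<Rightarrow> nat" where
  "generatedc M A = rec_nat A (\<lambda>_ S. set_encode (set_decode S \<union>
     set_decode (set_encode {tmul x a |x a. x < S \<and> a < A \<and> (x \<in> set_decode S \<and> a \<in> set_decode A)}))) M"

lemma cfun_generatedc: "cfun M \<Longrightarrow> cfun A \<Longrightarrow> cfun (\<lambda>x. generatedc (M x) (A x))"
proof -
  assume M: "cfun M" and A: "cfun A"
  show ?thesis unfolding generatedc_def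
    by (intro cfun_rec cfun_union cfun_image2 cfun_tmul cfun_intros M A cfun_comp[OF A])
qed

text \<open>A round that adds nothing is followed only by such rounds. Until then each round adds an
  element, which within \<open>{..<M}\<close> cannot go on beyond \<open>M\<close> rounds.\<close>

lemma set_decode_generatedc:
  assumes "generated (set_decode A) \<subseteq> {..<M}" shows "set_decode (generatedc M A) = generated (set_decode A)"
proof -
  define G where "G n = set_decode (generatedc n A)" for n
  have G0: "G 0 = set_decode A" by (simp add: G_def generatedc_def)
  have GS: "G (Suc n) = G n \<union> {tmul x a |x a. x \<in> G n \<and> a \<in> set_decode A}" for n
  proof -
    have "finite {tmul x a |x a. x < S \<and> a < A \<and> (x \<in> set_decode S \<and> a \<in> set_decode A)}" for S
      by (rule finite_subset[of _ "(\<lambda>(x, a). tmul x a) ` ({..<S} \<times> {..<A})"]) auto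
    then have "G (Suc n) = G n \<union> {tmul x a |x a. x < generatedc n A \<and> a < A \<and> (x \<in> G n \<and> a \<in> set_decode A)}"
      by (simp add: G_def generatedc_def)
    then show ?thesis using set_decode_less unfolding G_def by blast
  qed
  have sub: "G n \<subseteq> generated (set_decode A)" for n
    by (induction n) (auto simp: G0 GS intro: generated.intros)
  have sup: "set_decode A \<subseteq> G n" for n by (induction n) (auto simp: G0 GS)
  have stable: "G (Suc (Suc n)) = G (Suc n)" if "G (Suc n) = G n" for n
    by (simp only: GS[of "Suc n"] that GS[of n, symmetric])
  have fin: "finite (G n)" for n by (simp add: G_def)
  have "G (Suc n) = G n \<or> n < card (G (Suc n))" for n
  proof (induction n)
    case 0
    show ?case
    proof (cases "G 0 = {}")
      case True
      then have "G (Suc 0) = G 0" by (simp only: GS[of 0]) simp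
      then show ?thesis by simp
    next
      case False
      then have "G (Suc 0) \<noteq> {}" using GS[of 0] by blast
      then show ?thesis using fin[of "Suc 0"] by (simp add: card_gt_0_iff)
    qed
  next
    case (Suc n)
    show ?case
    proof (cases "G (Suc (Suc n)) = G (Suc n)")
      case False
      then have "n < card (G (Suc n))" using Suc stable by blast
      moreover have "G (Suc n) \<subset> G (Suc (Suc n))" using False GS[of "Suc n"] by blast
      ultimately show ?thesis using psubset_card_mono[OF fin[of "Suc (Suc n)"], of "G (Suc n)"] by linarith
    qed simp
  qed
  moreover have "card (G (Suc M)) \<le> M"
    using card_mono[of "{..<M}" "G (Suc M)"] sub[of "Suc M"] assms by auto
  ultimately have "G (Suc M) = G M" using not_less by blast
  note st = this
  have "x \<in> G M" if "x \<in> generated (set_decode A)" for x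
    using that
  proof (induction rule: generated.induct)
    case (base a)
    then show ?case using sup by blast
  next
    case (step x a)
    then have "tmul x a \<in> G (Suc M)" using GS[of M] by blast
    then show ?case using st by simp
  qed
  then show ?thesis using sub G_def by blast
qed

lemma cfun_five_blocks: "cfun a \<Longrightarrow> cfun b \<Longrightarrow> cfun c \<Longrightarrow> cfun (\<lambda>x. five_blocks (a x) (b x) (c x))"
  unfolding five_blocks_def by (intro cfun_tmul)

lemma cpred_is_sing: "cfun i \<Longrightarrow> cfun t \<Longrightarrow> cpred (\<lambda>x. is_sing (i x) (t x))"
  unfolding is_sing_def by (intro cfun_intros cpred_meets cpred_precs)

lemmas cfun_type_intros = cfun_union cfun_set_pair cfun_remove cfun_filter cfun_tmul cfun_kidsc cfun_generatedc cfun_five_blocks cpred_is_sing cpred_meets cpred_precs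

section \<open>Tables of satisfying triples\<close>

definition atomc :: "nat \<Rightarrow> nat \<Rightarrow> nat \<Rightarrow> bool" where
  "atomc t r f \<longleftrightarrow>
     (if t = 0 then prod_encode (2 * pfst r + 1, 2 * psnd r + 1) \<in> meets f \<or> prod_encode (2 * pfst r + 1, 2 * psnd r + 1) \<in> precs f
      else if t = 1 then prod_encode (2 * pfst r + 1, 2 * psnd r + 1) \<in> meets f
      else if t = 2 then prod_encode (2 * r + 1, 0) \<in> meets f
      else prod_encode (2 * pfst r + 1, 2 * psnd r + 2) \<in> meets f)"

text \<open>\<open>expansion\<close> with quantifiers bounded by decoded sets. \<open>S\<close> is
  the table of the subformula, and \<open>single\<close> selects the reading as an element
  quantifier.\<close>

definition expansionc :: "nat \<Rightarrow> nat \<Rightarrow> nat \<Rightarrow> bool \<Rightarrow> nat \<Rightarrow> bool" where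
  "expansionc M i S single p \<longleftrightarrow>
     (\<exists>a'\<in>set_decode (generatedc M (kidsc i (pfst p))). \<exists>x\<in>set_decode (generatedc M (kidsc i (pfst p))).
      \<exists>b'\<in>set_decode (kidsc i (pfst (psnd p))). \<exists>y\<in>set_decode (generatedc M (kidsc i (psnd (psnd p)))).
      \<exists>c'\<in>set_decode (generatedc M (kidsc i (psnd (psnd p)))).
       (single \<longrightarrow> is_sing i (five_blocks a' (tmul x (tmul b' y)) c')) \<and>
       prod_encode (a', prod_encode (tmul x (tmul b' y), c')) \<in> set_decode S)"

lemma psnd_psnd_less: "0 < pfst n \<Longrightarrow> psnd (psnd n) < n"
  and pfst_psnd_less: "0 < pfst n \<Longrightarrow> pfst (psnd n) < n"
  using psnd_less[of n] psnd_le[of "psnd n"] pfst_le[of "psnd n"] by linarith+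

text \<open>
  The set of those triples of types below \<open>M\<close> that satisfy the formula coded by
  \<open>n\<close>.
\<close>

function satc :: "nat \<Rightarrow> nat \<Rightarrow> nat" where
  "satc M n =
    (if pfst n < 4 then set_encode {p. p < M \<and> atomc (pfst n) (psnd n) (five_blocks (pfst p) (pfst (psnd p)) (psnd (psnd p)))}
     else if pfst n = 4 then set_encode ({p. p < M \<and> p \<notin> set_decode (satc M (psnd n))})
     else if pfst n = 5 then set_encode ({p. p < M \<and> (p \<in> set_decode (satc M (pfst (psnd n))) \<and>
       p \<in> set_decode (satc M (psnd (psnd n))))})
     else if pfst n = 6 then set_encode ({p. p < M \<and> expansionc M (2 * pfst (psnd n) + 1) (satc M (psnd (psnd n))) True p})
     else set_encode ({p. p < M \<and> expansionc M (2 * pfst (psnd n) + 2) (satc M (psnd (psnd n))) False p}))"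
  by auto
termination by (relation "measure snd") (auto simp: psnd_less psnd_psnd_less pfst_psnd_less)

declare satc.simps [simp del]

text \<open>A quantifier consults its subformula at other triples. Returning whole tables rather
  than truth values makes this a course-of-values recursion on the code of the formula
  alone.\<close>

lemma cfun_satc: "cfun f \<Longrightarrow> cfun g \<Longrightarrow> cfun (\<lambda>x. satc (f x) (g x))"
proof -
  define B where "B M n F =
    (if pfst n < 4 then set_encode {p. p < M \<and> atomc (pfst n) (psnd n) (five_blocks (pfst p) (pfst (psnd p)) (psnd (psnd p)))}
     else if pfst n = 4 then set_encode ({p. p < M \<and> p \<notin> set_decode (F (psnd n))})
     else if pfst n = 5 then set_encode ({p. p < M \<and> (p \<in> set_decode (F (pfst (psnd n))) \<and>
       p \<in> set_decode (F (psnd (psnd n))))})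
     else if pfst n = 6 then set_encode ({p. p < M \<and> expansionc M (2 * pfst (psnd n) + 1) (F (psnd (psnd n))) True p})
     else set_encode ({p. p < M \<and> expansionc M (2 * pfst (psnd n) + 2) (F (psnd (psnd n))) False p}))"
    for M n :: nat and F :: "nat \<Rightarrow> nat"
  show "cfun f \<Longrightarrow> cfun g \<Longrightarrow> cfun (\<lambda>x. satc (f x) (g x))"
  proof (rule cfun_course_of_values[where F = satc and B = B])
    show "satc M n = B M n (satc M)" for M n
      unfolding B_def by (rule satc.simps)
    show "B M n F = B M n G" if "\<And>i. i < n \<Longrightarrow> F i = G i" for M n F G
    proof (cases "pfst n < 4")
      case False
      then have "psnd n < n" by (intro psnd_less) simp
      moreover have "psnd (psnd n) \<le> psnd n" "pfst (psnd n) \<le> psnd n" by (rule psnd_le pfst_le)+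
      ultimately have "F (psnd n) = G (psnd n)" "F (psnd (psnd n)) = G (psnd (psnd n))"
        "F (pfst (psnd n)) = G (pfst (psnd n))" by (auto intro!: that)
      then show ?thesis unfolding B_def by (simp only:)
    qed (simp add: B_def)
    show "cfun (\<lambda>w. B (pfst w) (pfst (psnd w)) (\<lambda>i. cnth (psnd (psnd w)) (pfst (psnd w) - 1 - i)))"
      unfolding B_def atomc_def expansionc_def by (intro cfun_type_intros cfun_intros)
  qed
qed

text \<open>Serves both as table size and as number of closure rounds, since it exceeds the coded
  triples and also their components.\<close>

definition triple_bound :: "nat \<Rightarrow> nat \<Rightarrow> nat" where
  "triple_bound N k = Suc (prod_encode (type_bound N k, prod_encode (type_bound N k, type_bound N k)))"

text \<open>The bound stays at the top rank \<open>K\<close> while the rank \<open>k\<close> of the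
  triple drops at each quantifier; hence the two separate ranks.\<close>

lemma satc_correct:
  assumes "k \<le> K" "is_type N k a" "is_type N k b" "is_type N k c"
  shows "prod_encode (a, prod_encode (b, c)) \<in> set_decode (satc (triple_bound N K) (mso_code \<phi>)) \<longleftrightarrow> type_sat \<phi> a b c"
  using assms
proof (induction \<phi> arbitrary: k a b c)
  let ?p = "\<lambda>a b c. prod_encode (a, prod_encode (b, c))"
  have less: "?p a b c < triple_bound N K" if "k \<le> K" "is_type N k a" "is_type N k b" "is_type N k c" for k a b c
    unfolding triple_bound_def less_Suc_eq_le using that type_bound_mono[of k K N]
    by (intro prod_encode_mono) (meson is_type_less_type_bound le_trans less_imp_le)+
  have fin: "finite {p. p < triple_bound N K \<and> P p}" for P by simp
  have ext: "expansionc (triple_bound N K) i (satc (triple_bound N K) (mso_code \<phi>)) single (?p a b c) \<longleftrightarrow>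
      (\<exists>a' m c'. expansion i a b c a' m c' \<and> (single \<longrightarrow> is_sing i (five_blocks a' m c')) \<and> type_sat \<phi> a' m c')"
    if IH: "\<And>k a b c. k \<le> K \<Longrightarrow> is_type N k a \<Longrightarrow> is_type N k b \<Longrightarrow> is_type N k c \<Longrightarrow>
        ?p a b c \<in> set_decode (satc (triple_bound N K) (mso_code \<phi>)) \<longleftrightarrow> type_sat \<phi> a b c"
      and abc: "k \<le> K" "is_type N k a" "is_type N k b" "is_type N k c" for \<phi> i single k a b c
  proof (cases k)
    case 0
    \<comment> \<open>Types of rank 0 have no kids, so both sides are false.\<close>
    then have "kids i a = {}" "kids i b = {}" "kids i c = {}" using abc by (auto simp: kids_def)
    then show ?thesis by (simp add: expansionc_def expansion_def)
  next
    case (Suc k')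
    have W: "is_type N k' u" if "u \<in> kids i a \<or> u \<in> kids i b \<or> u \<in> kids i c" for u
      using that abc Suc by auto
    have Wg: "is_type N k' u" if "u \<in> generated (kids i a) \<or> u \<in> generated (kids i c)" for u
      using that W is_type_generated by metis
    have "u < triple_bound N K" if "is_type N k' u" for u
      using less[of k' u u u] le_prod_encode_1[of u "prod_encode (u, u)"] that abc(1) Suc by simp
    then have "generated (kids i a) \<subseteq> {..<triple_bound N K}" "generated (kids i c) \<subseteq> {..<triple_bound N K}" using Wg by auto
    then have g: "set_decode (generatedc (triple_bound N K) (kidsc i a)) = generated (kids i a)"
      "set_decode (generatedc (triple_bound N K) (kidsc i c)) = generated (kids i c)"
      using set_decode_generatedc[of "kidsc i a"] set_decode_generatedc[of "kidsc i c"] by simp_all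
    have "?p a' (tmul x (tmul b' y)) c' \<in> set_decode (satc (triple_bound N K) (mso_code \<phi>)) \<longleftrightarrow> type_sat \<phi> a' (tmul x (tmul b' y)) c'"
      if "a' \<in> generated (kids i a)" "x \<in> generated (kids i a)" "b' \<in> kids i b" "y \<in> generated (kids i c)" "c' \<in> generated (kids i c)" for a' x b' y c'
      using that W Wg abc(1) Suc by (intro IH[of k']) (auto intro!: is_type_tmul)
    then show ?thesis
      unfolding expansionc_def expansion_def by (simp only: pfst_encode psnd_encode g set_decode_kidsc) blast
  qed
  {
    case (Le x y)
    then show ?case using less[OF Le] by (subst satc.simps) (simp add: fin atomc_def)
  next
    case (Eq x y)
    then show ?case using less[OF Eq] by (subst satc.simps) (simp add: fin atomc_def)
  next
    case (InP x)
    then show ?case using less[OF InP] by (subst satc.simps) (simp add: fin atomc_def)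
  next
    case (Mem x X)
    then show ?case using less[OF Mem] by (subst satc.simps) (simp add: fin atomc_def)
  next
    case (Neg \<phi>)
    then show ?case using less[OF Neg.prems] by (subst satc.simps) (simp add: fin)
  next
    case (Conj \<phi> \<psi>)
    have "?p a b c \<in> set_decode (satc (triple_bound N K) (mso_code \<phi>)) \<longleftrightarrow> type_sat \<phi> a b c"
      "?p a b c \<in> set_decode (satc (triple_bound N K) (mso_code \<psi>)) \<longleftrightarrow> type_sat \<psi> a b c"
      using Conj by blast+
    then show ?case using less[OF Conj.prems] by (subst satc.simps) (simp add: fin)
  next
    case (ExElem x \<phi>)
    have "?p a b c \<in> set_decode (satc (triple_bound N K) (mso_code (ExElem x \<phi>))) \<longleftrightarrow>
      expansionc (triple_bound N K) (2 * x + 1) (satc (triple_bound N K) (mso_code \<phi>)) True (?p a b c)"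
      using less[OF ExElem.prems] by (subst satc.simps) (simp add: fin)
    then show ?case using ext[OF ExElem.IH ExElem.prems, where i = "2 * x + 1" and single = True] by simp
  next
    case (ExSet x \<phi>)
    have "?p a b c \<in> set_decode (satc (triple_bound N K) (mso_code (ExSet x \<phi>))) \<longleftrightarrow>
      expansionc (triple_bound N K) (2 * x + 2) (satc (triple_bound N K) (mso_code \<phi>)) False (?p a b c)"
      using less[OF ExSet.prems] by (subst satc.simps) (simp add: fin)
    then show ?case using ext[OF ExSet.IH ExSet.prems, where i = "2 * x + 2" and single = False] by simp
  }
qed

text \<open>
  The labels of the free variables. Numbers that code no formula are detected by the label 0,
  which belongs to no variable.
\<close>

function freec :: "nat \<Rightarrow> nat" where
  "freec n =
    (if pfst n < 2 then set_encode {2 * pfst (psnd n) + 1, 2 * psnd (psnd n) + 1}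
     else if pfst n = 2 then set_encode {2 * psnd n + 1, 2 * psnd n + 1}
     else if pfst n = 3 then set_encode {2 * pfst (psnd n) + 1, 2 * psnd (psnd n) + 2}
     else if pfst n = 4 then freec (psnd n)
     else if pfst n = 5 then set_encode (set_decode (freec (pfst (psnd n))) \<union> set_decode (freec (psnd (psnd n))))
     else if pfst n = 6 then set_encode (set_decode (freec (psnd (psnd n))) - {2 * pfst (psnd n) + 1})
     else if pfst n = 7 then set_encode (set_decode (freec (psnd (psnd n))) - {2 * pfst (psnd n) + 2})
     else 1)"
  by auto
termination by (relation "measure id") (auto simp: psnd_less psnd_psnd_less pfst_psnd_less)

declare freec.simps [simp del]

lemma cfun_freec: "cfun f \<Longrightarrow> cfun (\<lambda>x. freec (f x))"
proof -
  define B where "B z n F =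
    (if pfst n < 2 then set_encode {2 * pfst (psnd n) + 1, 2 * psnd (psnd n) + 1}
     else if pfst n = 2 then set_encode {2 * psnd n + 1, 2 * psnd n + 1}
     else if pfst n = 3 then set_encode {2 * pfst (psnd n) + 1, 2 * psnd (psnd n) + 2}
     else if pfst n = 4 then F (psnd n)
     else if pfst n = 5 then set_encode (set_decode (F (pfst (psnd n))) \<union> set_decode (F (psnd (psnd n))))
     else if pfst n = 6 then set_encode (set_decode (F (psnd (psnd n))) - {2 * pfst (psnd n) + 1})
     else if pfst n = 7 then set_encode (set_decode (F (psnd (psnd n))) - {2 * pfst (psnd n) + 2})
     else 1)" for z n :: nat and F :: "nat \<Rightarrow> nat"
  show "cfun f \<Longrightarrow> cfun (\<lambda>x. freec (f x))"
  proof (rule cfun_course_of_values[where F = "\<lambda>_. freec" and B = B and z = "\<lambda>x. x", OF _ _ _ cfun_id])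
    show "freec n = B z n freec" for z n
      unfolding B_def by (rule freec.simps)
    show "B z n F = B z n G" if "\<And>i. i < n \<Longrightarrow> F i = G i" for z n F G
    proof (cases "pfst n < 2")
      case False
      then have "psnd n < n" by (intro psnd_less) simp
      moreover have "psnd (psnd n) \<le> psnd n" "pfst (psnd n) \<le> psnd n" by (rule psnd_le pfst_le)+
      ultimately have "F (psnd n) = G (psnd n)" "F (psnd (psnd n)) = G (psnd (psnd n))"
        "F (pfst (psnd n)) = G (pfst (psnd n))" by (auto intro!: that)
      then show ?thesis unfolding B_def by (simp only:)
    qed (simp add: B_def)
    show "cfun (\<lambda>w. B (pfst w) (pfst (psnd w)) (\<lambda>i. cnth (psnd (psnd w)) (pfst (psnd w) - 1 - i)))"
      unfolding B_def by (intro cfun_type_intros cfun_intros)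
  qed
qed

lemma freec_mso_code:
  "set_decode (freec (mso_code \<phi>)) = (\<lambda>x. 2 * x + 1) ` free_elem \<phi> \<union> (\<lambda>X. 2 * X + 2) ` free_set \<phi>"
proof (induction \<phi>)
  case (Conj \<phi> \<psi>)
  have "set_decode (freec (mso_code (Conj \<phi> \<psi>))) = set_decode (freec (mso_code \<phi>)) \<union> set_decode (freec (mso_code \<psi>))"
    by (subst freec.simps) simp
  then show ?case using Conj by auto
next
  case (ExElem x \<phi>)
  have "set_decode (freec (mso_code (ExElem x \<phi>))) = set_decode (freec (mso_code \<phi>)) - {2 * x + 1}"
    by (subst freec.simps) simp
  also have "\<dots> = (\<lambda>x. 2 * x + 1) ` (free_elem \<phi> - {x}) \<union> (\<lambda>X. 2 * X + 2) ` free_set \<phi>"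
  proof -
    have "2 * X + 2 \<noteq> 2 * x + 1" for X by presburger
    then show ?thesis unfolding ExElem by (auto; presburger)
  qed
  finally show ?case by simp
next
  case (ExSet X \<phi>)
  have "set_decode (freec (mso_code (ExSet X \<phi>))) = set_decode (freec (mso_code \<phi>)) - {2 * X + 2}"
    by (subst freec.simps) simp
  also have "\<dots> = (\<lambda>x. 2 * x + 1) ` free_elem \<phi> \<union> (\<lambda>X. 2 * X + 2) ` (free_set \<phi> - {X})"
  proof -
    have "2 * x + 1 \<noteq> 2 * X + 2" for x by presburger
    then show ?thesis unfolding ExSet by (auto; presburger)
  qed
  finally show ?case by simp
qed (subst freec.simps; auto simp del: set_encode_insert set_decode_Suc)+

text \<open>The value 1 given to an unknown tag codes the set containing just 0. Quantifiers remove
  positive labels only, so the 0 of a malformed part survives up to the root.\<close>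

lemma freec_only_codes: "0 \<notin> set_decode (freec n) \<Longrightarrow> \<exists>\<phi>. n = mso_code \<phi>"
proof (induction n rule: less_induct)
  case (less n)
  obtain t r where n1: "n = prod_encode (t, r)" by (metis prod_encode_pfst_psnd)
  obtain x y where r: "r = prod_encode (x, y)" by (metis prod_encode_pfst_psnd)
  note n2 = n1[unfolded r]
  have IH: "0 \<notin> set_decode (freec m) \<Longrightarrow> 2 \<le> t \<Longrightarrow> m \<in> {r, x, y} \<Longrightarrow> \<exists>\<phi>. m = mso_code \<phi>" for m
    using less.IH[of m] psnd_less[of n] psnd_psnd_less[of n] pfst_psnd_less[of n] by (auto simp: n1 r)
  have fv: "0 \<notin> set_decode (freec (prod_encode (t, r)))" using less.prems n1 by simp
  then have "t \<le> 7" by (subst (asm) freec.simps) (auto split: if_splits)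
  then consider "t = 0" | "t = 1" | "t = 2" | "t = 3" | "t = 4" | "t = 5" | "t = 6" | "t = 7" by linarith
  then show ?case
  proof cases
    case 1
    then show ?thesis using n2 by (intro exI[of _ "Le x y"]) simp
  next
    case 2
    then show ?thesis using n2 by (intro exI[of _ "Eq x y"]) simp
  next
    case 3
    then show ?thesis using n1 by (intro exI[of _ "InP r"]) simp
  next
    case 4
    then show ?thesis using n2 by (intro exI[of _ "Mem x y"]) simp
  next
    case 5
    then have "0 \<notin> set_decode (freec r)" using fv by (subst (asm) freec.simps) simp
    then obtain \<phi> where "r = mso_code \<phi>" using IH 5 by auto
    then show ?thesis using n1 5 by (intro exI[of _ "Neg \<phi>"]) simp
  next
    case 6
    then have "0 \<notin> set_decode (freec x)" "0 \<notin> set_decode (freec y)" using fv r by (subst (asm) freec.simps; simp)+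
    then obtain \<phi> \<psi> where "x = mso_code \<phi>" "y = mso_code \<psi>" using IH 6 by fastforce
    then show ?thesis using n2 6 by (intro exI[of _ "Conj \<phi> \<psi>"]) simp
  next
    case 7
    then have "0 \<notin> set_decode (freec y)" using fv r by (subst (asm) freec.simps) simp
    then obtain \<phi> where "y = mso_code \<phi>" using IH 7 by auto
    then show ?thesis using n2 7 by (intro exI[of _ "ExElem x \<phi>"]) simp
  next
    case 8
    then have "0 \<notin> set_decode (freec y)" using fv r by (subst (asm) freec.simps) simp
    then obtain \<phi> where "y = mso_code \<phi>" using IH 8 by auto
    then show ?thesis using n2 8 by (intro exI[of _ "ExSet x \<phi>"]) simp
  qed
qed

lemma freec_sentence: "freec n = 0 \<longleftrightarrow> (\<exists>\<phi>. n = mso_code \<phi> \<and> sentence \<phi>)"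
proof -
  have "set_decode (freec (mso_code \<phi>)) = {} \<longleftrightarrow> sentence \<phi>" for \<phi>
    by (simp add: freec_mso_code sentence_def)
  then have *: "freec (mso_code \<phi>) = 0 \<longleftrightarrow> sentence \<phi>" for \<phi>
    using set_decode_inject[of "freec (mso_code \<phi>)" 0] by simp
  show ?thesis
  proof
    assume n: "freec n = 0"
    then obtain \<phi> where "n = mso_code \<phi>" using freec_only_codes[of n] by auto
    then show "\<exists>\<phi>. n = mso_code \<phi> \<and> sentence \<phi>" using n * by auto
  qed (use * in auto)
qed

lemma le_tagged: "r \<le> prod_encode (t, r)" "x \<le> prod_encode (t, prod_encode (x, y))" "y \<le> prod_encode (t, prod_encode (x, y))"
  using le_prod_encode_1 le_prod_encode_2 by (meson le_trans)+

text \<open>The code of a formula bounds its labels and, by \<open>qrank_mso_code\<close>, its rank.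
  Hence \<open>N = 2 * n + 3\<close> and \<open>k = n\<close> can be read off a code
  \<open>n\<close>.\<close>

lemma var_indices_mso_code: "var_indices \<phi> \<subseteq> {..<2 * mso_code \<phi> + 3}"
proof -
  have "i \<le> 2 * mso_code \<phi> + 2" if "i \<in> var_indices \<phi>" for i
    using that
  proof (induction \<phi>)
    case (Le x y)
    then show ?case using le_tagged(2)[of x 0 y] le_tagged(3)[of y 0 x] by auto
  next
    case (Eq x y)
    then show ?case using le_tagged(2)[of x 1 y] le_tagged(3)[of y 1 x] by auto
  next
    case (InP x)
    then show ?case using le_tagged(1)[of x 2] by auto
  next
    case (Mem x y)
    then show ?case using le_tagged(2)[of x 3 y] le_tagged(3)[of y 3 x] by auto
  next
    case (Neg \<phi>)
    then show ?case using le_tagged(1)[of "mso_code \<phi>" 4] by auto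
  next
    case (Conj \<phi> \<psi>)
    then show ?case using le_tagged(2,3)[of "mso_code \<phi>" 5 "mso_code \<psi>"] le_tagged(3)[of "mso_code \<psi>" 5 "mso_code \<phi>"] by auto
  next
    case (ExElem x \<phi>)
    then show ?case using le_tagged(2)[of x 6 "mso_code \<phi>"] le_tagged(3)[of "mso_code \<phi>" 6 x] by auto
  next
    case (ExSet x \<phi>)
    then show ?case using le_tagged(2)[of x 7 "mso_code \<phi>"] le_tagged(3)[of "mso_code \<phi>" 7 x] by auto
  qed
  then show ?thesis by (auto simp: less_Suc_eq_le numeral_3_eq_3)
qed

lemma qrank_mso_code: "qrank \<phi> \<le> mso_code \<phi>"
proof (induction \<phi>)
  case (Neg \<phi>)
  then show ?case using le_tagged(1)[of "mso_code \<phi>" 4] by auto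
next
  case (Conj \<phi> \<psi>)
  then show ?case using le_tagged(2)[of "mso_code \<phi>" 5 "mso_code \<psi>"] le_tagged(3)[of "mso_code \<psi>" 5 "mso_code \<phi>"] by auto
next
  case (ExElem x \<phi>)
  then show ?case using psnd_psnd_less[of "mso_code (ExElem x \<phi>)"] by simp
next
  case (ExSet x \<phi>)
  then show ?case using psnd_psnd_less[of "mso_code (ExSet x \<phi>)"] by simp
qed auto

section \<open>Computing the types of letters and a kernel idempotent\<close>

definition point_code :: "nat \<Rightarrow> nat \<Rightarrow> nat" where
  "point_code A C = prod_encode (set_encode {prod_encode (i, j) |i j. i < A \<and> j < A \<and>
     (i \<in> set_decode A \<and> j \<in> set_decode A)}, prod_encode (0, C))"

definition point_step :: "nat \<Rightarrow> nat \<Rightarrow> nat \<Rightarrow> nat" where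
  "point_step N g A = point_code A (set_encode {prod_encode (i, psnd u) |i u. i < N \<and> u < g \<and>
     (u \<in> set_decode g \<and>
       (pfst u = set_encode (insert i (set_decode A)) \<or> pfst u = set_encode (set_decode A - {i})))})"

text \<open>\<open>point_type\<close> at one rank calls the lower rank at other label sets, so the
  recursion carries the graph of the whole function on the codes of subsets of
  \<open>{..<N}\<close>. The conjunct \<open>True\<close> fits the comprehension to
  \<open>cfun_image\<close>.\<close>

definition point_graph :: "nat \<Rightarrow> nat \<Rightarrow> nat" where
  "point_graph N k = rec_nat (set_encode {prod_encode (A, point_code A 0) |A. A < 2 ^ N \<and> True})
    (\<lambda>_ g. set_encode {prod_encode (A, point_step N g A) |A. A < 2 ^ N \<and> True}) k"

lemma cfun_point_graph: "cfun N \<Longrightarrow> cfun k \<Longrightarrow> cfun (\<lambda>x. point_graph (N x) (k x))"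
proof -
  assume N: "cfun N" and k: "cfun k"
  show ?thesis unfolding point_graph_def point_step_def point_code_def
    by (intro cfun_intros cfun_insert cfun_remove N k cfun_comp[OF N])
qed

lemma set_decode_subset_iff: "set_decode A \<subseteq> {..<N} \<longleftrightarrow> A < 2 ^ N"
proof
  show "set_decode A \<subseteq> {..<N} \<Longrightarrow> A < 2 ^ N" using set_encode_less_exp[of "set_decode A" N] by simp
  show "A < 2 ^ N \<Longrightarrow> set_decode A \<subseteq> {..<N}"
  proof
    fix x assume "A < 2 ^ N" "x \<in> set_decode A"
    then have "A div 2 ^ x \<noteq> 0" unfolding set_decode_def by (metis (no_types, lifting) even_zero mem_Collect_eq)
    then have "2 ^ x < (2 ^ N :: nat)" using \<open>A < 2 ^ N\<close> by (meson div_less le_less_trans not_le)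
    then show "x \<in> {..<N}" by simp
  qed
qed

lemma set_decode_point_graph: "set_decode (point_graph N k) = {prod_encode (A, point_type N k (set_decode A)) |A. A < 2 ^ N}"
proof -
  have fin: "finite {f A |A. A < (2::nat) ^ N}" for f :: "nat \<Rightarrow> nat" by simp
  have code: "point_code A (set_encode C) = mk_type (prod_encode ` (set_decode A \<times> set_decode A)) {} C" for A C
  proof -
    have "{prod_encode (i, j) |i j. i < A \<and> j < A \<and> (i \<in> set_decode A \<and> j \<in> set_decode A)} =
      prod_encode ` (set_decode A \<times> set_decode A)" by (auto dest: set_decode_less)
    then show ?thesis by (simp add: point_code_def mk_type_def)
  qed
  have compr: "{f A |A. A < (2::nat) ^ N \<and> True} = {g A |A. A < 2 ^ N}"
    if "\<And>A. A < 2 ^ N \<Longrightarrow> f A = g A" for f g :: "nat \<Rightarrow> nat"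
    using that by (intro Collect_cong) metis
  show ?thesis
  proof (induction k)
    case 0
    show ?case using fin by (simp add: point_graph_def code[of _ "{}", simplified])
  next
    case (Suc k)
    have 2: "{prod_encode (i, psnd u) |i u. i < N \<and> u < point_graph N k \<and> (u \<in> set_decode (point_graph N k) \<and>
         (pfst u = set_encode (insert i (set_decode A)) \<or> pfst u = set_encode (set_decode A - {i})))} =
      {prod_encode (i, point_type N k B) |i B. i < N \<and> (B = insert i (set_decode A) \<or> B = set_decode A - {i})}" (is "?L = ?R")
      if A: "A < 2 ^ N" for A
    proof (intro equalityI subsetI)
      fix z assume "z \<in> ?L"
      then obtain i u where z: "z = prod_encode (i, psnd u)" "i < N" "u \<in> set_decode (point_graph N k)"
        "pfst u = set_encode (insert i (set_decode A)) \<or> pfst u = set_encode (set_decode A - {i})" by blast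
      then obtain A' where "u = prod_encode (A', point_type N k (set_decode A'))" unfolding Suc by blast
      then have "psnd u = point_type N k (set_decode (pfst u))" by simp
      moreover have "set_decode (pfst u) = insert i (set_decode A) \<or> set_decode (pfst u) = set_decode A - {i}"
        using z(4) by (metis finite_Diff finite_insert finite_set_decode set_encode_inverse)
      ultimately have "z = prod_encode (i, point_type N k (set_decode (pfst u)))" "i < N"
        "set_decode (pfst u) = insert i (set_decode A) \<or> set_decode (pfst u) = set_decode A - {i}"
        using z(1,2) by simp_all
      then show "z \<in> ?R" by blast
    next
      fix z assume "z \<in> ?R"
      then obtain i B where z: "z = prod_encode (i, point_type N k B)" "i < N" "B = insert i (set_decode A) \<or> B = set_decode A - {i}" by blast
      then have B: "finite B" "B \<subseteq> {..<N}" using A[folded set_decode_subset_iff] by auto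
      then have "set_encode B < 2 ^ N" by (simp add: set_encode_less_exp)
      then have u: "prod_encode (set_encode B, point_type N k B) \<in> set_decode (point_graph N k)"
        unfolding Suc using B(1) by force
      have "z = prod_encode (i, psnd (prod_encode (set_encode B, point_type N k B)))" using z by simp
      moreover have "pfst (prod_encode (set_encode B, point_type N k B)) = set_encode (insert i (set_decode A)) \<or>
        pfst (prod_encode (set_encode B, point_type N k B)) = set_encode (set_decode A - {i})" using z(3) by auto
      ultimately show "z \<in> ?L" using u set_decode_less[OF u] z(2) by blast
    qed
    have "{prod_encode (A, point_step N (point_graph N k) A) |A. A < 2 ^ N \<and> True} =
      {prod_encode (A, point_type N (Suc k) (set_decode A)) |A. A < 2 ^ N}"
      by (rule compr) (simp add: point_step_def code 2)
    then have "point_graph N (Suc k) = set_encode {prod_encode (A, point_type N (Suc k) (set_decode A)) |A. A < 2 ^ N}"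
      by (simp only: point_graph_def nat.rec(2))
    then show ?case using fin by simp
  qed
qed

text \<open>Looked up in the graph as the least, and in fact only, partner of the code of the label
  set; \<open>of_bool b\<close> codes that set.\<close>

lemma cfun_letter: "cfun (\<lambda>n. letter (2 * n + 3) n b)"
proof -
  have mem: "prod_encode (of_bool b, t) \<in> set_decode (point_graph (2 * n + 3) n) \<longleftrightarrow> t = letter (2 * n + 3) n b" for t n
  proof -
    have "1 < (2::nat) ^ (2 * n + 3)" by (rule one_less_power) simp_all
    then have "of_bool b < (2::nat) ^ (2 * n + 3)" by (cases b) simp_all
    moreover have "set_decode (of_bool b) = (if b then {0} else {})"
      using set_encode_inverse[of "{0}"] by simp
    ultimately have "prod_encode (of_bool b, letter (2 * n + 3) n b) \<in> set_decode (point_graph (2 * n + 3) n)"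
      unfolding set_decode_point_graph letter_def by (intro CollectI exI[of _ "of_bool b"] conjI) simp_all
    moreover have "t = letter (2 * n + 3) n b" if "prod_encode (of_bool b, t) \<in> set_decode (point_graph (2 * n + 3) n)"
      using that \<open>set_decode (of_bool b) = _\<close> unfolding set_decode_point_graph letter_def by (elim CollectE exE conjE) simp
    ultimately show ?thesis by blast
  qed
  have "cfun (\<lambda>n. LEAST t. prod_encode (of_bool b, t) \<in> set_decode (point_graph (2 * n + 3) n))"
    by (rule cfun_Least) (intro cfun_point_graph cfun_intros, simp only: mem, blast)
  moreover have "(LEAST t. t = a) = a" for a :: nat by (rule Least_equality) auto
  ultimately show ?thesis by (simp add: mem)
qed

lemma cfun_type_bound: "cfun N \<Longrightarrow> cfun k \<Longrightarrow> cfun (\<lambda>x. type_bound (N x) (k x))"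
proof -
  assume N: "cfun N" and k: "cfun k"
  have "type_bound N k = rec_nat (Suc (prod_encode (2 ^ prod_encode (N, N), prod_encode (2 ^ prod_encode (N, N), 1))))
    (\<lambda>_ t. Suc (prod_encode (2 ^ prod_encode (N, N), prod_encode (2 ^ prod_encode (N, N), 2 ^ prod_encode (N, t))))) k"
    for N k by (induction k) simp_all
  then show ?thesis by (simp only:) (intro cfun_intros N k cfun_comp[OF N])
qed

lemma cfun_triple_bound: "cfun N \<Longrightarrow> cfun k \<Longrightarrow> cfun (\<lambda>x. triple_bound (N x) (k x))"
  unfolding triple_bound_def by (intro cfun_intros cfun_type_bound)

definition word_typesc :: "nat \<Rightarrow> nat" where
  "word_typesc n = generatedc (triple_bound (2 * n + 3) n) (set_encode {letter (2 * n + 3) n False, letter (2 * n + 3) n True})"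

lemma set_decode_word_typesc: "set_decode (word_typesc n) = word_types (2 * n + 3) n"
proof -
  have "u < triple_bound N k" if "u < type_bound N k" for u N k
    using that le_prod_encode_1[of "type_bound N k" "prod_encode (type_bound N k, type_bound N k)"] by (simp add: triple_bound_def)
  then show ?thesis
    unfolding word_typesc_def word_types_def using word_types_less[of "2 * n + 3" _ n, unfolded word_types_def]
    by (subst set_decode_generatedc) (auto simp del: set_encode_insert)
qed

lemma cfun_word_typesc: "cfun f \<Longrightarrow> cfun (\<lambda>x. word_typesc (f x))"
proof -
  have "cfun word_typesc" unfolding word_typesc_def[abs_def] by (intro cfun_generatedc cfun_triple_bound cfun_set_pair cfun_letter cfun_intros)
  then show "cfun f \<Longrightarrow> cfun (\<lambda>x. word_typesc (f x))" by (rule cfun_comp)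
qed

definition kernel_idem_elem :: "nat \<Rightarrow> nat" where
  "kernel_idem_elem n = (LEAST e. kernel_idem (2 * n + 3) n e)"

lemma kernel_idem_elem: "kernel_idem (2 * n + 3) n (kernel_idem_elem n)"
  unfolding kernel_idem_elem_def by (rule LeastI_ex) (rule kernel_idem_exists, simp)

lemma cfun_kernel_idem_elem: "cfun kernel_idem_elem"
  unfolding kernel_idem_elem_def[abs_def]
proof (rule cfun_Least)
  show "\<exists>e. kernel_idem (2 * n + 3) n e" for n using kernel_idem_exists by simp
  show "cpred (\<lambda>z. kernel_idem (2 * psnd z + 3) (psnd z) (pfst z))"
    unfolding kernel_idem_def set_decode_word_typesc[symmetric]
    by (intro cfun_intros cfun_tmul cfun_word_typesc)
qed

text \<open>Decision procedure: test that \<open>n\<close> codes a sentence, find the least kernel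
  idempotent, and look up its constant triple in the table of the formula.\<close>

theorem rich_decidable:
  assumes "rich \<xi>" shows "decidable_mso_theory \<xi>"
  unfolding decidable_mso_theory_def
proof (rule decidable_set_cpred)
  let ?t = "\<lambda>n. freec n = 0 \<and> prod_encode (kernel_idem_elem n, prod_encode (kernel_idem_elem n, kernel_idem_elem n))
    \<in> set_decode (satc (triple_bound (2 * n + 3) n) n)"
  have *: "prod_encode (kernel_idem_elem n, prod_encode (kernel_idem_elem n, kernel_idem_elem n)) \<in> set_decode (satc (triple_bound (2 * n + 3) n) n)
    \<longleftrightarrow> models UNIV \<xi> \<phi>" if "n = mso_code \<phi>" "sentence \<phi>" for n \<phi>
  proof -
    have "is_type (2 * n + 3) n (kernel_idem_elem n)"
      using kernel_idem_elem[of n] by (intro is_type_word_types) (simp_all add: kernel_idem_def)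
    then have "prod_encode (kernel_idem_elem n, prod_encode (kernel_idem_elem n, kernel_idem_elem n)) \<in> set_decode (satc (triple_bound (2 * n + 3) n) n)
      \<longleftrightarrow> type_sat \<phi> (kernel_idem_elem n) (kernel_idem_elem n) (kernel_idem_elem n)"
      unfolding that(1) by (intro satc_correct) simp_all
    also have "\<dots> \<longleftrightarrow> models UNIV \<xi> \<phi>"
      by (rule rich_models_iff[OF _ _ _ that(2) assms kernel_idem_elem, symmetric])
        (use that(1) var_indices_mso_code[of \<phi>] qrank_mso_code[of \<phi>] in simp_all)
    finally show ?thesis .
  qed
  have "cpred ?t"
    by (intro cfun_intros cfun_freec cfun_satc cfun_triple_bound cfun_comp[OF cfun_kernel_idem_elem])
  moreover have "?t n \<longleftrightarrow> n \<in> mso_code ` mso_theory \<xi>" for n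
    unfolding freec_sentence mso_theory_def using * by blast
  ultimately show "cpred (\<lambda>n. n \<in> mso_code ` mso_theory \<xi>)" by (rule cpred_cong)
qed


section \<open>Certificates for enumerations\<close>

primrec rcode :: "recf \<Rightarrow> nat" where
  "rcode RZero = prod_encode (0, 0)"
| "rcode RSucc = prod_encode (1, 0)"
| "rcode (RProj i) = prod_encode (2, i)"
| "rcode (RComp f gs) = prod_encode (3, prod_encode (rcode f, list_encode (map rcode gs)))"
| "rcode (RPrim f g) = prod_encode (4, prod_encode (rcode f, rcode g))"
| "rcode (RMu f) = prod_encode (5, rcode f)"

definition entry :: "nat \<Rightarrow> nat \<Rightarrow> nat \<Rightarrow> nat" where
  "entry f xs y = prod_encode (f, prod_encode (xs, y))"

text \<open>
  One step of an evaluation: whether \<open>f\<close> maps \<open>xs\<close> to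
  \<open>y\<close>, given the entries in \<open>Q\<close>; the bound \<open>b\<close> on the
  intermediate values keeps this decidable.
\<close>

definition justified :: "nat \<Rightarrow> (nat \<Rightarrow> bool) \<Rightarrow> nat \<Rightarrow> nat \<Rightarrow> nat \<Rightarrow> bool" where
  "justified b Q f xs y \<longleftrightarrow>
     (if pfst f = 0 then y = 0
      else if pfst f = 1 then clen xs = 1 \<and> y = Suc (cnth xs 0)
      else if pfst f = 2 then psnd f < clen xs \<and> y = cnth xs (psnd f)
      else if pfst f = 3 then \<exists>ys\<le>b. clen ys = clen (psnd (psnd f)) \<and>
        (\<forall>l<clen (psnd (psnd f)). Q (entry (cnth (psnd (psnd f)) l) xs (cnth ys l))) \<and> Q (entry (pfst (psnd f)) ys y)
      else if pfst f = 4 then 0 < xs \<and>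
        (if chd xs = 0 then Q (entry (pfst (psnd f)) (ctl xs) y)
         else \<exists>v\<le>b. Q (entry f (ccons (chd xs - 1) (ctl xs)) v) \<and>
           Q (entry (psnd (psnd f)) (ccons (chd xs - 1) (ccons v (ctl xs))) y))
      else if pfst f = 5 then Q (entry (psnd f) (ccons y xs) 0) \<and> (\<forall>m<y. \<exists>v\<le>b. Q (entry (psnd f) (ccons m xs) (Suc v)))
      else False)"

lemma entry_less_list:
  assumes "entry f xs y \<in> set t" shows "f \<le> list_encode t" "xs \<le> list_encode t" "y \<le> list_encode t"
proof -
  have *: "x \<in> set t \<Longrightarrow> x \<le> list_encode t" for x t
  proof (induction t)
    case (Cons a t)
    then show ?case using le_prod_encode_1[of a "list_encode t"] le_prod_encode_2[of "list_encode t" a] by auto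
  qed simp
  have "f \<le> entry f xs y" "xs \<le> entry f xs y" "y \<le> entry f xs y"
    unfolding entry_def using le_prod_encode_1 le_prod_encode_2 by (meson le_trans)+
  with *[OF assms] show "f \<le> list_encode t" "xs \<le> list_encode t" "y \<le> list_encode t" by linarith+
qed

text \<open>The bound limits only existential witnesses, and each witness occurs in an entry
  satisfying \<open>Q\<close>. Any bound on the components of those entries will therefore
  do.\<close>

lemma justified_mono:
  assumes j: "justified b Q f xs y" and Q: "\<And>e. Q e \<Longrightarrow> Q' e"
    and b: "\<And>g zs v. Q (entry g zs v) \<Longrightarrow> zs \<le> b' \<and> v \<le> b'"
  shows "justified b' Q' f xs y"
proof -
  consider "pfst f \<notin> {3, 4, 5}" | "pfst f = 3" | "pfst f = 4" | "pfst f = 5" by blast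
  then show ?thesis
  proof cases
    case 1
    then show ?thesis using j by (auto simp: justified_def split: if_splits)
  next
    case 2
    then obtain ys where "clen ys = clen (psnd (psnd f))"
      "\<forall>l<clen (psnd (psnd f)). Q (entry (cnth (psnd (psnd f)) l) xs (cnth ys l))" "Q (entry (pfst (psnd f)) ys y)"
      using j by (auto simp: justified_def)
    moreover from this(3) have "ys \<le> b'" using b by blast
    ultimately have "\<exists>ys\<le>b'. clen ys = clen (psnd (psnd f)) \<and>
      (\<forall>l<clen (psnd (psnd f)). Q' (entry (cnth (psnd (psnd f)) l) xs (cnth ys l))) \<and> Q' (entry (pfst (psnd f)) ys y)"
      using Q by blast
    then show ?thesis using 2 by (simp add: justified_def)
  next
    case 3
    then show ?thesis using j Q b unfolding justified_def by (simp split: if_splits) blast+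
  next
    case 4
    have "\<exists>v\<le>b'. Q' (entry (psnd f) (ccons m xs) (Suc v))" if "m < y" for m
    proof -
      obtain v where "Q (entry (psnd f) (ccons m xs) (Suc v))" using j 4 \<open>m < y\<close> by (auto simp: justified_def)
      then show ?thesis using Q b Suc_leD by blast
    qed
    then show ?thesis using j 4 Q by (auto simp: justified_def)
  qed
qed

text \<open>A derivation in the style of Hilbert: each line follows from earlier ones. The bound may
  vary from line to line, which makes tables easy to concatenate; \<open>tablec\<close> later uses
  one bound for all lines.\<close>

definition valid_table :: "nat list \<Rightarrow> bool" where
  "valid_table t \<longleftrightarrow> (\<forall>i<length t. \<exists>f xs y b. t ! i = entry f xs y \<and> justified b (\<lambda>e. e \<in> set (take i t)) f xs y)"

lemma valid_table_Nil: "valid_table []"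
  by (simp add: valid_table_def)

lemma valid_table_append: "valid_table s \<Longrightarrow> valid_table t \<Longrightarrow> valid_table (s @ t)"
  unfolding valid_table_def
proof (intro allI impI)
  fix i
  assume s: "\<forall>i<length s. \<exists>f xs y b. s ! i = entry f xs y \<and> justified b (\<lambda>e. e \<in> set (take i s)) f xs y"
    and t: "\<forall>i<length t. \<exists>f xs y b. t ! i = entry f xs y \<and> justified b (\<lambda>e. e \<in> set (take i t)) f xs y"
    and i: "i < length (s @ t)"
  show "\<exists>f xs y b. (s @ t) ! i = entry f xs y \<and> justified b (\<lambda>e. e \<in> set (take i (s @ t))) f xs y"
  proof (cases "i < length s")
    case True
    then show ?thesis using s by (simp add: nth_append)
  next
    case False
    then have "i - length s < length t" using i by auto
    then obtain f xs y b where "t ! (i - length s) = entry f xs y"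
      "justified b (\<lambda>e. e \<in> set (take (i - length s) t)) f xs y" using t by blast
    moreover from this(2) have "justified (list_encode (take (i - length s) t)) (\<lambda>e. e \<in> set (take i (s @ t))) f xs y"
      by (rule justified_mono) (auto dest: entry_less_list)
    ultimately show ?thesis using False by (auto simp: nth_append)
  qed
qed

lemma valid_table_snoc: "valid_table t \<Longrightarrow> justified b (\<lambda>e. e \<in> set t) f xs y \<Longrightarrow> valid_table (t @ [entry f xs y])"
  unfolding valid_table_def by (auto simp: nth_append less_Suc_eq)

definition derivable :: "nat \<Rightarrow> bool" where
  "derivable e \<longleftrightarrow> (\<exists>t. valid_table t \<and> e \<in> set t)"

lemma derivable_finite: "(\<And>l::nat. l < n \<Longrightarrow> derivable (F l)) \<Longrightarrow> \<exists>t. valid_table t \<and> (\<forall>l<n. F l \<in> set t)"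
proof (induction n)
  case 0
  then show ?case using valid_table_Nil by blast
next
  case (Suc n)
  have "\<exists>t. valid_table t \<and> (\<forall>l<n. F l \<in> set t)" by (rule Suc.IH) (simp add: Suc.prems)
  then obtain t where t: "valid_table t" "\<forall>l<n. F l \<in> set t" by blast
  obtain s where s: "valid_table s" "F n \<in> set s" using Suc.prems[of n] unfolding derivable_def by auto
  show ?case using t s by (intro exI[of _ "t @ s"]) (auto simp: less_Suc_eq valid_table_append)
qed

lemma derivableI:
  fixes n :: nat
  assumes "\<And>l. l < n \<Longrightarrow> derivable (F l)" "justified b (\<lambda>e. \<exists>l<n. e = F l) f xs y"
  shows "derivable (entry f xs y)"
proof -
  obtain t where t: "valid_table t" "\<forall>l<n. F l \<in> set t" using derivable_finite[of n F] assms(1) by blast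
  have "justified (list_encode t) (\<lambda>e. e \<in> set t) f xs y"
    using assms(2)
  proof (rule justified_mono)
    show "e \<in> set t" if "\<exists>l<n. e = F l" for e using that t(2) by blast
    show "zs \<le> list_encode t \<and> v \<le> list_encode t" if "\<exists>l<n. entry g zs v = F l" for g zs v
    proof -
      have "entry g zs v \<in> set t" using that t(2) by auto
      from entry_less_list(2,3)[OF this] show ?thesis by simp
    qed
  qed
  from valid_table_snoc[OF t(1) this] show ?thesis unfolding derivable_def by force
qed

lemma those_map_Some:
  "those (map h gs) = Some ys \<longleftrightarrow> length ys = length gs \<and> (\<forall>l<length gs. h (gs ! l) = Some (ys ! l))"
proof (induction gs arbitrary: ys)
  case (Cons g gs)
  show ?case
  proof (cases ys)
    case Nil
    then show ?thesis by (auto split: option.split)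
  next
    case (Cons y ys')
    have "those (map h (g # gs)) = Some (y # ys') \<longleftrightarrow> h g = Some y \<and> those (map h gs) = Some ys'"
      by (auto split: option.split)
    also have "\<dots> \<longleftrightarrow> length (y # ys') = length (g # gs) \<and> (\<forall>l<length (g # gs). h ((g # gs) ! l) = Some ((y # ys') ! l))"
      unfolding Cons.IH by (auto simp: less_Suc_eq_0_disj)
    finally show ?thesis using Cons by simp
  qed
qed auto

text \<open>For a genuine program code every premise concerns a genuine program, namely a part of it
  or itself; and every number is the code of an argument list. Junk entries thus never enter the
  argument.\<close>

lemma justified_sound:
  assumes Q: "\<And>f xs y. Q (entry (rcode f) (list_encode xs) y) \<Longrightarrow> reval f xs = Some y"
    and j: "justified b Q (rcode f) (list_encode xs) y"
  shows "reval f xs = Some y"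
proof (cases f)
  case RZero
  then show ?thesis using j by (simp add: justified_def)
next
  case RSucc
  then have "length xs = 1" "y = Suc (cnth (list_encode xs) 0)" using j by (simp_all add: justified_def)
  moreover from this(1) obtain x where "xs = [x]" by (cases xs) auto
  moreover have "cnth (list_encode [x]) 0 = x" using cnth_encode[of 0 "[x]"] by (simp del: list_encode.simps)
  ultimately show ?thesis using RSucc by (simp del: list_encode.simps)
next
  case (RProj i)
  then have "i < length xs" "y = cnth (list_encode xs) i" using j by (simp_all add: justified_def)
  then show ?thesis using RProj by simp
next
  case (RComp g gs)
  then obtain ysc where ysc: "clen ysc = length gs"
    "\<And>l. l < length gs \<Longrightarrow> Q (entry (cnth (list_encode (map rcode gs)) l) (list_encode xs) (cnth ysc l))"
    "Q (entry (rcode g) ysc y)" using j by (auto simp: justified_def)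
  define ys where "ys = list_decode ysc"
  have "ysc = list_encode ys" by (simp add: ys_def)
  with ysc have ys: "length ys = length gs"
    "\<And>l. l < length gs \<Longrightarrow> Q (entry (rcode (gs ! l)) (list_encode xs) (ys ! l))" "Q (entry (rcode g) (list_encode ys) y)"
    by auto
  then have "those (map (\<lambda>g. reval g xs) gs) = Some ys" unfolding those_map_Some using Q by auto
  then show ?thesis using RComp Q[OF ys(3)] by simp
next
  case (RPrim g h)
  then have "xs \<noteq> []" using j by (auto simp: justified_def)
  then obtain n zs where xs: "xs = n # zs" by (cases xs) auto
  show ?thesis
  proof (cases n)
    case 0
    then have "Q (entry (rcode g) (list_encode zs) y)" using j RPrim xs by (auto simp: justified_def chd_def ctl_def)
    then show ?thesis using Q RPrim xs 0 by simp
  next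
    case (Suc m)
    then obtain v where "Q (entry (rcode f) (list_encode (m # zs)) v)"
      "Q (entry (rcode h) (list_encode (m # v # zs)) y)"
      using j RPrim xs by (auto simp: justified_def chd_def ctl_def ccons_def)
    then have "reval f (m # zs) = Some v" "reval h (m # v # zs) = Some y" using Q by blast+
    then show ?thesis using RPrim xs Suc by simp
  qed
next
  case (RMu g)
  then have "Q (entry (rcode g) (list_encode (y # xs)) 0)"
    "\<And>m. m < y \<Longrightarrow> \<exists>v. Q (entry (rcode g) (list_encode (m # xs)) (Suc v))"
    using j by (auto simp: justified_def ccons_def)
  then have *: "reval g (y # xs) = Some 0" "\<And>m. m < y \<Longrightarrow> \<exists>v. reval g (m # xs) = Some (Suc v)"
    using Q by blast+
  then have ex: "\<exists>n. reval g (n # xs) = Some 0 \<and> (\<forall>m<n. \<exists>y. reval g (m # xs) = Some (Suc y))" by blast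
  have "(LEAST n. reval g (n # xs) = Some 0) = y"
  proof (rule Least_equality)
    show "reval g (z # xs) = Some 0 \<Longrightarrow> y \<le> z" for z
      using *(2)[of z] by (cases "y \<le> z") auto
  qed (rule *(1))
  then show ?thesis using RMu ex by simp
qed

lemma reval_derivable: "reval f xs = Some y \<Longrightarrow> derivable (entry (rcode f) (list_encode xs) y)"
proof (induction f arbitrary: xs y)
  case RZero
  then show ?case by (intro derivableI[of 0 _ 0]) (simp_all add: justified_def)
next
  case RSucc
  then obtain x where "xs = [x]" "y = Suc x" by (auto split: list.splits)
  then have "justified 0 (\<lambda>e. \<exists>l<0. e = F l) (rcode RSucc) (list_encode xs) y" for F :: "nat \<Rightarrow> nat"
    using clen_encode[of "[x]"] cnth_encode[of 0 "[x]"] by (simp add: justified_def)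
  then show ?case by (intro derivableI[of 0]) simp
next
  case (RProj i)
  then have "i < length xs" "y = xs ! i" by (auto split: if_splits)
  then show ?case by (intro derivableI[of 0 _ 0]) (simp_all add: justified_def)
next
  case (RComp f gs)
  then obtain ys where ys: "those (map (\<lambda>g. reval g xs) gs) = Some ys" "reval f ys = Some y"
    by (auto simp: bind_eq_Some_conv)
  then have len: "length ys = length gs" and g: "\<And>l. l < length gs \<Longrightarrow> reval (gs ! l) xs = Some (ys ! l)"
    unfolding those_map_Some by auto
  \<comment> \<open>The premises of the step: the inner evaluations at indices below
    \<open>length gs\<close>, and the outer one at \<open>length gs\<close>.\<close>
  define F where "F l = (if l < length gs then entry (rcode (gs ! l)) (list_encode xs) (ys ! l)
    else entry (rcode f) (list_encode ys) y)" for l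
  show ?case
  proof (rule derivableI)
    show "l < Suc (length gs) \<Longrightarrow> derivable (F l)" for l
      using RComp.IH(1)[OF ys(2)] RComp.IH(2)[OF nth_mem g] by (simp add: F_def)
    have "\<exists>l'<Suc (length gs). entry (rcode (gs ! l)) (list_encode xs) (ys ! l) = F l'" if "l < length gs" for l
      using that by (intro exI[of _ l]) (simp add: F_def)
    moreover have "\<exists>l'<Suc (length gs). entry (rcode f) (list_encode ys) y = F l'"
      by (intro exI[of _ "length gs"]) (simp add: F_def)
    ultimately have "\<exists>ys'\<le>list_encode ys. clen ys' = clen (list_encode (map rcode gs)) \<and>
      (\<forall>l<clen (list_encode (map rcode gs)). \<exists>l'<Suc (length gs).
        entry (cnth (list_encode (map rcode gs)) l) (list_encode xs) (cnth ys' l) = F l') \<and>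
      (\<exists>l'<Suc (length gs). entry (rcode f) ys' y = F l')"
      using len by (intro exI[of _ "list_encode ys"]) simp
    then show "justified (list_encode ys) (\<lambda>e. \<exists>l<Suc (length gs). e = F l) (rcode (RComp f gs)) (list_encode xs) y"
      by (simp add: justified_def)
  qed
next
  case (RPrim f g)
  then obtain n zs where xs: "xs = n # zs" by (cases xs) auto
  \<comment> \<open>An inner induction on the recursion argument, because the premise for the
    previous value is about the same program.\<close>
  have "reval (RPrim f g) (n # zs) = Some y \<Longrightarrow> derivable (entry (rcode (RPrim f g)) (list_encode (n # zs)) y)"
  proof (induction n arbitrary: y)
    case 0
    have "justified 0 (\<lambda>e. \<exists>l<1::nat. e = entry (rcode f) (list_encode zs) y) (rcode (RPrim f g)) (list_encode (0 # zs)) y"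
      by (simp add: justified_def chd_def ctl_def)
    then show ?case by (rule derivableI[rotated]) (use 0 RPrim.IH(1) in simp)
  next
    case (Suc m)
    then obtain v where v: "reval (RPrim f g) (m # zs) = Some v" "reval g (m # v # zs) = Some y"
      by (auto simp: bind_eq_Some_conv)
    define F where "F l = (if l = 0 then entry (rcode (RPrim f g)) (list_encode (m # zs)) v
      else entry (rcode g) (list_encode (m # v # zs)) y)" for l :: nat
    show ?case
    proof (rule derivableI)
      show "l < 2 \<Longrightarrow> derivable (F l)" for l
        using Suc.IH[OF v(1)] RPrim.IH(2)[OF v(2)] by (simp add: F_def)
      have "\<exists>l<2. entry (rcode (RPrim f g)) (list_encode (m # zs)) v = F l"
        by (intro exI[of _ 0]) (simp add: F_def)
      moreover have "\<exists>l<2. entry (rcode g) (list_encode (m # v # zs)) y = F l"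
        by (intro exI[of _ 1]) (simp add: F_def)
      ultimately show "justified v (\<lambda>e. \<exists>l<2. e = F l) (rcode (RPrim f g)) (list_encode (Suc m # zs)) y"
        by (auto simp: justified_def chd_def ctl_def ccons_def)
    qed
  qed
  then show ?case using RPrim.prems xs by simp
next
  case (RMu f)
  have ex: "\<exists>n. reval f (n # xs) = Some 0 \<and> (\<forall>m<n. \<exists>y. reval f (m # xs) = Some (Suc y))"
    by (rule ccontr) (use RMu.prems in \<open>simp only: reval.simps if_False option.distinct\<close>)
  have y: "y = (LEAST n. reval f (n # xs) = Some 0)"
    using RMu.prems unfolding reval.simps if_P[OF ex] by simp
  from ex obtain n where n: "reval f (n # xs) = Some 0" "\<forall>m<n. \<exists>y. reval f (m # xs) = Some (Suc y)" by blast
  have "(LEAST n. reval f (n # xs) = Some 0) = n"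
  proof (rule Least_equality)
    show "reval f (z # xs) = Some 0 \<Longrightarrow> n \<le> z" for z
      using n(2)[rule_format, of z] by (cases "n \<le> z") auto
  qed (rule n(1))
  with y have [simp]: "y = n" by simp
  from n(2) obtain v where v: "\<And>m. m < n \<Longrightarrow> reval f (m # xs) = Some (Suc (v m))" by metis
  define F where "F l = entry (rcode f) (list_encode (l # xs)) (if l < n then Suc (v l) else 0)" for l
  have "derivable (F l)" if "l < Suc n" for l
    using that RMu.IH[OF n(1)] RMu.IH[OF v] by (auto simp: F_def less_Suc_eq)
  then obtain t where t: "valid_table t" "\<forall>l<Suc n. F l \<in> set t" using derivable_finite[of "Suc n" F] by blast
  have "justified (list_encode t) (\<lambda>e. e \<in> set t) (rcode (RMu f)) (list_encode xs) n"
  proof -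
    have "F n \<in> set t" "\<And>m. m < n \<Longrightarrow> F m \<in> set t" using t(2) by auto
    then have "entry (rcode f) (ccons n (list_encode xs)) 0 \<in> set t"
      "\<And>m. m < n \<Longrightarrow> entry (rcode f) (ccons m (list_encode xs)) (Suc (v m)) \<in> set t"
      by (simp_all add: F_def)
    moreover from this(2) have "\<And>m. m < n \<Longrightarrow> v m \<le> list_encode t" using entry_less_list(3) by fastforce
    ultimately show ?thesis by (auto simp: justified_def)
  qed
  from valid_table_snoc[OF t(1) this] show ?case unfolding derivable_def by force
qed

section \<open>Checkable certificates\<close>

text \<open>The code of the table bounds the components of its entries, so it can itself serve as
  bound for all witnesses, and the check becomes computable.\<close>

definition tablec :: "nat \<Rightarrow> bool" where
  "tablec t \<longleftrightarrow> (\<forall>i<clen t. justified t (\<lambda>e. \<exists>j<i. cnth t j = e)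
     (pfst (cnth t i)) (pfst (psnd (cnth t i))) (psnd (psnd (cnth t i))))"

lemma valid_table_tablec: "valid_table t \<Longrightarrow> tablec (list_encode t)"
  unfolding tablec_def clen_encode
proof (intro allI impI)
  fix i assume "valid_table t" and i: "i < length t"
  then obtain f xs y b where e: "t ! i = entry f xs y" "justified b (\<lambda>e. e \<in> set (take i t)) f xs y"
    unfolding valid_table_def by blast
  from e(2) have "justified (list_encode t) (\<lambda>e. \<exists>j<i. cnth (list_encode t) j = e) f xs y"
  proof (rule justified_mono)
    show "e \<in> set (take i t) \<Longrightarrow> \<exists>j<i. cnth (list_encode t) j = e" for e
      using i by (auto simp: in_set_conv_nth)
    show "entry g zs v \<in> set (take i t) \<Longrightarrow> zs \<le> list_encode t \<and> v \<le> list_encode t" for g zs v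
      using entry_less_list set_take_subset by (metis subsetD)
  qed
  then show "justified (list_encode t) (\<lambda>e. \<exists>j<i. cnth (list_encode t) j = e) (pfst (cnth (list_encode t) i))
      (pfst (psnd (cnth (list_encode t) i))) (psnd (psnd (cnth (list_encode t) i)))"
    using i e(1) by (simp add: entry_def)
qed

lemma tablec_sound: "tablec t \<Longrightarrow> i < clen t \<Longrightarrow> cnth t i = entry (rcode f) (list_encode xs) y \<Longrightarrow> reval f xs = Some y"
proof (induction i arbitrary: f xs y rule: less_induct)
  case (less i)
  have "justified t (\<lambda>e. \<exists>j<i. cnth t j = e) (rcode f) (list_encode xs) y"
    using less.prems unfolding tablec_def by (auto simp: entry_def)
  then show ?case
    by (rule justified_sound[rotated]) (use less in auto)
qed

lemma cpred_tablec: "cfun t \<Longrightarrow> cpred (\<lambda>x. tablec (t x))"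
proof -
  have "cpred (\<lambda>t. tablec t)" unfolding tablec_def justified_def entry_def by (intro cfun_intros)
  then show "cfun t \<Longrightarrow> cpred (\<lambda>x. tablec (t x))" by (rule cpred_comp)
qed

text \<open>The pair of a list of \<open>m + 4\<close> distinct inputs and a table showing that the
  program halts on them. The elements of index at most \<open>m + 2\<close> of an increasing
  sequence number \<open>m + 3\<close>, so \<open>m + 4\<close> elements include one of larger
  index. \<open>ccons x 0\<close> codes the one-element list.\<close>

definition certificate :: "nat \<Rightarrow> nat \<Rightarrow> nat \<Rightarrow> bool" where
  "certificate e m c \<longleftrightarrow> clen (pfst c) = m + 4 \<and> (\<forall>i<m + 4. \<forall>j<i. cnth (pfst c) i \<noteq> cnth (pfst c) j) \<and>
     tablec (psnd c) \<and> (\<forall>i<m + 4. \<exists>j<clen (psnd c). \<exists>y\<le>psnd c. cnth (psnd c) j = entry e (ccons (cnth (pfst c) i) 0) y)"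

lemma cpred_certificate: "cfun e \<Longrightarrow> cfun m \<Longrightarrow> cfun c \<Longrightarrow> cpred (\<lambda>x. certificate (e x) (m x) (c x))"
proof -
  assume e: "cfun e" and m: "cfun m" and c: "cfun c"
  show ?thesis unfolding certificate_def entry_def
    by (intro cfun_intros cpred_tablec e m c cfun_comp[OF e] cfun_comp[OF m] cfun_comp[OF c])
qed

text \<open>List codes bound their entries, which yields the decisive inequality
  \<open>x \<le> c\<close>.\<close>

lemma certificate_sound:
  assumes "certificate (rcode f) m c"
  shows "\<exists>X. finite X \<and> card X = m + 4 \<and> (\<forall>x\<in>X. x \<le> c \<and> reval f [x] \<noteq> None)"
proof -
  define xs where "xs = list_decode (pfst c)"
  have xs: "pfst c = list_encode xs" by (simp add: xs_def)
  have len: "length xs = m + 4" using assms by (simp add: certificate_def xs)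
  have "distinct xs"
    unfolding distinct_conv_nth
  proof (intro allI impI)
    fix i j assume "i < length xs" "j < length xs" "i \<noteq> j"
    then show "xs ! i \<noteq> xs ! j" using assms len unfolding certificate_def xs
      by (metis cnth_encode linorder_neqE_nat)
  qed
  moreover have "x \<le> c \<and> reval f [x] \<noteq> None" if "x \<in> set xs" for x
  proof -
    obtain i where i: "i < m + 4" "x = xs ! i" using \<open>x \<in> set xs\<close> len by (metis in_set_conv_nth)
    then obtain j y where "j < clen (psnd c)" "cnth (psnd c) j = entry (rcode f) (list_encode [x]) y"
      using assms len unfolding certificate_def xs by (auto simp: ccons_def)
    then have "reval f [x] = Some y" using assms tablec_sound unfolding certificate_def by blast
    moreover have "x \<le> list_encode xs" using \<open>x \<in> set xs\<close>
    proof (induction xs)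
      case (Cons a t)
      then show ?case using le_prod_encode_1[of a "list_encode t"] le_prod_encode_2[of "list_encode t" a] by auto
    qed simp
    ultimately show ?thesis using pfst_le[of c] xs by simp
  qed
  ultimately show ?thesis using len by (intro exI[of _ "set xs"]) (simp add: distinct_card)
qed

text \<open>Halting computations on \<open>m + 4\<close> members of the domain are merged into one
  table by concatenation.\<close>

lemma certificate_exists:
  assumes "infinite {x. reval f [x] \<noteq> None}" shows "\<exists>c. certificate (rcode f) m c"
proof -
  obtain X where X: "X \<subseteq> {x. reval f [x] \<noteq> None}" "finite X" "card X = m + 4"
    using infinite_arbitrarily_large[OF assms] by blast
  obtain xs where xs: "set xs = X" "distinct xs" using finite_distinct_list[OF X(2)] by blast
  have len: "length xs = m + 4" using xs X(3) distinct_card by fastforce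
  have "\<exists>y. reval f [xs ! i] = Some y" if "i < m + 4" for i
    using X(1) xs(1) len that nth_mem[of i xs] by auto
  then obtain y where y: "\<And>i. i < m + 4 \<Longrightarrow> reval f [xs ! i] = Some (y i)" by metis
  obtain t where t: "valid_table t" "\<forall>i<m + 4. entry (rcode f) (list_encode [xs ! i]) (y i) \<in> set t"
    using derivable_finite[of "m + 4" "\<lambda>i. entry (rcode f) (list_encode [xs ! i]) (y i)"] reval_derivable[OF y] by blast
  have "certificate (rcode f) m (prod_encode (list_encode xs, list_encode t))"
    unfolding certificate_def pfst_encode psnd_encode
  proof (intro conjI allI impI valid_table_tablec t(1))
    show "clen (list_encode xs) = m + 4" by (simp add: len)
    show "cnth (list_encode xs) i \<noteq> cnth (list_encode xs) j" if "i < m + 4" "j < i" for i j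
      using that len xs(2) by (simp add: nth_eq_iff_index_eq)
    show "\<exists>j<clen (list_encode t). \<exists>y\<le>list_encode t. cnth (list_encode t) j = entry (rcode f) (ccons (cnth (list_encode xs) i) 0) y"
      if "i < m + 4" for i
    proof -
      have m: "entry (rcode f) (list_encode [xs ! i]) (y i) \<in> set t" using t(2) that by blast
      then obtain j where "j < length t" "t ! j = entry (rcode f) (list_encode [xs ! i]) (y i)"
        by (metis in_set_conv_nth)
      moreover have "y i \<le> list_encode t" using entry_less_list(3)[OF m] .
      ultimately show ?thesis using that len by (intro exI[of _ j] conjI exI[of _ "y i"]) (simp_all add: ccons_def)
    qed
  qed
  then show ?thesis by blast
qed


section \<open>The word\<close>

text \<open>Minimality leaves at most one \<open>c\<close> per pair (e, m), which is what bounds the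
  dead blocks for a given \<open>pfst s\<close>. After the choice of \<open>c\<close> everything is
  bounded, so death is recursively enumerable.\<close>

definition dead :: "nat \<Rightarrow> bool" where
  "dead s \<longleftrightarrow> (\<exists>c. s < c \<and> (\<exists>e\<le>pfst s. \<exists>m\<le>pfst s. certificate e m c \<and> (\<forall>c'<c. \<not> certificate e m c')))"

text \<open>
  \<^const>\<open>prod_encode\<close> runs through the diagonals, so \<open>prod_encode (j,
  r)\<close> is the position with offset \<open>j\<close> in the block \<open>j + r\<close>,
  whose length is \<open>j + r + 1\<close>.
\<close>

definition xi_nat :: "nat \<Rightarrow> bool" where
  "xi_nat i \<longleftrightarrow> pfst i \<notin> set_decode (pfst (pfst i + psnd i)) \<or> dead (pfst i + psnd i)"

definition xi :: "int \<Rightarrow> bool" where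
  "xi p \<longleftrightarrow> xi_nat (nat \<bar>p\<bar>)"

lemma re_word_xi: "re_word xi"
proof -
  \<comment> \<open>The coded position is \<open>x div 2\<close> in absolute value, odd codes
    standing for negative positions; the only unbounded quantifier of \<open>dead\<close> is moved
    to the front.\<close>
  let ?P = "\<lambda>c x. (even x \<or> 0 < x div 2) \<and>
    (pfst (x div 2) \<notin> set_decode (pfst (pfst (x div 2) + psnd (x div 2))) \<or>
     pfst (x div 2) + psnd (x div 2) < c \<and>
     (\<exists>e\<le>pfst (pfst (x div 2) + psnd (x div 2)). \<exists>m\<le>pfst (pfst (x div 2) + psnd (x div 2)).
       certificate e m c \<and> (\<forall>c'<c. \<not> certificate e m c')))"
  have "re_set {x. \<exists>c. ?P c x}"
    by (rule re_set_ex) (intro cfun_intros cpred_certificate)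
  also have "{x. \<exists>c. ?P c x} = {x. (even x \<or> 0 < x div 2) \<and> xi_nat (x div 2)}"
    unfolding xi_nat_def dead_def by (simp only: ex_simps)
  also have "\<dots> = {2 * i |i. xi (int i)} \<union> {2 * i + 1 |i. 0 < i \<and> xi (- int i)}"
  proof (intro set_eqI iffI)
    fix x assume x: "x \<in> {x. (even x \<or> 0 < x div 2) \<and> xi_nat (x div 2)}"
    show "x \<in> {2 * i |i. xi (int i)} \<union> {2 * i + 1 |i. 0 < i \<and> xi (- int i)}"
    proof (cases "even x")
      case True
      then have "x = 2 * (x div 2)" by simp
      then show ?thesis using x by (auto simp: xi_def)
    next
      case False
      then have "x = 2 * (x div 2) + 1" by simp
      moreover have "0 < x div 2" "xi (- int (x div 2))" using x False by (auto simp: xi_def)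
      ultimately show ?thesis by blast
    qed
  qed (auto simp: xi_def)
  finally show ?thesis unfolding re_word_def .
qed

text \<open>Only finitely many pairs (e, m) can strike blocks with first component \<open>n\<close>;
  beyond the largest of their least certificates none does.\<close>

lemma eventually_alive: "\<exists>S. \<forall>s\<ge>S. pfst s = n \<longrightarrow> \<not> dead s"
proof -
  define S where "S = Max ((\<lambda>(e, m). LEAST c. certificate e m c) ` ({..n} \<times> {..n}))"
  have "\<not> dead s" if s: "S \<le> s" "pfst s = n" for s
  proof
    assume "dead s"
    then obtain c e m where c: "s < c" "e \<le> n" "m \<le> n" "certificate e m c" "\<forall>c'<c. \<not> certificate e m c'"
      unfolding dead_def s(2) by blast
    then have "(LEAST c. certificate e m c) = c" by (intro Least_equality) (auto simp: not_less)
    moreover have "(LEAST c. certificate e m c) \<le> S" unfolding S_def using c(2,3) by (intro Max_ge) auto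
    ultimately show False using c(1) s(1) by linarith
  qed
  then show ?thesis by blast
qed

lemma xi_right: "\<exists>p>b. occurs xi p w"
proof -
  \<comment> \<open>\<open>n\<close> codes the positions of zeros in \<open>w\<close>; the rest of
    the block is filled with ones.\<close>
  define n where "n = set_encode {j. j < length w \<and> \<not> w ! j}"
  have n: "set_decode n = {j. j < length w \<and> \<not> w ! j}" by (simp add: n_def)
  obtain S where S: "\<And>s. S \<le> s \<Longrightarrow> pfst s = n \<Longrightarrow> \<not> dead s" using eventually_alive by blast
  \<comment> \<open>The second component makes the block late enough to be alive, long enough for
    \<open>w\<close>, and situated beyond \<open>b\<close>.\<close>
  define s where "s = prod_encode (n, max S (max (length w) (nat b + 1)))"
  have s: "S \<le> s" "length w \<le> s" "nat b + 1 \<le> s"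
    using le_prod_encode_2[of "max S (max (length w) (nat b + 1))" n] by (simp_all add: s_def)
  have al: "pfst s = n" "\<not> dead s" using S[OF s(1)] by (simp_all add: s_def)
  have "xi (int (prod_encode (0, s)) + int i) = w ! i" if "i < length w" for i
  proof -
    have "prod_encode (0, s) + i = prod_encode (i, s - i)" using that s(2) by (simp add: prod_encode_def)
    then have "xi (int (prod_encode (0, s)) + int i) = xi_nat (prod_encode (i, s - i))"
      unfolding xi_def by (simp flip: of_nat_add)
    also have "\<dots> \<longleftrightarrow> w ! i" using that s(2) al n by (simp add: xi_nat_def)
    finally show ?thesis .
  qed
  moreover have "b < int (prod_encode (0, s))" using s(3) le_prod_encode_2[of s 0] by linarith
  ultimately show ?thesis unfolding occurs_def by blast
qed

lemma xi_left: "\<exists>p<b. occurs xi p w"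
proof -
  \<comment> \<open>The word is symmetric about 0, so an occurrence of the reversed word on the
    right reflects to one of \<open>w\<close> on the left.\<close>
  obtain p where p: "\<bar>b\<bar> + 1 < p" "occurs xi p (rev w)" using xi_right by blast
  have "xi (- (p + int (length w) - 1) + int i) = w ! i" if "i < length w" for i
  proof -
    have "- (p + int (length w) - 1) + int i = - (p + int (length w - 1 - i))"
      using that by (simp add: of_nat_diff)
    then have "xi (- (p + int (length w) - 1) + int i) = xi (p + int (length w - 1 - i))"
      by (simp only: xi_def abs_minus_cancel)
    also have "\<dots> = rev w ! (length w - 1 - i)"
    proof -
      have "length w - 1 - i < length (rev w)" using that by simp
      then show ?thesis using p(2) unfolding occurs_def by blast
    qed
    also have "\<dots> = w ! i" using that by (simp add: rev_nth)
    finally show ?thesis .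
  qed
  moreover have "- (p + int (length w) - 1) < b" using p(1) by linarith
  ultimately show ?thesis unfolding occurs_def by blast
qed

lemma rich_xi: "rich xi"
  unfolding rich_def using xi_left xi_right by blast

lemma occurs_factor:
  "occurs \<xi> p w \<Longrightarrow> factor \<xi> p (p + int (length w) - 1) = w"
  unfolding factor_def occurs_def by (rule nth_equalityI) (simp_all add: nth_upto)

lemma rich_recurrent:
  assumes "rich \<xi>" shows "recurrent \<xi>"
proof -
  have "w \<in> factors \<xi> I" if "\<exists>p. occurs \<xi> p w \<and> {p..p + int (length w) - 1} \<subseteq> I" for w I
  proof (cases "w = []")
    case False
    then show ?thesis using that occurs_factor unfolding factors_def
      by (smt (verit) insertCI mem_Collect_eq length_greater_0_conv of_nat_0_less_iff)
  qed (simp add: factors_def)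
  note * = this
  have "factors \<xi> UNIV = UNIV" "factors \<xi> {..i} = UNIV" "factors \<xi> {i..} = UNIV" for i
  proof -
    show "factors \<xi> UNIV = UNIV" using * assms unfolding rich_def by blast
    show "factors \<xi> {i..} = UNIV"
    proof (rule UNIV_eq_I[symmetric], rule *)
      fix w
      obtain p where "i < p" "occurs \<xi> p w" using assms unfolding rich_def by blast
      then show "\<exists>p. occurs \<xi> p w \<and> {p..p + int (length w) - 1} \<subseteq> {i..}" by (intro exI[of _ p]) auto
    qed
    show "factors \<xi> {..i} = UNIV"
    proof (rule UNIV_eq_I[symmetric], rule *)
      fix w
      obtain p where "p < i - int (length w)" "occurs \<xi> p w" using assms unfolding rich_def by blast
      then show "\<exists>p. occurs \<xi> p w \<and> {p..p + int (length w) - 1} \<subseteq> {..i}" by (intro exI[of _ p]) auto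
    qed
  qed
  then show ?thesis unfolding recurrent_def by simp
qed

section \<open>Runs of zeros expressed by formulas of small rank\<close>

text \<open>Variable 0 is reserved for the position in between; hence \<open>x\<close> and
  \<open>y\<close> are to be positive.\<close>

definition next_pos :: "nat \<Rightarrow> nat \<Rightarrow> mso" where
  "next_pos x y = Conj (Conj (Le x y) (Neg (Eq x y)))
     (Neg (ExElem 0 (Conj (Conj (Le x 0) (Neg (Eq x 0))) (Conj (Le 0 y) (Neg (Eq 0 y))))))"

text \<open>Variable \<open>m + 1\<close> holds the start of a run of \<open>m + 1\<close> zeros,
  and the indices count down along the run.\<close>

primrec zero_run :: "nat \<Rightarrow> mso" where
  "zero_run 0 = Neg (InP 1)"
| "zero_run (Suc m) = Conj (Neg (InP (m + 2))) (ExElem (m + 1) (Conj (next_pos (m + 2) (m + 1)) (zero_run m)))"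

lemma free_zero_run: "free_elem (zero_run m) = {m + 1}" "free_set (zero_run m) = {}"
  by (induction m) (auto simp: next_pos_def)

lemma qrank_zero_run: "qrank (zero_run m) \<le> m + 1"
  by (induction m) (auto simp: next_pos_def)

lemma sat_next_pos:
  assumes "0 < x" "0 < y" "e x < n" "e y < n"
  shows "sat {..<n} P e E (next_pos x y) \<longleftrightarrow> e y = Suc (e x)"
proof -
  have "sat {..<n} P e E (next_pos x y) \<longleftrightarrow>
      (e x \<le> e y \<and> e x \<noteq> e y) \<and> \<not> (\<exists>d\<in>{..<n}. (e x \<le> d \<and> e x \<noteq> d) \<and> (d \<le> e y \<and> d \<noteq> e y))"
    (is "_ \<longleftrightarrow> ?R") using assms(1,2) unfolding next_pos_def sat.simps by simp
  also have "?R \<longleftrightarrow> e y = Suc (e x)"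
  proof
    assume *: ?R
    have "\<not> Suc (e x) < e y"
    proof
      assume "Suc (e x) < e y"
      then have "Suc (e x) \<in> {..<n}" "(e x \<le> Suc (e x) \<and> e x \<noteq> Suc (e x)) \<and> (Suc (e x) \<le> e y \<and> Suc (e x) \<noteq> e y)"
        using assms(4) by auto
      then show False using * by blast
    qed
    then show "e y = Suc (e x)" using * by linarith
  qed auto
  finally show ?thesis .
qed

lemma sat_zero_run:
  "e (m + 1) < n \<Longrightarrow> sat {..<n} P e E (zero_run m) \<longleftrightarrow> e (m + 1) + m < n \<and> (\<forall>i\<le>m. \<not> P (e (m + 1) + i))"
proof (induction m arbitrary: e)
  case (Suc m)
  let ?p = "e (m + 2)"
  have p: "?p < n" using Suc.prems by simp
  have "sat {..<n} P e E (zero_run (Suc m)) \<longleftrightarrow> \<not> P ?p \<and>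
    (\<exists>d<n. sat {..<n} P (e(m + 1 := d)) E (next_pos (m + 2) (m + 1)) \<and> sat {..<n} P (e(m + 1 := d)) E (zero_run m))"
    by auto
  also have "\<dots> \<longleftrightarrow> \<not> P ?p \<and> (\<exists>d<n. d = Suc ?p \<and> d + m < n \<and> (\<forall>i\<le>m. \<not> P (d + i)))"
  proof -
    have "sat {..<n} P (e(m + 1 := d)) E (next_pos (m + 2) (m + 1)) \<longleftrightarrow> d = Suc ?p"
      "sat {..<n} P (e(m + 1 := d)) E (zero_run m) \<longleftrightarrow> d + m < n \<and> (\<forall>i\<le>m. \<not> P (d + i))" if "d < n" for d
      by (subst sat_next_pos; use that p in simp) (subst Suc.IH; use that in simp)
    then show ?thesis by blast
  qed
  also have "\<dots> \<longleftrightarrow> ?p + Suc m < n \<and> (\<forall>i\<le>Suc m. \<not> P (?p + i))"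
  proof -
    have "(\<forall>i\<le>Suc m. \<not> P (?p + i)) \<longleftrightarrow> \<not> P ?p \<and> (\<forall>i\<le>m. \<not> P (Suc ?p + i))"
    proof
      assume *: "\<forall>i\<le>Suc m. \<not> P (?p + i)"
      have "\<not> P (Suc ?p + i)" if "i \<le> m" for i using *[rule_format, of "Suc i"] that by simp
      then show "\<not> P ?p \<and> (\<forall>i\<le>m. \<not> P (Suc ?p + i))" using *[rule_format, of 0] by simp
    next
      assume *: "\<not> P ?p \<and> (\<forall>i\<le>m. \<not> P (Suc ?p + i))"
      have "\<not> P (?p + i)" if "i \<le> Suc m" for i using * that by (cases i) auto
      then show "\<forall>i\<le>Suc m. \<not> P (?p + i)" by blast
    qed
    then show ?thesis by auto
  qed
  finally show ?case by simp
qed simp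

lemma word_models_zero_run:
  "word_models u (ExElem (m + 1) (zero_run m)) \<longleftrightarrow> (\<exists>p. p + m < length u \<and> (\<forall>i\<le>m. \<not> u ! (p + i)))"
proof -
  have "sat {..<length u} (\<lambda>i. u ! i) e E (ExElem (m + 1) (zero_run m)) \<longleftrightarrow>
    (\<exists>p. p + m < length u \<and> (\<forall>i\<le>m. \<not> u ! (p + i)))" for e E
  proof -
    have "sat {..<length u} (\<lambda>i. u ! i) e E (ExElem (m + 1) (zero_run m)) \<longleftrightarrow>
      (\<exists>p<length u. p + m < length u \<and> (\<forall>i\<le>m. \<not> u ! (p + i)))"
      by (simp only: sat.simps) (simp add: sat_zero_run[of "e(m + 1 := _)" m, simplified] Bex_def)
    then show ?thesis by (meson add_lessD1)
  qed
  then show ?thesis unfolding word_models_def models_def by blast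
qed

lemma factor_zero_run:
  assumes "a \<le> b"
  shows "word_models (factor \<xi> a (b - 1)) (ExElem (m + 1) (zero_run m)) \<longleftrightarrow>
    (\<exists>p\<ge>a. p + int m < b \<and> (\<forall>i\<le>m. \<not> \<xi> (p + int i)))"
proof -
  have len: "length (factor \<xi> a (b - 1)) = nat (b - a)" by (simp add: factor_def)
  have nth: "factor \<xi> a (b - 1) ! i = \<xi> (a + int i)" if "i < nat (b - a)" for i
    using that by (simp add: factor_def nth_upto)
  show ?thesis
    unfolding word_models_zero_run len
  proof
    assume "\<exists>p. p + m < nat (b - a) \<and> (\<forall>i\<le>m. \<not> factor \<xi> a (b - 1) ! (p + i))"
    then obtain p where "p + m < nat (b - a)" "\<forall>i\<le>m. \<not> factor \<xi> a (b - 1) ! (p + i)" by blast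
    then show "\<exists>p\<ge>a. p + int m < b \<and> (\<forall>i\<le>m. \<not> \<xi> (p + int i))"
      using nth by (intro exI[of _ "a + int p"]) (auto simp: add.assoc)
  next
    assume "\<exists>p\<ge>a. p + int m < b \<and> (\<forall>i\<le>m. \<not> \<xi> (p + int i))"
    then obtain p where "a \<le> p" "p + int m < b" "\<forall>i\<le>m. \<not> \<xi> (p + int i)" by blast
    then show "\<exists>p. p + m < nat (b - a) \<and> (\<forall>i\<le>m. \<not> factor \<xi> a (b - 1) ! (p + i))"
      using nth by (intro exI[of _ "nat (p - a)"]) auto
  qed
qed

text \<open>Richness puts a run of zeros somewhere after \<open>hp (m + 2)\<close>, hence before
  some \<open>hp j\<close>; homogeneity carries it back to the interval ending at
  \<open>hp (m + 3)\<close>. The rank is at most \<open>m + 2\<close>: one quantifier for each of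
  the \<open>m + 1\<close> positions and one inside \<open>next_pos\<close>.\<close>

lemma uniformly_homogeneous_zero_run:
  assumes \<xi>: "rich \<xi>" and hp: "strict_mono (hp :: nat \<Rightarrow> int)"
    and hom: "homogeneous (m + 2) \<xi> HL (hp ` {m + 2..})"
  shows "\<exists>p\<ge>hp (m + 2). p + int m < hp (m + 3) \<and> (\<forall>i\<le>m. \<not> \<xi> (p + int i))"
proof -
  let ?\<phi> = "ExElem (m + 1) (zero_run m)"
  have \<phi>: "sentence ?\<phi>" "qrank ?\<phi> \<le> m + 2"
    using qrank_zero_run[of m] by (auto simp: sentence_def free_zero_run)
  obtain w where "\<forall>i\<in>hp ` {m + 2..}. \<forall>j\<in>hp ` {m + 2..}. i < j \<longrightarrow> k_equiv (m + 2) (factor \<xi> i (j - 1)) w"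
    using hom unfolding homogeneous_def homogeneous_factorisation_def by blast
  then have eq: "word_models (factor \<xi> (hp (m + 2)) (hp j - 1)) ?\<phi> \<longleftrightarrow> word_models w ?\<phi>" if "m + 2 < j" for j
    using \<phi> that hp unfolding k_equiv_def by (simp add: strict_mono_less)
  have le: "hp (m + 2) \<le> hp j" if "m + 2 < j" for j using that hp by (simp add: strict_mono_less_eq)
  obtain p where p: "hp (m + 2) < p" "occurs \<xi> p (replicate (m + 1) False)" using \<xi> unfolding rich_def by blast
  have ge: "hp 0 + int j \<le> hp j" for j
  proof (induction j)
    case (Suc j)
    have "hp j < hp (Suc j)" using hp by (simp add: strict_mono_less)
    then show ?case using Suc by simp
  qed simp
  \<comment> \<open>As \<open>hp\<close> grows by at least 1 per step, this index passes the end of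
    the run; the summand \<open>m + 3\<close> ensures \<open>m + 2 < j\<close>.\<close>
  define j where "j = nat (p + int m - hp 0) + m + 3"
  have "p + int m - hp 0 \<le> int (nat (p + int m - hp 0))" by simp
  then have "p + int m < hp 0 + int j" unfolding j_def of_nat_add by linarith
  then have "p + int m < hp j" using ge[of j] by linarith
  moreover have "\<not> \<xi> (p + int i)" if "i \<le> m" for i
  proof -
    have "\<xi> (p + int i) = replicate (m + 1) False ! i" using p(2) that unfolding occurs_def by simp
    then show ?thesis using that by (simp del: replicate.simps)
  qed
  ultimately have "\<exists>p\<ge>hp (m + 2). p + int m < hp j \<and> (\<forall>i\<le>m. \<not> \<xi> (p + int i))"
    using p(1) by (intro exI[of _ p]) auto
  moreover have "m + 2 < j" by (simp add: j_def)
  ultimately have "word_models (factor \<xi> (hp (m + 2)) (hp j - 1)) ?\<phi>"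
    using factor_zero_run[OF le, of j \<xi> m] by blast
  then have "word_models (factor \<xi> (hp (m + 2)) (hp (m + 3) - 1)) ?\<phi>" using eq[of j] eq[of "m + 3"] by (simp add: j_def)
  then show ?thesis using factor_zero_run[OF le[of "m + 3"], of \<xi> m] by simp
qed

text \<open>Every block ends in a one, so a run of zeros stays inside one block, which must be
  alive. Its last offset, at least \<open>m\<close>, belongs to the set coded by
  \<open>pfst s\<close> and is therefore smaller than \<open>pfst s\<close>.\<close>

lemma xi_nat_zero_run:
  assumes "\<forall>i\<le>m. \<not> xi_nat (q + i)"
  shows "\<exists>s. s \<le> q \<and> m \<le> pfst s \<and> \<not> dead s"
proof -
  let ?s = "pfst q + psnd q"
  have z: "pfst p \<in> set_decode (pfst (pfst p + psnd p))" "\<not> dead (pfst p + psnd p)" if "\<not> xi_nat p" for p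
    using that by (auto simp: xi_nat_def)
  have "q + i = prod_encode (pfst q + i, psnd q - i) \<and> i \<le> psnd q" if "i \<le> m" for i
    using that
  proof (induction i)
    case (Suc i)
    then have i: "q + i = prod_encode (pfst q + i, psnd q - i)" "i \<le> psnd q" by auto
    have "psnd q - i \<noteq> 0"
    proof
      assume 0: "psnd q - i = 0"
      \<comment> \<open>At the end of the block the offset equals the block number b, and a zero
        there would require b to be less than \<open>pfst b\<close>, which is at most b.\<close>
      have "pfst q + i \<in> set_decode (pfst (pfst q + i))"
      proof -
        have "\<not> xi_nat (q + i)" using assms Suc.prems by simp
        from z(1)[OF this] show ?thesis unfolding i(1) 0 by simp
      qed
      then have "pfst q + i < pfst (pfst q + i)" by (rule set_decode_less)
      then show False using pfst_le[of "pfst q + i"] by linarith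
    qed
    then obtain r where r: "psnd q - i = Suc r" by (cases "psnd q - i") auto
    have "q + Suc i = Suc (prod_encode (pfst q + i, Suc r))" using i(1) r by simp
    also have "\<dots> = prod_encode (pfst q + Suc i, r)" by (simp add: prod_encode_def)
    also have "r = psnd q - Suc i" using r by simp
    finally show ?case using r by simp
  qed simp
  then have qm: "q + m = prod_encode (pfst q + m, psnd q - m)" "m \<le> psnd q" by auto
  then have "pfst q + m \<in> set_decode (pfst ?s)" "\<not> dead ?s"
  proof -
    have "\<not> xi_nat (q + m)" using assms by simp
    from z[OF this] show "pfst q + m \<in> set_decode (pfst ?s)" "\<not> dead ?s" unfolding qm(1) using qm(2) by simp_all
  qed
  moreover have "?s \<le> q"
    using pfst_psnd_triangle[of q] by (cases "pfst q + psnd q") auto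
  ultimately show ?thesis using set_decode_less[of "pfst q + m" "pfst ?s"] by (intro exI[of _ ?s]) simp
qed

lemma int_decode_le: "int_decode n \<le> int n"
  unfolding int_decode_def by (cases "sum_decode n") (auto simp: sum_decode_def split: if_splits)

lemma no_re_homogeneous:
  assumes re: "re_int_set (range hp)" and hp: "strict_mono (hp :: nat \<Rightarrow> int)"
    and hom: "\<And>k. homogeneous k xi (HL k) (hp ` {k..})"
  shows False
proof -
  obtain f where f: "int_encode ` range hp = {n. reval f [n] \<noteq> None}"
    using re unfolding re_int_set_def re_set_def by blast
  have ge: "hp 0 + int j \<le> hp j" for j
  proof (induction j)
    case (Suc j)
    have "hp j < hp (Suc j)" using hp by (simp add: strict_mono_less)
    then show ?case using Suc by simp
  qed simp
  have inf: "infinite {n. reval f [n] \<noteq> None}"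
    unfolding f[symmetric] using hp
    by (metis finite_imageD infinite_UNIV_nat inj_int_encode strict_mono_imp_inj_on)
  \<comment> \<open>The first component lets the program qualify in blocks with
    \<open>m \<le> pfst s\<close>; the second makes \<open>hp (m + 2)\<close> nonnegative, so that
    the run lies where the block structure of \<open>xi_nat\<close> applies directly.\<close>
  define m where "m = max (rcode f) (nat \<bar>hp 0\<bar>)"
  obtain p where p: "hp (m + 2) \<le> p" "p + int m < hp (m + 3)" "\<forall>i\<le>m. \<not> xi (p + int i)"
    using uniformly_homogeneous_zero_run[OF rich_xi hp hom] by blast
  have p0: "0 \<le> p" using ge[of "m + 2"] p(1) by (simp add: m_def)
  have "\<not> xi_nat (nat p + i)" if "i \<le> m" for i
    using p(3) p0 that by (simp add: xi_def nat_add_distrib)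
  then obtain s where s: "s \<le> nat p" "m \<le> pfst s" "\<not> dead s" using xi_nat_zero_run[of m "nat p"] by blast
  define c where "c = (LEAST c. certificate (rcode f) m c)"
  have c: "certificate (rcode f) m c" unfolding c_def using certificate_exists[OF inf] by (rule LeastI_ex)
  have "\<forall>c'<c. \<not> certificate (rcode f) m c'" unfolding c_def by (auto dest: not_less_Least)
  moreover have "rcode f \<le> pfst s" using s(2) by (simp add: m_def)
  \<comment> \<open>A least certificate beyond \<open>s\<close> would have killed the block.\<close>
  ultimately have "c \<le> s" using s(2,3) c unfolding dead_def by (meson not_less)
  obtain X where X: "finite X" "card X = m + 4" "\<And>x. x \<in> X \<Longrightarrow> x \<le> c \<and> reval f [x] \<noteq> None"
    using certificate_sound[OF c] by blast
  have "x \<in> (\<lambda>j. int_encode (hp j)) ` {..<m + 3}" if "x \<in> X" for x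
  proof -
    have "x \<in> int_encode ` range hp" using X(3)[OF that] f by simp
    then obtain j where j: "x = int_encode (hp j)" by auto
    have "hp j = int_decode x" by (simp add: j)
    also have "\<dots> \<le> int c" using int_decode_le[of x] X(3)[OF that] by linarith
    also have "\<dots> < hp (m + 3)" using \<open>c \<le> s\<close> s(1) p0 p(2) by linarith
    finally have "j < m + 3" using hp by (simp add: strict_mono_less)
    then show ?thesis using j by blast
  qed
  then have "card X \<le> card ((\<lambda>j. int_encode (hp j)) ` {..<m + 3})" by (intro card_mono) auto
  also have "\<dots> \<le> m + 3" using card_image_le[of "{..<m + 3}"] by force
  finally show False using X(2) by simp
qed

theorem theorem5p20:
  shows "\<exists>\<xi> :: int \<Rightarrow> bool.
    recurrent \<xi> \<and> re_word \<xi> \<and> decidable_mso_theory \<xi> \<and>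
    \<not> (\<exists>HL HR. re_int_set HL \<and> re_int_set HR \<and> uniformly_homogeneous \<xi> HL HR)"
proof (intro exI conjI)
  show "recurrent xi" by (rule rich_recurrent[OF rich_xi])
  show "re_word xi" by (rule re_word_xi)
  show "decidable_mso_theory xi" by (rule rich_decidable[OF rich_xi])
  show "\<not> (\<exists>HL HR. re_int_set HL \<and> re_int_set HR \<and> uniformly_homogeneous xi HL HR)"
  proof
    assume "\<exists>HL HR. re_int_set HL \<and> re_int_set HR \<and> uniformly_homogeneous xi HL HR"
    then obtain HR and hm hp :: "nat \<Rightarrow> int" where "re_int_set HR" "strict_mono hp" "HR = range hp"
      "\<And>k. homogeneous k xi (hm ` {k..}) (hp ` {k..})"
      unfolding uniformly_homogeneous_def by blast
    then show False using no_re_homogeneous[of hp "\<lambda>k. hm ` {k..}"] by simp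
  qed
qed

end
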